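(* Let $\widehat{\mathfrak g}$ be an affine Kac-Moody Lie algebra of type $(ADE)^{(1)}$ with Cartan matrix $(a_{ij})_{i,j=0}^n$, let $L$ be a restricted $U_q(\widehat{\mathfrak g})$-module, fix a sign $\pm$ (the same throughout) and set $\mathsf q=q^{\pm2}$. For every $(\alpha_1,\dots,\alpha_n)\in(\mathbb Z_{\ge0})^{n}$ there exists a unique smallest graded nonlocal $\mathsf q$-vertex algebra $(V,Y,\mathbf 1)$ (inside $\mathcal E(L)_t$) generated by (i.e. containing) the set $$\left\{x_{i}^{\pm}(z)\otimes t^{\alpha_i}\,:\,i=1,2,\dots,n\right\}\subset\mathcal E(L)_t .$$ Furthermore, $V$ is spanned by $$\left\{(x_{i_1}^{\pm}(z)\otimes t^{\alpha_{i_1}})_{r_1}\cdots (x_{i_m}^{\pm}(z)\otimes t^{\alpha_{i_m}})_{r_m}\mathbf 1\,:\,1\leq i_j\leq n,\ r_j<0,\ j=1,\dots,m,\ m\in\mathbb{Z}_{\geq 0}\right\}.$$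
   Context: Quantum affine algebra (Drinfeld realization, simply laced case). $q$ is an indeterminate, $[m]=(q^m-q^{-m})/(q-q^{-1})$, with corresponding factorials and (symmetric) binomials $\binom{m}{s}_q=[m][m-1]\cdots[m-s+1]/[s]!$. $U_q(\widehat{\mathfrak g})$ is the unital associative algebra over $\mathbb C(q^{1/2})$ generated by $x_i^\pm(k)$, $a_i(l)$, $K_i^{\pm1}$, $\gamma^{\pm1/2}$, $q^{\pm d}$ ($1\le i\le n$, $k,l\in\mathbb Z$, $l\ne0$) with relations: $\gamma^{\pm1/2}$ central; $K_iK_j=K_jK_i$, $K_iK_i^{-1}=K_i^{-1}K_i=1$; $[a_i(k),a_j(l)]=\delta_{k+l,0}\frac{[a_{ij}k]}{k}\frac{\gamma^k-\gamma^{-k}}{q-q^{-1}}$; $[a_i(k),K_j^{\pm1}]=[q^{\pm d},K_j^{\pm1}]=0$; $q^dx_i^\pm(k)q^{-d}=q^kx_i^\pm(k)$, $q^da_i(l)q^{-d}=q^la_i(l)$; $K_ix_j^\pm(k)K_i^{-1}=q^{\pm a_{ij}}x_j^\pm(k)$; $[a_i(k),x_j^\pm(l)]=\pm\frac{[a_{ij}k]}{k}\gamma^{\mp|k|/2}x_j^\pm(k+l)$; $x_i^\pm(k+1)x_j^\pm(l)-q^{\pm a_{ij}}x_j^\pm(l)x_i^\pm(k+1)=q^{\pm a_{ij}}x_i^\pm(k)x_j^\pm(l+1)-x_j^\pm(l+1)x_i^\pm(k)$; $[x_i^+(k),x_j^-(l)]=\frac{\delta_{ij}}{q-q^{-1}}(\gamma^{(k-l)/2}\psi_i(k+l)-\gamma^{(l-k)/2}\phi_i(k+l))$;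 and for $i\ne j$, $m=1-a_{ij}$, $\operatorname{Sym}_{l_1,\dots,l_m}\sum_{s=0}^m(-1)^s\binom ms_qx_i^\pm(l_1)\cdots x_i^\pm(l_s)x_j^\pm(k)x_i^\pm(l_{s+1})\cdots x_i^\pm(l_m)=0$. Here $\sum_{r\ge0}\phi_i(-r)z^r=K_i^{-1}\exp(-(q-q^{-1})\sum_{r\ge1}a_i(-r)z^r)$, $\sum_{r\ge0}\psi_i(r)z^{-r}=K_i\exp((q-q^{-1})\sum_{r\ge1}a_i(r)z^{-r})$, other $\phi_i(k),\psi_i(k)$ being $0$. On a module, $x_i^\pm(z)=\sum_{r\in\mathbb Z}x_i^\pm(r)z^{-r-1}$. $L$ restricted means that for every $v\in L$ and $i$, $x_i^\pm(r)v=0$ for $r$ sufficiently large, i.e. $x_i^\pm(z)\in\mathcal E(L)$. Operators. Let $\mathbb F=\mathbb C(q^{1/2})$. $L((z_1,\dots,z_m))$ denotes Laurent series with exponents bounded below in each variable; $\mathcal E(L)=\operatorname{Hom}(L,L((z)))$, $\mathcal E(L)_t=\mathcal E(L)\otimes\mathbb F[t]$; $a(z)\otimes t^\alpha$ is homogeneous of weight $\alpha$. $[r]_{\mathsf q}=(\mathsf q^r-1)/(\mathsf q-1)$, $[r]_{\mathsf q}!$ and $\binom ml_{\mathsf q}=[m]_{\mathsf q}\cdots[m-l+1]_{\mathsf q}/[l]_{\mathsf q}!$ as usual. $a^{[1]}(z)=\frac{a(z\mathsf q)-a(z)}{z(\mathsf q-1)}$, $a^{[r]}$ its $r$-th iterate.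 $\mathbb F[z]_0=\{p\in\mathbb F[z]:p(1)=1,\ p(\mathsf q^n)\ne0\ \forall n\in\mathbb Z_{\ge0}\}$. A sequence $(a_1(z)\otimes t^{\alpha_1},\dots,a_m(z)\otimes t^{\alpha_m})$ is quasi-commutative if for some $p\in\mathbb F[z]_0$, $\bigl(\prod_{i<j}p(z_j/z_i)\bigr)a_1(z_1)a_2(z_2\mathsf q^{\alpha_1})\cdots a_m(z_m\mathsf q^{\alpha_1+\cdots+\alpha_{m-1}})\in\operatorname{Hom}(L,L((z_1,\dots,z_m)))$; a sequence of general elements is quasi-commutative if all choices of homogeneous components are. For a quasi-commutative pair and $r\ge0$, $(a(z)\otimes t^\alpha)_{-r-1}(b(z)\otimes t^\beta)=\lim_{z_1\to z}\frac{p(z/z_1)}{[r]_{\mathsf q}!}a^{[r]}(z_1)b(z\mathsf q^{\alpha+r})\otimes t^{\alpha+\beta+r}$, with any $p\in\mathbb F[z]_0$ such that $p(z/z_1)a^{[r]}(z_1)b(z\mathsf q^{\alpha+r})\in\operatorname{Hom}(L,L((z_1,z)))$ (set $z_1=z$; independent of $p$); for $r<0$ the product is $0$; extend bilinearly. $Y(a,z_0)b=\sum_r(a_rb)z_0^{-r-1}$, $\mathbf 1=1\otimes1$. Iterated products are nested to the right. A graded nonlocal $\mathsf q$-vertex algebra is a $\mathbb Z$-graded space $V=\coprod_uV_{(u)}$ with a linear map $Y(\cdot,z_0):V\to(\operatorname{End}V)[[z_0^{\pm1}]]$, $Y(a,z_0)=\sum_ra_rz_0^{-r-1}$, and $\mathbf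 1\in V$ such that: $a_rb=0$ for $r\gg0$; $Y(\mathbf 1,z_0)=1_V$; $Y(a,z_0)\mathbf 1\in V[[z_0]]$ has constant term $a$; $a_rV_{(s)}\subseteq V_{(s+u-r-1)}$ for $a\in V_{(u)}$; and for $a\in V_{(u)}$, $b,c\in V$, $r,s\in\mathbb Z$: $(a_rb)_sc=\sum_{l\ge0}\binom{l-r-1}{l}_{\mathsf q}\mathsf q^{(s+l+1)(r-u+1)}a_{r-l}(b_{s+l}c)$ (this is $Y(a,z_0+z_2)Y(b,z_2\mathsf q^u)c=Y(Y(a,z_0)b,z_2)c$ with $z_2z_0=\mathsf qz_0z_2$). A graded nonlocal $\mathsf q$-vertex algebra inside $\mathcal E(L)_t$ is a subspace $V$ whose pairs are quasi-commutative, containing $\mathbf 1$, closed under all products, satisfying these axioms with $Y(a,z_0)b=\sum_{r\in\mathbb Z}(a_rb)z_0^{-r-1}$ formed from the products $a_rb$ of quasi-commutative pairs in $\mathcal E(L)_t$, with $\mathbf 1=1\otimes1$ (identity operator of $L$ tensor $1$), and with $V_{(u)}=\{a(z)\otimes t^u\in V\}$. *)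

theory Defs
  imports
    Complex_Main
    "HOL-Library.Function_Algebras"
    "HOL-Library.Poly_Mapping"
    "HOL-Combinatorics.Permutations"
    "HOL-Computational_Algebra.Polynomial"
    "HOL-Computational_Algebra.Formal_Power_Series"
    "HOL-Computational_Algebra.Fraction_Field"
begin

section \<open>Base field and q-numbers\<close>

text \<open>The field of rational functions over the complex numbers in the variable \<open>hq\<close>,
  which plays the role of \<open>q\<close> to the power \<open>1/2\<close>; \<open>qv\<close> is \<open>q\<close>. The parameter \<open>qq\<close> further below is the deformation parameter of
  the q-vertex algebra, to be taken as \<open>q\<close> to the power \<open>2\<close> or \<open>- 2\<close>.\<close>

type_synonym Cq = "complex poly fract"

definition hq :: Cq where
  "hq = Fract [:0, 1:] 1"

definition qv :: Cq where
  "qv = hq ^ 2"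

definition qint :: "int \<Rightarrow> Cq" where
  "qint m = (qv powi m - qv powi (- m)) / (qv - inverse qv)"

definition qbinom :: "nat \<Rightarrow> nat \<Rightarrow> Cq" where
  "qbinom m s = (\<Prod>j<s. qint (int m - int j)) / (\<Prod>j=1..s. qint (int j))"

section \<open>Cartan matrices of type (ADE)(1)\<close>

datatype ade = A_type nat | D_type nat | E_type nat

fun ade_valid :: "ade \<Rightarrow> bool" where
  "ade_valid (A_type n) \<longleftrightarrow> n \<ge> 1"
| "ade_valid (D_type n) \<longleftrightarrow> n \<ge> 4"
| "ade_valid (E_type n) \<longleftrightarrow> n \<in> {6, 7, 8}"

fun ade_rank :: "ade \<Rightarrow> nat" where
  "ade_rank (A_type n) = n"
| "ade_rank (D_type n) = n"
| "ade_rank (E_type n) = n"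

text \<open>Edges of the extended Dynkin diagram on the nodes \<open>0, \<dots>, n\<close> in Bourbaki's numbering,
  each listed in one orientation. For \<open>A_type 1\<close> the two nodes are joined by two edges, which
  appear as the two pairs \<open>(0, 1)\<close> and \<open>(1, 0)\<close>.\<close>

fun affine_edges :: "ade \<Rightarrow> (nat \<times> nat) set" where
  "affine_edges (A_type n) = insert (n, 0) {(i, Suc i) |i. i < n}"
| "affine_edges (D_type n) = {(0, 2), (n - 2, n)} \<union> {(i, Suc i) |i. 1 \<le> i \<and> i < n - 1}"
| "affine_edges (E_type n) = {(0, if n = 6 then 2 else if n = 7 then 1 else 8), (1, 3), (2, 4)}
     \<union> {(i, Suc i) |i. 3 \<le> i \<and> i < n}"

definition affine_cartan :: "ade \<Rightarrow> nat \<Rightarrow> nat \<Rightarrow> int" where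
  "affine_cartan T i j = (if i = j then 2 else - int (card (affine_edges T \<inter> {(i, j), (j, i)})))"

text \<open>The numbering of the nodes \<open>1, \<dots>, n\<close> is left free.\<close>

definition affine_ADE :: "nat \<Rightarrow> (nat \<Rightarrow> nat \<Rightarrow> int) \<Rightarrow> bool" where
  "affine_ADE n a \<longleftrightarrow> (\<exists>T \<sigma>. ade_valid T \<and> ade_rank T = n \<and> \<sigma> permutes {1..n} \<and>
     (\<forall>i\<le>n. \<forall>j\<le>n. a i j = affine_cartan T (\<sigma> i) (\<sigma> j)))"

section \<open>The quantum affine algebra in Drinfeld's realization\<close>

datatype sign = Pos | Neg

fun sgn_int :: "sign \<Rightarrow> int" where
  "sgn_int Pos = 1"
| "sgn_int Neg = - 1"

text \<open>\<open>GHalf\<close>, \<open>GHalfInv\<close> are the generators written \<open>\<gamma>\<close> to the powers \<open>1/2\<close> and \<open>-1/2\<close>;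
  \<open>QD\<close>, \<open>QDInv\<close> are \<open>q\<close> to the powers \<open>d\<close> and \<open>-d\<close>. Generators with
  index outside \<open>1, \<dots>, n\<close>, and \<open>GA i 0\<close>, do not occur in the algebra; they are set to \<open>0\<close>
  below.\<close>

datatype gen = GX sign nat int | GA nat int | GK nat | GKInv nat
  | GHalf | GHalfInv | QD | QDInv

fun is_gen :: "nat \<Rightarrow> gen \<Rightarrow> bool" where
  "is_gen n (GX s i k) \<longleftrightarrow> i \<in> {1..n}"
| "is_gen n (GA i l) \<longleftrightarrow> i \<in> {1..n} \<and> l \<noteq> 0"
| "is_gen n (GK i) \<longleftrightarrow> i \<in> {1..n}"
| "is_gen n (GKInv i) \<longleftrightarrow> i \<in> {1..n}"
| "is_gen n g \<longleftrightarrow> True"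

text \<open>The free monoid, written additively so that \<open>gen word \<Rightarrow>\<^sub>0 Cq\<close> with its
  convolution product is the free unital associative algebra.\<close>

datatype 'g word = Word "'g list"

instantiation word :: (type) monoid_add
begin

definition zero_word :: "'a word" where
  "zero_word = Word []"

fun plus_word :: "'a word \<Rightarrow> 'a word \<Rightarrow> 'a word" where
  "plus_word (Word u) (Word v) = Word (u @ v)"

instance
proof
  fix a b c :: "'a word"
  show "a + b + c = a + (b + c)"
    by (cases a; cases b; cases c) simp
  show "0 + a = a" and "a + 0 = a"
    by (cases a; simp add: zero_word_def)+
qed

end

type_synonym free_alg = "gen word \<Rightarrow>\<^sub>0 Cq"

definition sc :: "Cq \<Rightarrow> free_alg" where
  "sc c = Poly_Mapping.single 0 c"

definition gn :: "gen \<Rightarrow> free_alg" where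
  "gn g = Poly_Mapping.single (Word [g]) 1"

abbreviation "genx s i k \<equiv> gn (GX s i k)"
abbreviation "gena i l \<equiv> gn (GA i l)"
abbreviation "genK i \<equiv> gn (GK i)"
abbreviation "genKI i \<equiv> gn (GKInv i)"

definition commutator :: "free_alg \<Rightarrow> free_alg \<Rightarrow> free_alg" where
  "commutator X Y = X * Y - Y * X"

definition ghalf :: "int \<Rightarrow> free_alg" where
  "ghalf m = (if m \<ge> 0 then gn GHalf ^ nat m else gn GHalfInv ^ nat (- m))"

definition exp_free :: "free_alg fps" where
  "exp_free = Abs_fps (\<lambda>N. sc (1 / of_nat (fact N)))"

text \<open>The formal variable is the inverse of \<open>z\<close> for \<open>drinfeld_psi\<close> and \<open>z\<close> for \<open>drinfeld_phi\<close>.\<close>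

definition drinfeld_psi :: "nat \<Rightarrow> int \<Rightarrow> free_alg" where
  "drinfeld_psi i k = (if k \<ge> 0 then fps_nth
     (fps_const (genK i) *
      (exp_free oo Abs_fps (\<lambda>r. if r = 0 then 0 else sc (qv - inverse qv) * gena i (int r)))) (nat k)
    else 0)"

definition drinfeld_phi :: "nat \<Rightarrow> int \<Rightarrow> free_alg" where
  "drinfeld_phi i k = (if k \<le> 0 then fps_nth
     (fps_const (genKI i) *
      (exp_free oo Abs_fps (\<lambda>r. if r = 0 then 0 else sc (- (qv - inverse qv)) * gena i (- int r)))) (nat (- k))
    else 0)"

definition serre :: "(nat \<Rightarrow> nat \<Rightarrow> int) \<Rightarrow> sign \<Rightarrow> nat \<Rightarrow> nat \<Rightarrow> (nat \<Rightarrow> int) \<Rightarrow> int \<Rightarrow> free_alg" where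
  "serre a s i j l k = (let m = nat (1 - a i j) in
     \<Sum>\<pi> | \<pi> permutes {..<m}. \<Sum>t\<le>m.
       sc ((- 1) ^ t * qbinom m t) *
       (prod_list (map (\<lambda>u. genx s i (l (\<pi> u))) [0..<t]) * genx s j k *
        prod_list (map (\<lambda>u. genx s i (l (\<pi> u))) [t..<m])))"

inductive Uq_rel :: "nat \<Rightarrow> (nat \<Rightarrow> nat \<Rightarrow> int) \<Rightarrow> free_alg \<Rightarrow> free_alg \<Rightarrow> bool"
  for n :: nat and a :: "nat \<Rightarrow> nat \<Rightarrow> int" where
  outside: "\<not> is_gen n g \<Longrightarrow> Uq_rel n a (gn g) 0"
| gamma_central: "Uq_rel n a (gn GHalf * gn g) (gn g * gn GHalf)"
| gamma_inv_central: "Uq_rel n a (gn GHalfInv * gn g) (gn g * gn GHalfInv)"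
| gamma_inv: "Uq_rel n a (gn GHalf * gn GHalfInv) 1"
| qd_inv_right: "Uq_rel n a (gn QD * gn QDInv) 1"
| qd_inv_left: "Uq_rel n a (gn QDInv * gn QD) 1"
| K_K: "i \<in> {1..n} \<Longrightarrow> j \<in> {1..n} \<Longrightarrow> Uq_rel n a (genK i * genK j) (genK j * genK i)"
| K_inv_right: "i \<in> {1..n} \<Longrightarrow> Uq_rel n a (genK i * genKI i) 1"
| K_inv_left: "i \<in> {1..n} \<Longrightarrow> Uq_rel n a (genKI i * genK i) 1"
| a_a: "i \<in> {1..n} \<Longrightarrow> j \<in> {1..n} \<Longrightarrow> k \<noteq> 0 \<Longrightarrow> l \<noteq> 0 \<Longrightarrow>
    Uq_rel n a (commutator (gena i k) (gena j l))
      (if k + l = 0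
       then sc (qint (a i j * k) / (of_int k * (qv - inverse qv))) * (ghalf (2 * k) - ghalf (- 2 * k))
       else 0)"
| a_K: "i \<in> {1..n} \<Longrightarrow> j \<in> {1..n} \<Longrightarrow> k \<noteq> 0 \<Longrightarrow> g \<in> {GK j, GKInv j} \<Longrightarrow>
    Uq_rel n a (commutator (gena i k) (gn g)) 0"
| qd_K: "j \<in> {1..n} \<Longrightarrow> g \<in> {GK j, GKInv j} \<Longrightarrow> h \<in> {QD, QDInv} \<Longrightarrow>
    Uq_rel n a (commutator (gn h) (gn g)) 0"
| qd_x: "i \<in> {1..n} \<Longrightarrow>
    Uq_rel n a (gn QD * genx s i k * gn QDInv) (sc (qv powi k) * genx s i k)"
| qd_a: "i \<in> {1..n} \<Longrightarrow> l \<noteq> 0 \<Longrightarrow>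
    Uq_rel n a (gn QD * gena i l * gn QDInv) (sc (qv powi l) * gena i l)"
| K_x: "i \<in> {1..n} \<Longrightarrow> j \<in> {1..n} \<Longrightarrow>
    Uq_rel n a (genK i * genx s j k * genKI i) (sc (qv powi (sgn_int s * a i j)) * genx s j k)"
| a_x: "i \<in> {1..n} \<Longrightarrow> j \<in> {1..n} \<Longrightarrow> k \<noteq> 0 \<Longrightarrow>
    Uq_rel n a (commutator (gena i k) (genx s j l))
      (sc (of_int (sgn_int s) * qint (a i j * k) / of_int k) *
       ghalf (- sgn_int s * \<bar>k\<bar>) * genx s j (k + l))"
| x_x: "i \<in> {1..n} \<Longrightarrow> j \<in> {1..n} \<Longrightarrow>
    Uq_rel n a
      (genx s i (k + 1) * genx s j l - sc (qv powi (sgn_int s * a i j)) * (genx s j l * genx s i (k + 1)))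
      (sc (qv powi (sgn_int s * a i j)) * (genx s i k * genx s j (l + 1)) - genx s j (l + 1) * genx s i k)"
| x_pos_neg: "i \<in> {1..n} \<Longrightarrow> j \<in> {1..n} \<Longrightarrow>
    Uq_rel n a (commutator (genx Pos i k) (genx Neg j l))
      (if i = j
       then sc (1 / (qv - inverse qv)) *
         (ghalf (k - l) * drinfeld_psi i (k + l) - ghalf (l - k) * drinfeld_phi i (k + l))
       else 0)"
| serre: "i \<in> {1..n} \<Longrightarrow> j \<in> {1..n} \<Longrightarrow> i \<noteq> j \<Longrightarrow> Uq_rel n a (serre a s i j l k) 0"

text \<open>Equality in the algebra: the congruence on the free algebra generated by the relations.
  Compatibility with scalars is multiplication by \<^term>\<open>sc c\<close>.\<close>

inductive Uq_eq :: "nat \<Rightarrow> (nat \<Rightarrow> nat \<Rightarrow> int) \<Rightarrow> free_alg \<Rightarrow> free_alg \<Rightarrow> bool"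
  for n :: nat and a :: "nat \<Rightarrow> nat \<Rightarrow> int" where
  base: "Uq_rel n a X Y \<Longrightarrow> Uq_eq n a X Y"
| refl: "Uq_eq n a X X"
| sym: "Uq_eq n a X Y \<Longrightarrow> Uq_eq n a Y X"
| trans: "Uq_eq n a X Y \<Longrightarrow> Uq_eq n a Y Z \<Longrightarrow> Uq_eq n a X Z"
| add: "Uq_eq n a X Y \<Longrightarrow> Uq_eq n a X' Y' \<Longrightarrow> Uq_eq n a (X + X') (Y + Y')"
| mult: "Uq_eq n a X Y \<Longrightarrow> Uq_eq n a X' Y' \<Longrightarrow> Uq_eq n a (X * X') (Y * Y')"

text \<open>A module over the quotient of the free algebra by \<^const>\<open>Uq_eq\<close>, whose underlying space is
  the whole type \<open>'v\<close>; \<open>act X\<close> is the operator by which (the class of) \<open>X\<close> acts.\<close>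

definition Uq_module ::
  "nat \<Rightarrow> (nat \<Rightarrow> nat \<Rightarrow> int) \<Rightarrow> (Cq \<Rightarrow> 'v::ab_group_add \<Rightarrow> 'v) \<Rightarrow> (free_alg \<Rightarrow> 'v \<Rightarrow> 'v) \<Rightarrow> bool" where
  "Uq_module n a scale act \<longleftrightarrow>
     vector_space scale \<and>
     (\<forall>X. Vector_Spaces.linear scale scale (act X)) \<and>
     (\<forall>c v. act (sc c) v = scale c v) \<and>
     (\<forall>X Y v. act (X + Y) v = act X v + act Y v) \<and>
     (\<forall>X Y v. act (X * Y) v = act X (act Y v)) \<and>
     (\<forall>X Y v. Uq_eq n a X Y \<longrightarrow> act X v = act Y v)"

definition restricted_module :: "nat \<Rightarrow> (free_alg \<Rightarrow> 'v::zero \<Rightarrow> 'v) \<Rightarrow> bool" where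
  "restricted_module n act \<longleftrightarrow>
     (\<forall>v. \<forall>i\<in>{1..n}. \<forall>s. \<exists>N. \<forall>r\<ge>N. act (genx s i r) v = 0)"

section \<open>Nonlocal q-vertex algebras\<close>

definition nqint :: "'f::field \<Rightarrow> int \<Rightarrow> 'f" where
  "nqint qq r = (qq powi r - 1) / (qq - 1)"

definition nqfact :: "'f::field \<Rightarrow> nat \<Rightarrow> 'f" where
  "nqfact qq r = (\<Prod>j=1..r. nqint qq (int j))"

definition nqbinom :: "'f::field \<Rightarrow> int \<Rightarrow> nat \<Rightarrow> 'f" where
  "nqbinom qq m l = (\<Prod>j<l. nqint qq (m - int j)) / nqfact qq l"

text \<open>\<open>V\<close> is a subspace of the space given by \<open>scale\<close>, \<open>Gr u\<close> is the component of degree \<open>u\<close>, and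
  \<open>md a r b\<close> is the product of \<open>a\<close> and \<open>b\<close> with index \<open>r\<close>, that is, the coefficient of \<open>z\<^sub>0\<close> to the
  power \<open>- r - 1\<close> in \<open>Y(a, z\<^sub>0) b\<close>. By truncation only finitely many summands
  in the last axiom are nonzero.\<close>

definition graded_nonlocal_qva ::
  "('f::field \<Rightarrow> 'w::ab_group_add \<Rightarrow> 'w) \<Rightarrow> 'f \<Rightarrow> 'w set \<Rightarrow> (int \<Rightarrow> 'w set)
    \<Rightarrow> ('w \<Rightarrow> int \<Rightarrow> 'w \<Rightarrow> 'w) \<Rightarrow> 'w \<Rightarrow> bool" where
  "graded_nonlocal_qva scale qq V Gr md vac \<longleftrightarrow>
     module.subspace scale V \<and>
     (\<forall>u. module.subspace scale (Gr u) \<and> Gr u \<subseteq> V) \<and>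
     (\<forall>a\<in>V. \<exists>!f. (\<forall>u. f u \<in> Gr u) \<and> finite {u. f u \<noteq> 0} \<and> a = (\<Sum>u | f u \<noteq> 0. f u)) \<and>
     (\<forall>a\<in>V. \<forall>r. \<forall>b\<in>V. md a r b \<in> V) \<and>
     (\<forall>r. \<forall>a\<in>V. \<forall>a'\<in>V. \<forall>b\<in>V. md (a + a') r b = md a r b + md a' r b) \<and>
     (\<forall>r c. \<forall>a\<in>V. \<forall>b\<in>V. md (scale c a) r b = scale c (md a r b)) \<and>
     (\<forall>r. \<forall>a\<in>V. \<forall>b\<in>V. \<forall>b'\<in>V. md a r (b + b') = md a r b + md a r b') \<and>
     (\<forall>r c. \<forall>a\<in>V. \<forall>b\<in>V. md a r (scale c b) = scale c (md a r b)) \<and>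
     vac \<in> V \<and>
     (\<forall>a\<in>V. \<forall>b\<in>V. \<exists>N. \<forall>r\<ge>N. md a r b = 0) \<and>
     (\<forall>b\<in>V. \<forall>r. md vac r b = (if r = - 1 then b else 0)) \<and>
     (\<forall>a\<in>V. (\<forall>r\<ge>0. md a r vac = 0) \<and> md a (- 1) vac = a) \<and>
     (\<forall>u s r. \<forall>a\<in>Gr u. \<forall>b\<in>Gr s. md a r b \<in> Gr (s + u - r - 1)) \<and>
     (\<forall>u r s. \<forall>a\<in>Gr u. \<forall>b\<in>V. \<forall>c\<in>V.
        md (md a r b) s c =
        Sum_any (\<lambda>l::nat.
          scale (nqbinom qq (int l - r - 1) l * qq powi ((s + int l + 1) * (r - u + 1)))
            (md a (r - int l) (md b (s + int l) c))))"

section \<open>Operators and their products\<close>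

text \<open>A series with coefficients in \<open>L\<close> is the function giving the coefficient of each power of the
  variable (or of each pair of powers), so that \<open>Hom(L, L((z)))\<close> and \<open>Hom(L, L((z\<^sub>1, z\<^sub>2)))\<close> consist of
  functions of the following two types. Addition of such functions is pointwise.\<close>

type_synonym 'v field1 = "'v \<Rightarrow> int \<Rightarrow> 'v"
type_synonym 'v field2 = "'v \<Rightarrow> int \<Rightarrow> int \<Rightarrow> 'v"

context
  fixes scale :: "'f::field \<Rightarrow> 'v::ab_group_add \<Rightarrow> 'v"
    and qq :: 'f
begin

definition hom1 :: "'v field1 set" where
  "hom1 = {a. (\<forall>k. Vector_Spaces.linear scale scale (\<lambda>v. a v k)) \<and>
              (\<forall>v. \<exists>N. \<forall>k<N. a v k = 0)}"

definition hom2 :: "'v field2 set" where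
  "hom2 = {f. (\<forall>k l. Vector_Spaces.linear scale scale (\<lambda>v. f v k l)) \<and>
              (\<forall>v. \<exists>N. \<forall>k l. k < N \<or> l < N \<longrightarrow> f v k l = 0)}"

text \<open>The substitution \<open>a(z c)\<close>.\<close>

definition dilate :: "'f \<Rightarrow> 'v field1 \<Rightarrow> 'v field1" where
  "dilate c a = (\<lambda>v k. scale (c powi k) (a v k))"

text \<open>The q-derivative; division by \<open>z\<close> shifts the index of the coefficients.\<close>

definition qderiv :: "'v field1 \<Rightarrow> 'v field1" where
  "qderiv a = (\<lambda>v k. scale (1 / (qq - 1)) (dilate qq a v (k + 1) - a v (k + 1)))"

text \<open>\<open>a(z\<^sub>1) b(z\<^sub>2)\<close>.\<close>

definition comp_fields :: "'v field1 \<Rightarrow> 'v field1 \<Rightarrow> 'v field2" where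
  "comp_fields a b = (\<lambda>v k l. a (b v l) k)"

text \<open>Multiplication by \<open>p(z\<^sub>2 / z\<^sub>1)\<close>.\<close>

definition mult_ratio :: "'f poly \<Rightarrow> 'v field2 \<Rightarrow> 'v field2" where
  "mult_ratio p f = (\<lambda>v k l. \<Sum>j\<le>degree p. scale (coeff p j) (f v (k + int j) (l - int j)))"

text \<open>Restriction to \<open>z\<^sub>1 = z\<^sub>2 = z\<close>.\<close>

definition diag :: "'v field2 \<Rightarrow> 'v field1" where
  "diag f = (\<lambda>v k. Sum_any (\<lambda>j. f v j (k - j)))"

definition poly0 :: "'f poly set" where
  "poly0 = {p. poly p 1 = 1 \<and> (\<forall>m::nat. poly p (qq ^ m) \<noteq> 0)}"

text \<open>The tensor product of \<open>Hom(L, L((z)))\<close> with the polynomials in \<open>t\<close> is the space of polynomials in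
  \<open>t\<close> with coefficients in \<open>Hom(L, L((z)))\<close>; the homogeneous element \<open>a(z) \<otimes> t\<close> to the \<open>\<alpha>\<close> is
  \<^term>\<open>monom a \<alpha>\<close>.\<close>

definition homt :: "'v field1 poly set" where
  "homt = {P. \<forall>\<alpha>. coeff P \<alpha> \<in> hom1}"

definition scalet :: "'f \<Rightarrow> 'v field1 poly \<Rightarrow> 'v field1 poly" where
  "scalet c = map_poly (\<lambda>a v k. scale c (a v k))"

definition onet :: "'v field1 poly" where
  "onet = monom (\<lambda>v k. if k = 0 then v else 0) 0"

definition quasi_comm_hom :: "'v field1 \<Rightarrow> nat \<Rightarrow> 'v field1 \<Rightarrow> bool" where
  "quasi_comm_hom a \<alpha> b \<longleftrightarrow>
     (\<exists>p\<in>poly0. mult_ratio p (comp_fields a (dilate (qq ^ \<alpha>) b)) \<in> hom2)"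

definition quasi_comm :: "'v field1 poly \<Rightarrow> 'v field1 poly \<Rightarrow> bool" where
  "quasi_comm P Q \<longleftrightarrow> (\<forall>\<alpha> \<beta>. quasi_comm_hom (coeff P \<alpha>) \<alpha> (coeff Q \<beta>))"

text \<open>Operator part of the product with index \<open>- r - 1\<close> of \<open>a\<close> in degree \<open>\<alpha>\<close> with \<open>b\<close>. For a
  quasi-commutative pair an admissible \<open>p\<close> exists and the result does not depend on it.\<close>

definition prod_hom :: "'v field1 \<Rightarrow> nat \<Rightarrow> nat \<Rightarrow> 'v field1 \<Rightarrow> 'v field1" where
  "prod_hom a \<alpha> r b =
     (let f = comp_fields ((qderiv ^^ r) a) (dilate (qq ^ (\<alpha> + r)) b);
          p = (SOME p. p \<in> poly0 \<and> mult_ratio p f \<in> hom2)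
      in (\<lambda>v k. scale (1 / nqfact qq r) (diag (mult_ratio p f) v k)))"

definition prodt :: "'v field1 poly \<Rightarrow> int \<Rightarrow> 'v field1 poly \<Rightarrow> 'v field1 poly" where
  "prodt P k Q =
     (if k \<ge> 0 then 0
      else let r = nat (- k - 1) in
        \<Sum>\<alpha>\<le>degree P. \<Sum>\<beta>\<le>degree Q.
          monom (prod_hom (coeff P \<alpha>) \<alpha> r (coeff Q \<beta>)) (\<alpha> + \<beta> + r))"

definition homogt :: "'v field1 poly set \<Rightarrow> int \<Rightarrow> 'v field1 poly set" where
  "homogt V u = insert 0 {monom a \<alpha> |a \<alpha>. int \<alpha> = u \<and> monom a \<alpha> \<in> V}"

definition qva_in_homt :: "'v field1 poly set \<Rightarrow> bool" where
  "qva_in_homt V \<longleftrightarrow>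
     V \<subseteq> homt \<and> (\<forall>P\<in>V. \<forall>Q\<in>V. quasi_comm P Q) \<and>
     graded_nonlocal_qva scalet qq V (homogt V) prodt onet"

definition smallest_qva_containing :: "'v field1 poly set \<Rightarrow> 'v field1 poly set \<Rightarrow> bool" where
  "smallest_qva_containing S V \<longleftrightarrow>
     qva_in_homt V \<and> S \<subseteq> V \<and> (\<forall>W. qva_in_homt W \<and> S \<subseteq> W \<longrightarrow> V \<subseteq> W)"

end

text \<open>The coefficient of \<open>z\<close> to the \<open>k\<close> in the current of sign \<open>s\<close> and index \<open>i\<close> is the mode
  \<open>- k - 1\<close>.\<close>

definition current :: "(free_alg \<Rightarrow> 'v \<Rightarrow> 'v) \<Rightarrow> sign \<Rightarrow> nat \<Rightarrow> 'v field1" where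
  "current act s i = (\<lambda>v k. act (genx s i (- k - 1)) v)"

end

theory Submission
  imports Defs
begin

text \<open>
  In the skew polynomial ring over an algebra of fields, with \<open>t a(z) = a(z q) t\<close> for the
  parameter \<open>q\<close> of the vertex algebra, the product with index \<open>- r - 1\<close> of \<open>P\<close> and \<open>Q\<close> is
  \<open>D\<^sup>r(P) Q / [r]!\<close>, where \<open>D(a t\<^sup>\<alpha>) = a\<^bsup>[1]\<^esup> t\<^bsup>\<alpha>+1\<^esup>\<close>. With \<open>T = z\<^sup>-\<^sup>1 t / (q - 1)\<close> one has
  \<open>D(P) = T P - q\<^sup>\<alpha> P T\<close> for \<open>P\<close> of degree \<open>\<alpha>\<close>, so \<open>D\<close> is a skew derivation, and the associativity
  axiom of a nonlocal vertex algebra is the q-Leibniz rule for \<open>D\<^sup>s / [s]!\<close> combined with the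
  q-binomial composition rule of these divided powers.

  Products of fields exist only after regularization. They are controlled by exchange relations
  \<open>p(z\<^sub>2/z\<^sub>1) a(z\<^sub>1) b(z\<^sub>2) = p'(z\<^sub>2/z\<^sub>1) b(z\<^sub>2) a(z\<^sub>1)\<close> with \<open>p\<close> nonzero at all nonnegative powers of \<open>q\<close>:
  a version of Dong's lemma carries them over to products, and for three fields they bound the
  regularized product in all variables, which makes the product associative. For the currents the
  defining relations give \<open>p(x) = 1 - c x\<close>, with \<open>c\<close> equal to \<open>q\<^sub>0\<close> to the power \<open>\<plusminus> a\<^sub>i\<^sub>j\<close> and \<open>q = q\<^sub>0\<^bsup>\<plusminus>2\<^esup>\<close>; this \<open>p\<close> is
  admissible if \<open>a\<^sub>i\<^sub>j\<close> is \<open>2\<close> or \<open>- 1\<close>, and if \<open>a\<^sub>i\<^sub>j = 0\<close> the currents commute by the Serre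
  relation.
\<close>

section \<open>Polynomials in a shift operator\<close>

text \<open>Quasi-commutativity of pairs alone gives no control over a product against a third
  field: the lower bound for a regularised product applied to \<open>c v k\<close> may depend on k.
  An exchange relation is finer. On its left side the field next to v bounds the exponents of z2, on
  its right side those of z1, so the relation implies regularity, and it can also be applied in the
  middle of a longer product. Only the left polynomial p is divided out when z1 = z2, so p' may be
  arbitrary.

  A weight t^\<alpha> replaces b(z) by b(z q^\<alpha>), and with it p(x) by p(q^\<alpha> x).
  Nonvanishing at all nonnegative powers of q survives this substitution; the normalisation p(1) = 1
  does not, and is restored only where a product is evaluated.

  The element T need not lie in the generated vertex algebra. The algebra generated by the currents
  together with T is therefore treated first. There D is a twisted inner derivation, and the Leibniz
  rule follows from associativity; afterwards the rule is restricted to the span of the generated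
  monomials, which D preserves.\<close>

locale series_space = vector_space scale
  for scale :: "'f::field \<Rightarrow> 'v::ab_group_add \<Rightarrow> 'v"
begin

text \<open>This is p(S) for the operator S that sends g to its composite with s. The index type is
  left open because p(zj/zi) has to act both on pairs and on triples of exponents.\<close>

definition pmul :: "'f poly \<Rightarrow> ('k \<Rightarrow> 'k) \<Rightarrow> ('k \<Rightarrow> 'v) \<Rightarrow> 'k \<Rightarrow> 'v" where
  "pmul p s g k = (\<Sum>j\<le>degree p. scale (coeff p j) (g ((s ^^ j) k)))"

lemma pmul_superset:
  assumes "degree p \<le> N"
  shows "pmul p s g k = (\<Sum>j\<le>N. scale (coeff p j) (g ((s ^^ j) k)))"
  unfolding pmul_def
  by (rule sum.mono_neutral_left) (use assms in \<open>auto simp: coeff_eq_0 not_le\<close>)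

lemma pmul_0 [simp]: "pmul 0 s g k = 0"
  by (simp add: pmul_def)

lemma pmul_1 [simp]: "pmul 1 s g k = g k"
  by (simp add: pmul_def)

lemma pmul_pCons [simp]: "pmul (pCons c p) s g k = scale c (g k) + pmul p s g (s k)"
proof -
  have "pmul (pCons c p) s g k =
      (\<Sum>j\<le>Suc (degree p). scale (coeff (pCons c p) j) (g ((s ^^ j) k)))"
    by (rule pmul_superset) (simp add: degree_pCons_le)
  also have "\<dots> = scale c (g k) + (\<Sum>j\<le>degree p. scale (coeff p j) (g ((s ^^ Suc j) k)))"
    by (subst sum.atMost_Suc_shift) simp
  finally show ?thesis
    by (simp only: pmul_def funpow_Suc_right o_apply)
qed

lemma pmul_add_poly: "pmul (p + p') s g k = pmul p s g k + pmul p' s g k"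
  by (induction p p' arbitrary: k rule: poly_induct2) (simp_all add: scale_left_distrib)

lemma pmul_smult: "pmul (smult c p) s g k = scale c (pmul p s g k)"
  by (induction p arbitrary: k) (simp_all add: scale_right_distrib)

lemma pmul_mult: "pmul (p * p') s g k = pmul p s (pmul p' s g) k"
  by (induction p arbitrary: k) (simp_all add: pmul_add_poly pmul_smult)

text \<open>Freezing one exponent embeds pairs into triples compatibly with the shifts; identities
  with p(zj/zi) in three variables thereby reduce to two variables.\<close>

lemma pmul_reindex:
  assumes "\<And>k. h (s k) = s' (h k)"
  shows "pmul p s (\<lambda>k. g (h k)) k = pmul p s' g (h k)"
  by (induction p arbitrary: k) (simp_all add: assms)

lemma pmul_add: "pmul p s (\<lambda>k. g k + h k) k = pmul p s g k + pmul p s h k"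
  by (induction p arbitrary: k) (simp_all add: scale_right_distrib)

lemma pmul_scale: "pmul p s (\<lambda>k. scale c (g k)) k = scale c (pmul p s g k)"
  by (induction p arbitrary: k) (simp_all add: scale_right_distrib mult.commute)

lemma pmul_zero [simp]: "pmul p s (\<lambda>k. 0) k = 0"
  by (induction p arbitrary: k) simp_all

lemma pmul_commute:
  assumes "\<And>k. s (s' k) = s' (s k)"
  shows "pmul p s (pmul p' s' g) k = pmul p' s' (pmul p s g) k"
proof (induction p arbitrary: k)
  case 0
  have "pmul 0 s g = (\<lambda>k. 0)" by (simp add: fun_eq_iff)
  thus ?case by simp
next
  case (pCons c p)
  have fun_eq: "pmul (pCons c p) s g = (\<lambda>k. scale c (g k) + pmul p s g (s k))"
    by (simp add: fun_eq_iff)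
  have "pmul p' s' (pmul (pCons c p) s g) k
      = pmul p' s' (\<lambda>k. scale c (g k)) k + pmul p' s' (\<lambda>k. pmul p s g (s k)) k"
    by (simp add: pmul_add[symmetric] fun_eq)
  also have "\<dots> = scale c (pmul p' s' g k) + pmul p' s' (pmul p s g) (s k)"
    by (simp add: pmul_scale pmul_reindex[where s' = s'] assms)
  also have "\<dots> = pmul (pCons c p) s (pmul p' s' g) k"
    by (simp only: pmul_pCons pCons.IH)
  finally show ?case ..
qed

lemma pmul_linear:
  assumes "Vector_Spaces.linear scale scale \<phi>"
  shows "\<phi> (pmul p s g k) = pmul p s (\<lambda>k. \<phi> (g k)) k"
proof -
  interpret \<phi>: Vector_Spaces.linear scale scale \<phi> by fact
  show ?thesis
    by (induction p arbitrary: k) (simp_all add: \<phi>.add \<phi>.scale)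
qed

lemma pmul_fun_linear:
  assumes "\<And>k. Vector_Spaces.linear scale scale (\<lambda>v. g v k)"
  shows "Vector_Spaces.linear scale scale (\<lambda>v. pmul p s (g v) k)"
proof -
  have add: "g (u + v) k = g u k + g v k" and sc: "g (scale c v) k = scale c (g v k)" for u v k c
    using assms[of k] by (simp_all add: Vector_Spaces.linear_iff)
  show ?thesis
    by (induction p arbitrary: k)
       (simp_all add: Vector_Spaces.linear_iff add sc scale_right_distrib vector_space_axioms algebra_simps)
qed

text \<open>With \<open>\<chi>\<close> a character, this computes \<open>p(z\<^sub>2/z\<^sub>1)\<close> on a dilated series.\<close>

lemma pmul_weighted:
  assumes "\<And>k. \<chi> (s k) = c * \<chi> k"
  shows "pmul p s (\<lambda>k. scale (\<chi> k) (g k)) k = scale (\<chi> k) (pmul (pcompose p [:0, c:]) s g k)"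
  by (induction p arbitrary: k)
     (simp_all add: pcompose_pCons pmul_add_poly pmul_smult scale_right_distrib assms
        pmul_mult mult_ac)

text \<open>Each application of the shift raises \<open>h\<close> by at most d, so only the degree
  of p limits the lost range. Take d = 1 for an exponent that a ratio shift raises and d = 0 for one
  that it lowers or fixes.\<close>

lemma pmul_vanish:
  fixes h :: "'k \<Rightarrow> int"
  assumes "\<And>k. h (s k) \<le> h k + int d" and "\<And>k. h k < N \<Longrightarrow> g k = 0"
    and "h k < N - int (d * degree p)"
  shows "pmul p s g k = 0"
proof -
  have "h ((s ^^ j) k) \<le> h k + int (d * j)" for j
  proof (induction j)
    case (Suc j)
    show ?case using assms(1)[of "(s ^^ j) k"] Suc by simp
  qed simp
  moreover have "int (d * j) \<le> int (d * degree p)" if "j \<le> degree p" for j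
    using that by (simp add: mult_left_mono)
  ultimately have "h ((s ^^ j) k) < N" if "j \<le> degree p" for j
    using that assms(3) by (smt (verit))
  thus ?thesis
    by (simp add: pmul_def assms(2))
qed

text \<open>On a diagonal the ratio of the two variables is 1; this value of p is all that survives
  there.\<close>

lemma pmul_id: "pmul p id g k = scale (poly p 1) (g k)"
  by (induction p arbitrary: k) (simp_all add: scale_left_distrib)

text \<open>The set U is needed because the maps \<Phi> in question are infinite sums, linear only
  on families with finite support. The induction on p thus has to carry membership in U along with
  the identity.\<close>

lemma pmul_intertwine:
  assumes zero: "(\<lambda>k. 0) \<in> U" "\<And>m. \<Phi> (\<lambda>k. 0) m = 0"
    and add: "\<And>g h. g \<in> U \<Longrightarrow> h \<in> U \<Longrightarrow> (\<lambda>k. g k + h k) \<in> U"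
      "\<And>g h m. g \<in> U \<Longrightarrow> h \<in> U \<Longrightarrow> \<Phi> (\<lambda>k. g k + h k) m = \<Phi> g m + \<Phi> h m"
    and scale: "\<And>c g. g \<in> U \<Longrightarrow> (\<lambda>k. scale c (g k)) \<in> U"
      "\<And>c g m. g \<in> U \<Longrightarrow> \<Phi> (\<lambda>k. scale c (g k)) m = scale c (\<Phi> g m)"
    and shift: "\<And>g. g \<in> U \<Longrightarrow> (\<lambda>k. g (s k)) \<in> U"
      "\<And>g m. g \<in> U \<Longrightarrow> \<Phi> (\<lambda>k. g (s k)) m = \<Phi> g (s' m)"
    and g: "g \<in> U"
  shows "pmul p s g \<in> U" and "\<Phi> (pmul p s g) m = pmul p s' (\<Phi> g) m"
proof -
  have "pmul p s g \<in> U \<and> (\<forall>m. \<Phi> (pmul p s g) m = pmul p s' (\<Phi> g) m)"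
  proof (induction p)
    case 0
    have "pmul 0 s g = (\<lambda>k. 0)" by (simp add: fun_eq_iff)
    thus ?case using zero by simp
  next
    case (pCons c p)
    have "pmul (pCons c p) s g = (\<lambda>k. scale c (g k) + pmul p s g (s k))"
      by (simp add: fun_eq_iff)
    moreover have "(\<lambda>k. scale c (g k)) \<in> U" "(\<lambda>k. pmul p s g (s k)) \<in> U"
      using pCons g by (auto intro: scale shift)
    ultimately show ?case
      using pCons g by (simp add: add scale shift)
  qed
  thus "pmul p s g \<in> U" and "\<Phi> (pmul p s g) m = pmul p s' (\<Phi> g) m" by auto
qed

end

text \<open>\<open>Sum_any\<close> is 0 on an infinite support, so finiteness of the inner supports
  is not enough; the joint support has to lie in a finite rectangle.\<close>

lemma Sum_any_swap:
  assumes "finite A" "finite B" "\<And>i j. g i j \<noteq> 0 \<Longrightarrow> i \<in> A \<and> j \<in> B"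
  shows "Sum_any (\<lambda>i. Sum_any (\<lambda>j. g i j)) = Sum_any (\<lambda>j. Sum_any (\<lambda>i. g i j))"
proof -
  have 1: "Sum_any (\<lambda>j. g i j) = (\<Sum>j\<in>B. g i j)" for i
    by (rule Sum_any.expand_superset) (use assms in auto)
  have 2: "Sum_any (\<lambda>i. g i j) = (\<Sum>i\<in>A. g i j)" for j
    by (rule Sum_any.expand_superset) (use assms in auto)
  have zero: "(\<Sum>j\<in>B. g i j) = 0" if "i \<notin> A" for i
    by (rule sum.neutral) (use assms(3) that in blast)
  have zero': "(\<Sum>i\<in>A. g i j) = 0" if "j \<notin> B" for j
    by (rule sum.neutral) (use assms(3) that in blast)
  have "Sum_any (\<lambda>i. Sum_any (\<lambda>j. g i j)) = (\<Sum>i\<in>A. \<Sum>j\<in>B. g i j)"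
    unfolding 1 by (rule Sum_any.expand_superset) (use assms zero in auto)
  also have "\<dots> = (\<Sum>j\<in>B. \<Sum>i\<in>A. g i j)" by (rule sum.swap)
  also have "\<dots> = Sum_any (\<lambda>j. Sum_any (\<lambda>i. g i j))"
    unfolding 2 by (rule Sum_any.expand_superset[symmetric]) (use assms zero' in auto)
  finally show ?thesis .
qed

lemma Sum_any_shift: "Sum_any (\<lambda>j::int. g (j + d)) = Sum_any g"
proof -
  have "bij (\<lambda>j::int. j + d)"
    by (rule bij_betw_byWitness[where f' = "\<lambda>j. j - d"]) auto
  thus ?thesis
    by (rule Sum_any.reindex_cong[symmetric]) (simp add: fun_eq_iff)
qed

lemma (in series_space) Sum_any_linear:
  assumes "Vector_Spaces.linear scale scale \<phi>" "finite {j. g j \<noteq> 0}"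
  shows "\<phi> (Sum_any g) = Sum_any (\<lambda>j. \<phi> (g j))"
proof -
  interpret \<phi>: Vector_Spaces.linear scale scale \<phi> by fact
  have "Sum_any (\<lambda>j. \<phi> (g j)) = (\<Sum>j | g j \<noteq> 0. \<phi> (g j))"
    by (rule Sum_any.expand_superset) (use assms in auto)
  thus ?thesis by (simp add: Sum_any.expand_set \<phi>.sum)
qed

text \<open>The coefficient of z1^k z2^l in (z2/z1) f is the coefficient of f at (k + 1, l - 1). In
  the same way \<open>sh12\<close>, \<open>sh13\<close> and \<open>sh23\<close> encode
  multiplication by z2/z1, z3/z1 and z3/z2.\<close>

definition sh2 :: "int \<times> int \<Rightarrow> int \<times> int" where
  "sh2 = (\<lambda>(k, l). (k + 1, l - 1))"

definition sh12 :: "int \<times> int \<times> int \<Rightarrow> int \<times> int \<times> int" where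
  "sh12 = (\<lambda>(i, j, k). (i + 1, j - 1, k))"

definition sh13 :: "int \<times> int \<times> int \<Rightarrow> int \<times> int \<times> int" where
  "sh13 = (\<lambda>(i, j, k). (i + 1, j, k - 1))"

definition sh23 :: "int \<times> int \<times> int \<Rightarrow> int \<times> int \<times> int" where
  "sh23 = (\<lambda>(i, j, k). (i, j + 1, k - 1))"

lemmas sh_defs = sh2_def sh12_def sh13_def sh23_def

lemma finite_antidiagonal:
  assumes "\<And>k l :: int. k < N \<or> l < N \<Longrightarrow> g k l = (0 :: 'a :: zero)"
  shows "finite {j. g j (m - j) \<noteq> 0}"
proof (rule finite_subset)
  show "{j. g j (m - j) \<noteq> 0} \<subseteq> {N..m - N}"
    using assms by (force simp: not_less[symmetric])
qed simp

lemma finite_int_shift: "finite {j::int. P j} \<Longrightarrow> finite {j. P (j + d)}"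
  using finite_vimageI[of "{j. P j}" "\<lambda>j. j + d"] by (simp add: vimage_def inj_on_def)

section \<open>Regularised products of two fields and their restriction to the diagonal\<close>

context series_space
begin

abbreviation "lin \<equiv> Vector_Spaces.linear scale scale"

lemma lin_iff: "lin f \<longleftrightarrow> (\<forall>u v. f (u + v) = f u + f v) \<and> (\<forall>c v. f (scale c v) = scale c (f v))"
  by (simp add: Vector_Spaces.linear_iff vector_space_axioms)

lemma Sum_any_scale:
  assumes "finite {j. g j \<noteq> 0}"
  shows "Sum_any (\<lambda>j. scale c (g j)) = scale c (Sum_any g)"
proof -
  have "lin (scale c)" by (simp add: lin_iff scale_right_distrib mult.commute)
  from Sum_any_linear[OF this assms] show ?thesis ..
qed

lemma lin_0: "lin f \<Longrightarrow> f 0 = 0"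
  by (metis lin_iff scale_zero_left)

lemma hom1D:
  assumes "a \<in> hom1 scale"
  shows "lin (\<lambda>v. a v k)" and "\<exists>N. \<forall>k<N. a v k = 0"
  using assms by (auto simp: hom1_def)

lemma hom2D:
  assumes "f \<in> hom2 scale"
  shows "lin (\<lambda>v. f v k l)" and "\<exists>N. \<forall>k l. k < N \<or> l < N \<longrightarrow> f v k l = 0"
  using assms by (auto simp: hom2_def)

lemma hom2_finite:
  assumes "f \<in> hom2 scale"
  shows "finite {j. f v j (m - j) \<noteq> 0}"
proof -
  obtain N where "\<forall>k l. k < N \<or> l < N \<longrightarrow> f v k l = 0"
    using hom2D(2)[OF assms] by blast
  thus ?thesis by (intro finite_antidiagonal) auto
qed

lemma mult_ratio_pmul: "mult_ratio scale p f v k l = pmul p sh2 (\<lambda>(k, l). f v k l) (k, l)"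
proof -
  have "(sh2 ^^ j) (k, l) = (k + int j, l - int j)" for j
    by (induction j) (auto simp: sh2_def)
  thus ?thesis
    by (simp add: mult_ratio_def pmul_def)
qed

lemma pmul_sh12: "pmul p sh12 g (i, j, k) = pmul p sh2 (\<lambda>(i, j). g (i, j, k)) (i, j)"
  using pmul_reindex[of "\<lambda>(i, j). (i, j, k)" sh2 sh12 p g "(i, j)"]
  by (simp add: sh_defs split_def)

lemma pmul_sh13: "pmul p sh13 g (i, j, k) = pmul p sh2 (\<lambda>(i, k). g (i, j, k)) (i, k)"
  using pmul_reindex[of "\<lambda>(i, k). (i, j, k)" sh2 sh13 p g "(i, k)"]
  by (simp add: sh_defs split_def)

lemma pmul_sh23: "pmul p sh23 g (i, j, k) = pmul p sh2 (\<lambda>(j, k). g (i, j, k)) (j, k)"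
  using pmul_reindex[of "\<lambda>(j, k). (i, j, k)" sh2 sh23 p g "(j, k)"]
  by (simp add: sh_defs split_def)

lemma pmul_commute3:
  assumes "s \<in> {sh12, sh13, sh23}" "t \<in> {sh12, sh13, sh23}"
  shows "pmul p s (pmul p' t g) = pmul p' t (pmul p s g)"
  by (rule ext, rule pmul_commute) (use assms in \<open>auto simp: sh_defs split: prod.splits\<close>)

text \<open>\<open>p(z\<^sub>2/z\<^sub>1) a(z\<^sub>1) b(z\<^sub>2) = p'(z\<^sub>2/z\<^sub>1) b(z\<^sub>2) a(z\<^sub>1)\<close>\<close>

definition exchange :: "'f poly \<Rightarrow> 'f poly \<Rightarrow> 'v field1 \<Rightarrow> 'v field1 \<Rightarrow> bool" where
  "exchange p p' a b \<longleftrightarrow>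
    (\<forall>v. pmul p sh2 (\<lambda>(k, l). a (b v l) k) = pmul p' sh2 (\<lambda>(k, l). b (a v k) l))"

text \<open>The left side of the exchange relation bounds the exponents of z2, the right side those
  of z1; being equal, the two series obey both bounds.\<close>

lemma exchange_hom2:
  assumes "exchange p p' a b" "a \<in> hom1 scale" "b \<in> hom1 scale"
  shows "mult_ratio scale p (comp_fields a b) \<in> hom2 scale"
  unfolding hom2_def mem_Collect_eq
proof (intro conjI allI)
  fix k l
  have "lin (\<lambda>v. pmul p sh2 ((\<lambda>v (k, l). a (b v l) k) v) (k, l))"
  proof (rule pmul_fun_linear)
    fix x :: "int \<times> int"
    show "lin (\<lambda>v. (\<lambda>v (k, l). a (b v l) k) v x)"
      using hom1D(1)[OF assms(2), of "fst x"] hom1D(1)[OF assms(3), of "snd x"]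
      by (simp add: lin_iff case_prod_beta)
  qed
  thus "lin (\<lambda>v. mult_ratio scale p (comp_fields a b) v k l)"
    by (simp add: mult_ratio_pmul comp_fields_def)
next
  fix v
  obtain N where N: "\<And>k. k < N \<Longrightarrow> a v k = 0" using hom1D(2)[OF assms(2)] by blast
  obtain M where M: "\<And>k. k < M \<Longrightarrow> b v k = 0" using hom1D(2)[OF assms(3)] by blast
  \<comment> \<open>\<open>sh2\<close> lowers l, so the bound M from \<open>b v l\<close> is kept,
    but it raises k up to \<open>degree p'\<close> times, which is lost from the bound N on
    \<open>a v k\<close>.\<close>
  let ?K = "min (N - int (degree p')) M"
  have a0: "a 0 k = 0" and b0: "b 0 k = 0" for k
    using lin_0[OF hom1D(1)[OF assms(2)]] lin_0[OF hom1D(1)[OF assms(3)]] by auto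
  have "pmul p sh2 (\<lambda>(k, l). a (b v l) k) (k, l) = 0" if "l < M" for k l
    by (rule pmul_vanish[where h = snd and d = 0 and N = M])
       (use that in \<open>auto simp: sh2_def M a0\<close>)
  moreover have "pmul p' sh2 (\<lambda>(k, l). b (a v k) l) (k, l) = 0" if "k < N - int (degree p')" for k l
    by (rule pmul_vanish[where h = fst and d = 1 and N = N])
       (use that in \<open>auto simp: sh2_def N b0\<close>)
  ultimately have "\<forall>k l. k < ?K \<or> l < ?K \<longrightarrow> mult_ratio scale p (comp_fields a b) v k l = 0"
    using assms(1) unfolding mult_ratio_pmul comp_fields_def exchange_def
    by (metis min_less_iff_conj)
  thus "\<exists>N. \<forall>k l. k < N \<or> l < N \<longrightarrow> mult_ratio scale p (comp_fields a b) v k l = 0" ..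
qed

lemma diag_hom1:
  assumes "f \<in> hom2 scale"
  shows "diag f \<in> hom1 scale"
  unfolding hom1_def mem_Collect_eq
proof (intro conjI allI)
  fix k
  have "Sum_any (\<lambda>j. f (u + v) j (k - j)) = Sum_any (\<lambda>j. f u j (k - j)) + Sum_any (\<lambda>j. f v j (k - j))"
    for u v
  proof -
    have "f (u + v) j (k - j) = f u j (k - j) + f v j (k - j)" for j
      using hom2D(1)[OF assms] by (simp add: lin_iff)
    thus ?thesis by (simp add: Sum_any.distrib hom2_finite[OF assms])
  qed
  moreover have "Sum_any (\<lambda>j. f (scale c v) j (k - j)) = scale c (Sum_any (\<lambda>j. f v j (k - j)))" for c v
  proof -
    have "f (scale c v) j (k - j) = scale c (f v j (k - j))" for j
      using hom2D(1)[OF assms] by (simp add: lin_iff)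
    thus ?thesis by (simp add: Sum_any_scale hom2_finite[OF assms])
  qed
  ultimately show "lin (\<lambda>v. diag f v k)"
    by (simp add: lin_iff diag_def)
next
  fix v
  obtain N where N: "\<And>k l. k < N \<or> l < N \<Longrightarrow> f v k l = 0" using hom2D(2)[OF assms] by blast
  have "f v j (k - j) = 0" if "k < 2 * N" for j k
    by (rule N) (use that in linarith)
  hence "\<forall>k<2 * N. diag f v k = 0" by (simp add: diag_def)
  thus "\<exists>N. \<forall>k<N. diag f v k = 0" ..
qed

lemma diag_pmul_sh2:
  assumes "\<And>m. finite {j. g (j, m - j) \<noteq> 0}"
  shows "Sum_any (\<lambda>j. pmul p sh2 g (j, m - j)) = scale (poly p 1) (Sum_any (\<lambda>j. g (j, m - j)))"
proof -
  let ?U = "{g :: int \<times> int \<Rightarrow> 'v. \<forall>m. finite {j. g (j, m - j) \<noteq> 0}}"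
  let ?\<Phi> = "\<lambda>(g :: int \<times> int \<Rightarrow> 'v) m. Sum_any (\<lambda>j. g (j, m - j))"
  have sum_fin: "finite {j. g (j, m - j) + h (j, m - j) \<noteq> 0}" if "g \<in> ?U" "h \<in> ?U" for g h m
    by (rule finite_subset[of _ "{j. g (j, m - j) \<noteq> 0} \<union> {j. h (j, m - j) \<noteq> 0}"]) (use that in auto)
  have sc_fin: "finite {j. scale c (g (j, m - j)) \<noteq> 0}" if "g \<in> ?U" for g c m
    by (rule finite_subset[of _ "{j. g (j, m - j) \<noteq> 0}"]) (use that in auto)
  have sh_fin: "finite {j. g (sh2 (j, m - j)) \<noteq> 0}" if "g \<in> ?U" for g m
    using finite_int_shift[of "\<lambda>j. g (j, m - j) \<noteq> 0" 1] that by (simp add: sh2_def diff_diff_eq)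
  have sh_sum: "?\<Phi> (\<lambda>k. g (sh2 k)) m = ?\<Phi> g (id m)" if "g \<in> ?U" for g m
    using Sum_any_shift[of "\<lambda>j. g (j, m - j)" 1] by (simp add: sh2_def algebra_simps)
  have lin_sum: "Sum_any (\<lambda>j. scale c (g (j, m - j))) = scale c (Sum_any (\<lambda>j. g (j, m - j)))"
    if "g \<in> ?U" for g c m
    using Sum_any_scale[of "\<lambda>j. g (j, m - j)"] that by simp
  have U: "(\<lambda>k. 0) \<in> ?U"
    "g \<in> ?U \<Longrightarrow> h \<in> ?U \<Longrightarrow> (\<lambda>k. g k + h k) \<in> ?U"
    "g \<in> ?U \<Longrightarrow> (\<lambda>k. scale c (g k)) \<in> ?U"
    "g \<in> ?U \<Longrightarrow> (\<lambda>k. g (sh2 k)) \<in> ?U" for g h c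
    using sum_fin[of g h] sc_fin[of g c] sh_fin[of g] by auto
  have \<Phi>: "?\<Phi> (\<lambda>k. 0) m = 0"
    "g \<in> ?U \<Longrightarrow> h \<in> ?U \<Longrightarrow> ?\<Phi> (\<lambda>k. g k + h k) m = ?\<Phi> g m + ?\<Phi> h m" for g h m
    using Sum_any.distrib[of "\<lambda>j. g (j, m - j)" "\<lambda>j. h (j, m - j)"] by simp_all
  have g: "g \<in> ?U" by (rule CollectI, rule allI, rule assms)
  have "?\<Phi> (pmul p sh2 g) m = pmul p id (?\<Phi> g) m"
    by (rule pmul_intertwine(2)[where U = ?U and \<Phi> = ?\<Phi> and s' = id])
       (rule U(1), rule \<Phi>(1), erule (1) U(2), erule (1) \<Phi>(2), erule U(3), erule lin_sum,
        erule U(4), erule sh_sum, rule g)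
  thus "Sum_any (\<lambda>j. pmul p sh2 g (j, m - j)) = scale (poly p 1) (Sum_any (\<lambda>j. g (j, m - j)))"
    by (simp only: pmul_id)
qed

section \<open>Partial diagonals of series in three variables\<close>

definition diag12 :: "(int \<times> int \<times> int \<Rightarrow> 'v) \<Rightarrow> int \<times> int \<Rightarrow> 'v" where
  "diag12 g = (\<lambda>(m, k). Sum_any (\<lambda>j. g (j, m - j, k)))"

definition diag23 :: "(int \<times> int \<times> int \<Rightarrow> 'v) \<Rightarrow> int \<times> int \<Rightarrow> 'v" where
  "diag23 g = (\<lambda>(i, m). Sum_any (\<lambda>j. g (i, j, m - j)))"

text \<open>Finiteness is asked for each m and k separately: for a series f(z1,z2) c(z3) v the bound
  varies with the vector \<open>c v k\<close>.\<close>

definition fin12 :: "(int \<times> int \<times> int \<Rightarrow> 'v) set" where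
  "fin12 = {g. \<forall>m k. finite {j. g (j, m - j, k) \<noteq> 0}}"

definition fin23 :: "(int \<times> int \<times> int \<Rightarrow> 'v) set" where
  "fin23 = {g. \<forall>i m. finite {j. g (i, j, m - j) \<noteq> 0}}"

text \<open>Once z1 = z2 = z, both z3/z1 and z3/z2 become z3/z, so either shift descends to
  \<open>sh2\<close>.\<close>

lemma
  assumes "g \<in> fin12" and s: "s \<in> {sh13, sh23}"
  shows pmul_fin12: "pmul p s g \<in> fin12"
    and diag12_pmul: "diag12 (pmul p s g) = pmul p sh2 (diag12 g)"
proof -
  have fin: "finite {j. g (j, m - j, k) \<noteq> 0}" if "g \<in> fin12" for g m k
    by (rule that[unfolded fin12_def, THEN CollectD, THEN spec, THEN spec])
  have sum_fin: "finite {j. g (j, m - j, k) + h (j, m - j, k) \<noteq> 0}"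
    if "g \<in> fin12" "h \<in> fin12" for g h m k
    by (rule finite_subset[OF _ finite_UnI[OF fin[OF that(1), of m k] fin[OF that(2), of m k]]]) auto
  have sc_fin: "finite {j. scale c (g (j, m - j, k)) \<noteq> 0}" if "g \<in> fin12" for g c m k
    by (rule finite_subset[OF _ fin[OF that, of m k]]) auto
  have sh_fin: "finite {j. g (s (j, m - j, k)) \<noteq> 0}" if "g \<in> fin12" for g m k
  proof -
    have fin: "finite {j. g (j, m + 1 - j, k - 1) \<noteq> 0}"
      using that by (rule fin)
    have "finite {j. g (j + 1, m - j, k - 1) \<noteq> 0}"
      using finite_int_shift[OF fin, of 1] by simp
    moreover have "m + 1 - j = m - j + 1" for j by simp
    with fin have "finite {j. g (j, m - j + 1, k - 1) \<noteq> 0}" by (simp only:)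
    ultimately show ?thesis
      using s by (elim insertE) (simp_all add: sh_defs)
  qed
  have sh_sum: "diag12 (\<lambda>k. g (s k)) x = diag12 g (sh2 x)" for g x
  proof -
    obtain m k where x: "x = (m, k)" by (cases x)
    \<comment> \<open>Both shifts carry the antidiagonal of m to that of m + 1; \<open>sh13\<close>
      moreover translates the summation index along it.\<close>
    have "Sum_any (\<lambda>j. g (j + 1, m - j, k - 1)) = Sum_any (\<lambda>j. g (j, m + 1 - j, k - 1))"
      using Sum_any_shift[of "\<lambda>j. g (j, m + 1 - j, k - 1)" 1] by simp
    moreover have "m + 1 - j = m - j + 1" for j by simp
    hence "Sum_any (\<lambda>j. g (j, m + 1 - j, k - 1)) = Sum_any (\<lambda>j. g (j, m - j + 1, k - 1))"
      by (simp only:)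
    ultimately show ?thesis
      using s by (elim insertE) (simp_all add: x sh_defs diag12_def)
  qed
  have finI: "g \<in> fin12" if "\<And>m k. finite {j. g (j, m - j, k) \<noteq> 0}" for g
    unfolding fin12_def using that by (intro CollectI allI)
  have U: "(\<lambda>k. 0) \<in> fin12"
    "g \<in> fin12 \<Longrightarrow> h \<in> fin12 \<Longrightarrow> (\<lambda>k. g k + h k) \<in> fin12"
    "g \<in> fin12 \<Longrightarrow> (\<lambda>k. scale c (g k)) \<in> fin12"
    "g \<in> fin12 \<Longrightarrow> (\<lambda>k. g (s k)) \<in> fin12" for g h c
    by (rule finI, simp)
       (rule finI, rule sum_fin[of g h], assumption, assumption,
        rule finI, rule sc_fin[of g], assumption, rule finI, rule sh_fin[of g], assumption)
  have \<Phi>: "diag12 (\<lambda>k. 0) x = 0"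
    "g \<in> fin12 \<Longrightarrow> h \<in> fin12 \<Longrightarrow> diag12 (\<lambda>k. g k + h k) x = diag12 g x + diag12 h x"
    "g \<in> fin12 \<Longrightarrow> diag12 (\<lambda>k. scale c (g k)) x = scale c (diag12 g x)" for g h c x
  proof -
    obtain m k where x: "x = (m, k)" by (cases x)
    show "diag12 (\<lambda>k. 0) x = 0" by (simp add: x diag12_def)
    show "diag12 (\<lambda>k. g k + h k) x = diag12 g x + diag12 h x" if "g \<in> fin12" "h \<in> fin12"
      using Sum_any.distrib[OF fin[OF that(1), of m k] fin[OF that(2), of m k]]
      by (simp add: x diag12_def)
    show "diag12 (\<lambda>k. scale c (g k)) x = scale c (diag12 g x)" if "g \<in> fin12"
      using Sum_any_scale[OF fin[OF that, of m k], of c] by (simp add: x diag12_def)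
  qed
  show "pmul p s g \<in> fin12"
    by (rule pmul_intertwine(1)[where U = fin12 and \<Phi> = diag12 and s' = sh2])
       (rule U(1), rule \<Phi>(1), erule (1) U(2), erule (1) \<Phi>(2), erule U(3), erule \<Phi>(3),
        erule U(4), rule sh_sum, rule assms(1))
  show "diag12 (pmul p s g) = pmul p sh2 (diag12 g)"
    by (rule ext, rule pmul_intertwine(2)[where U = fin12 and \<Phi> = diag12 and s' = sh2])
       (rule U(1), rule \<Phi>(1), erule (1) U(2), erule (1) \<Phi>(2), erule U(3), erule \<Phi>(3),
        erule U(4), rule sh_sum, rule assms(1))
qed

text \<open>Here z2 = z3 = z identifies the ratios z2/z1 and z3/z1 with z/z1.\<close>

lemma
  assumes "g \<in> fin23" and s: "s \<in> {sh12, sh13}"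
  shows pmul_fin23: "pmul p s g \<in> fin23"
    and diag23_pmul: "diag23 (pmul p s g) = pmul p sh2 (diag23 g)"
proof -
  have fin: "finite {j. g (i, j, m - j) \<noteq> 0}" if "g \<in> fin23" for g m i
    by (rule that[unfolded fin23_def, THEN CollectD, THEN spec, THEN spec])
  have sum_fin: "finite {j. g (i, j, m - j) + h (i, j, m - j) \<noteq> 0}"
    if "g \<in> fin23" "h \<in> fin23" for g h m i
    by (rule finite_subset[OF _ finite_UnI[OF fin[OF that(1), of i m] fin[OF that(2), of i m]]]) auto
  have sc_fin: "finite {j. scale c (g (i, j, m - j)) \<noteq> 0}" if "g \<in> fin23" for g c m i
    by (rule finite_subset[OF _ fin[OF that, of i m]]) auto
  have sh_fin: "finite {j. g (s (i, j, m - j)) \<noteq> 0}" if "g \<in> fin23" for g m i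
  proof -
    have fin: "finite {j. g (i + 1, j, m - 1 - j) \<noteq> 0}"
      using that by (rule fin)
    have "finite {j. g (i + 1, j - 1, m - j) \<noteq> 0}"
      using finite_int_shift[OF fin, of "- 1"] by simp
    moreover have "m - 1 - j = m - j - 1" for j by simp
    with fin have "finite {j. g (i + 1, j, m - j - 1) \<noteq> 0}" by (simp only:)
    ultimately show ?thesis
      using s by (elim insertE) (simp_all add: sh_defs)
  qed
  have sh_sum: "diag23 (\<lambda>k. g (s k)) x = diag23 g (sh2 x)" for g x
  proof -
    obtain i m where x: "x = (i, m)" by (cases x)
    have "Sum_any (\<lambda>j. g (i + 1, j - 1, m - j)) = Sum_any (\<lambda>j. g (i + 1, j, m - 1 - j))"
      using Sum_any_shift[of "\<lambda>j. g (i + 1, j, m - 1 - j)" "- 1"] by simp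
    moreover have "m - 1 - j = m - j - 1" for j by simp
    hence "Sum_any (\<lambda>j. g (i + 1, j, m - 1 - j)) = Sum_any (\<lambda>j. g (i + 1, j, m - j - 1))"
      by (simp only:)
    ultimately show ?thesis
      using s by (elim insertE) (simp_all add: x sh_defs diag23_def)
  qed
  have finI: "g \<in> fin23" if "\<And>m k. finite {j. g (k, j, m - j) \<noteq> 0}" for g
    unfolding fin23_def using that by (intro CollectI allI)
  have U: "(\<lambda>k. 0) \<in> fin23"
    "g \<in> fin23 \<Longrightarrow> h \<in> fin23 \<Longrightarrow> (\<lambda>k. g k + h k) \<in> fin23"
    "g \<in> fin23 \<Longrightarrow> (\<lambda>k. scale c (g k)) \<in> fin23"
    "g \<in> fin23 \<Longrightarrow> (\<lambda>k. g (s k)) \<in> fin23" for g h c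
    by (rule finI, simp)
       (rule finI, rule sum_fin[of g h], assumption, assumption,
        rule finI, rule sc_fin[of g], assumption, rule finI, rule sh_fin[of g], assumption)
  have \<Phi>: "diag23 (\<lambda>k. 0) x = 0"
    "g \<in> fin23 \<Longrightarrow> h \<in> fin23 \<Longrightarrow> diag23 (\<lambda>k. g k + h k) x = diag23 g x + diag23 h x"
    "g \<in> fin23 \<Longrightarrow> diag23 (\<lambda>k. scale c (g k)) x = scale c (diag23 g x)" for g h c x
  proof -
    obtain i m where x: "x = (i, m)" by (cases x)
    show "diag23 (\<lambda>k. 0) x = 0" by (simp add: x diag23_def)
    show "diag23 (\<lambda>k. g k + h k) x = diag23 g x + diag23 h x" if "g \<in> fin23" "h \<in> fin23"
      using Sum_any.distrib[OF fin[OF that(1), of i m] fin[OF that(2), of i m]]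
      by (simp add: x diag23_def)
    show "diag23 (\<lambda>k. scale c (g k)) x = scale c (diag23 g x)" if "g \<in> fin23"
      using Sum_any_scale[OF fin[OF that, of i m], of c] by (simp add: x diag23_def)
  qed
  show "pmul p s g \<in> fin23"
    by (rule pmul_intertwine(1)[where U = fin23 and \<Phi> = diag23 and s' = sh2])
       (rule U(1), rule \<Phi>(1), erule (1) U(2), erule (1) \<Phi>(2), erule U(3), erule \<Phi>(3),
        erule U(4), rule sh_sum, rule assms(1))
  show "diag23 (pmul p s g) = pmul p sh2 (diag23 g)"
    by (rule ext, rule pmul_intertwine(2)[where U = fin23 and \<Phi> = diag23 and s' = sh2])
       (rule U(1), rule \<Phi>(1), erule (1) U(2), erule (1) \<Phi>(2), erule U(3), erule \<Phi>(3),
        erule U(4), rule sh_sum, rule assms(1))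
qed

end

section \<open>Exchange relations\<close>

context series_space
begin

lemma exchangeD: "exchange p p' a b \<Longrightarrow>
    pmul p sh2 (\<lambda>(k, l). a (b v l) k) = pmul p' sh2 (\<lambda>(k, l). b (a v k) l)"
  by (simp add: exchange_def)

lemma pmul_lin: "(\<And>i. lin (\<lambda>v. a v i)) \<Longrightarrow> a (pmul p s g k) i = pmul p s (\<lambda>k. a (g k) i) k"
  using pmul_linear[of "\<lambda>v. a v i"] by simp

lemma exchange_right:
  assumes "\<And>i. lin (\<lambda>v. a v i)" "exchange p p' b c"
  shows "a (pmul p sh2 (\<lambda>(j, k). b (c v k) j) x) i = a (pmul p' sh2 (\<lambda>(j, k). c (b v j) k) x) i"
  using exchangeD[OF assms(2), of v] by simp

text \<open>The field c(z3) is moved through b(z2) and then through a(z1). The first exchange takes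
  place inside \<open>a\<close>, whose linearity lets the polynomial in z3/z2 pass; the second is
  applied to the vector \<open>b v j\<close>.\<close>

lemma exchange_left3:
  assumes a: "\<And>i. lin (\<lambda>v. a v i)" and 1: "exchange p p' a c" and 2: "exchange r r' b c"
  shows "pmul p sh13 (pmul r sh23 (\<lambda>(i, j, k). a (b (c v k) j) i)) =
    pmul p' sh13 (pmul r' sh23 (\<lambda>(i, j, k). c (a (b v j) i) k))"
proof -
  have "pmul r sh23 (\<lambda>(i, j, k). a (b (c v k) j) i) = pmul r' sh23 (\<lambda>(i, j, k). a (c (b v j) k) i)"
  proof (rule ext, clarify)
    fix i j k
    show "pmul r sh23 (\<lambda>(i, j, k). a (b (c v k) j) i) (i, j, k) =
        pmul r' sh23 (\<lambda>(i, j, k). a (c (b v j) k) i) (i, j, k)"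
      using exchange_right[OF a 2, where v = v and x = "(j, k)" and i = i]
      by (simp add: pmul_sh23 pmul_lin[OF a] split_def)
  qed
  moreover have "pmul p sh13 (\<lambda>(i, j, k). a (c (b v j) k) i) = pmul p' sh13 (\<lambda>(i, j, k). c (a (b v j) i) k)"
  proof (rule ext, clarify)
    fix i j k
    show "pmul p sh13 (\<lambda>(i, j, k). a (c (b v j) k) i) (i, j, k) =
        pmul p' sh13 (\<lambda>(i, j, k). c (a (b v j) i) k) (i, j, k)"
      using exchangeD[OF 1, of "b v j"] by (simp add: pmul_sh13)
  qed
  ultimately show ?thesis
    by (simp add: pmul_commute3[of sh13 sh23])
qed

lemma exchange_right3:
  assumes a: "\<And>i. lin (\<lambda>v. a v i)" and 1: "exchange p p' c a" and 2: "exchange r r' c b"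
  shows "pmul p sh12 (pmul r sh13 (\<lambda>(i, j, k). c (a (b v k) j) i)) =
    pmul p' sh12 (pmul r' sh13 (\<lambda>(i, j, k). a (b (c v i) k) j))"
proof -
  have "pmul p sh12 (\<lambda>(i, j, k). c (a (b v k) j) i) = pmul p' sh12 (\<lambda>(i, j, k). a (c (b v k) i) j)"
  proof (rule ext, clarify)
    fix i j k
    show "pmul p sh12 (\<lambda>(i, j, k). c (a (b v k) j) i) (i, j, k) =
        pmul p' sh12 (\<lambda>(i, j, k). a (c (b v k) i) j) (i, j, k)"
      using exchangeD[OF 1, of "b v k"] by (simp add: pmul_sh12)
  qed
  moreover have "pmul r sh13 (\<lambda>(i, j, k). a (c (b v k) i) j) = pmul r' sh13 (\<lambda>(i, j, k). a (b (c v i) k) j)"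
  proof (rule ext, clarify)
    fix i j k
    show "pmul r sh13 (\<lambda>(i, j, k). a (c (b v k) i) j) (i, j, k) =
        pmul r' sh13 (\<lambda>(i, j, k). a (b (c v i) k) j) (i, j, k)"
      using exchange_right[OF a 2, where v = v and x = "(i, k)" and i = j]
      by (simp add: pmul_sh13 pmul_lin[OF a] split_def)
  qed
  ultimately have "pmul r sh13 (pmul p sh12 (\<lambda>(i, j, k). c (a (b v k) j) i)) =
      pmul r sh13 (pmul p' sh12 (\<lambda>(i, j, k). a (c (b v k) i) j))"
    and "pmul p' sh12 (pmul r sh13 (\<lambda>(i, j, k). a (c (b v k) i) j)) =
      pmul p' sh12 (pmul r' sh13 (\<lambda>(i, j, k). a (b (c v i) k) j))"
    by simp_all
  thus ?thesis
    by (simp only: pmul_commute3[of sh13 sh12, OF insertI2[OF insertI1] insertI1])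
qed

lemma mult_ratio_sh12:
  assumes "f = mult_ratio scale p (comp_fields a b)"
  shows "(\<lambda>(i, j, k). f (w k) i j) = pmul p sh12 (\<lambda>(i, j, k). a (b (w k) j) i)"
  by (auto simp: fun_eq_iff assms mult_ratio_pmul comp_fields_def pmul_sh12)

lemma mult_ratio_sh23:
  assumes "f = mult_ratio scale p (comp_fields a b)"
  shows "(\<lambda>(i, j, k). f (w i) j k) = pmul p sh23 (\<lambda>(i, j, k). a (b (w i) k) j)"
  by (auto simp: fun_eq_iff assms mult_ratio_pmul comp_fields_def pmul_sh23)

lemma lin_mult_ratio_sh12:
  assumes "f = mult_ratio scale p (comp_fields a b)" and c: "\<And>k. lin (\<lambda>v. c v k)"
  shows "(\<lambda>(i, j, k). c (f v i j) k) = pmul p sh12 (\<lambda>(i, j, k). c (a (b v j) i) k)"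
  by (auto simp: fun_eq_iff assms(1) mult_ratio_pmul comp_fields_def pmul_sh12 pmul_lin[OF c] split_def)

lemma lin_mult_ratio_sh23:
  assumes "f = mult_ratio scale p (comp_fields a b)" and c: "\<And>k. lin (\<lambda>v. c v k)"
  shows "(\<lambda>(i, j, k). c (f v j k) i) = pmul p sh23 (\<lambda>(i, j, k). c (a (b v k) j) i)"
  by (auto simp: fun_eq_iff assms(1) mult_ratio_pmul comp_fields_def pmul_sh23 pmul_lin[OF c] split_def)

lemma lin_diag:
  assumes f: "f \<in> hom2 scale" and c: "\<And>k. lin (\<lambda>v. c v k)"
  shows "c (diag f v m) k = Sum_any (\<lambda>j. c (f v j (m - j)) k)"
  using Sum_any_linear[OF c hom2_finite[OF f]] by (simp add: diag_def)

lemma finite_lin_hom2: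
  assumes f: "f \<in> hom2 scale" and c: "\<And>k. lin (\<lambda>v. c v k)"
  shows "finite {j. c (f v j (m - j)) k \<noteq> 0}"
  using lin_0[OF c] by (intro finite_subset[OF _ hom2_finite[OF f, of v m]]) auto

lemma
  assumes f: "f \<in> hom2 scale"
  shows hom2_fin12: "(\<lambda>(i, j, k). f (w k) i j) \<in> fin12"
    and diag12_hom2: "diag12 (\<lambda>(i, j, k). f (w k) i j) = (\<lambda>(m, k). diag f (w k) m)"
    and hom2_fin23: "(\<lambda>(i, j, k). f (w i) j k) \<in> fin23"
    and diag23_hom2: "diag23 (\<lambda>(i, j, k). f (w i) j k) = (\<lambda>(i, m). diag f (w i) m)"
  by (auto simp: fin12_def fin23_def hom2_finite[OF f] diag12_def diag23_def diag_def)

lemma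
  assumes f: "f \<in> hom2 scale" and c: "\<And>k. lin (\<lambda>v. c v k)"
  shows lin_hom2_fin12: "(\<lambda>(i, j, k). c (f v i j) k) \<in> fin12"
    and lin_diag12_hom2: "diag12 (\<lambda>(i, j, k). c (f v i j) k) = (\<lambda>(m, k). c (diag f v m) k)"
    and lin_hom2_fin23: "(\<lambda>(i, j, k). c (f v j k) i) \<in> fin23"
    and lin_diag23_hom2: "diag23 (\<lambda>(i, j, k). c (f v j k) i) = (\<lambda>(i, m). c (diag f v m) i)"
  by (auto simp: fin12_def fin23_def finite_lin_hom2[where c = c, OF f c] lin_diag[where c = c, OF f c] diag12_def diag23_def)

text \<open>Dong's lemma. The exchanges are made in the unregularised threefold product, with the
  commuting factor p0(z2/z1) kept outside. This factor provides the finite sums that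
  \<open>diag12\<close> needs, so z1 = z2 is set only around the regularised series. The two ratios
  then merge and the polynomials multiply.\<close>

lemma exchange_diag_left:
  assumes a: "a \<in> hom1 scale" and c: "c \<in> hom1 scale"
    and f: "f = mult_ratio scale p0 (comp_fields a b)" "f \<in> hom2 scale"
    and 1: "exchange p p' a c" and 2: "exchange r r' b c"
  shows "exchange (p * r) (p' * r') (diag f) c"
  unfolding exchange_def
proof
  fix v
  let ?fc = "\<lambda>(i, j, k). f (c v k) i j" and ?cf = "\<lambda>(i, j, k). c (f v i j) k"
  note linc = hom1D(1)[OF c] and lina = hom1D(1)[OF a]
  have mult: "pmul (s * t) sh2 g = pmul s sh2 (pmul t sh2 g)" for s t and g :: "_ \<Rightarrow> 'v"
    by (simp add: fun_eq_iff pmul_mult)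
  have "pmul (p * r) sh2 (diag12 ?fc) = diag12 (pmul p sh13 (pmul r sh23 ?fc))"
    by (simp add: mult diag12_pmul pmul_fin12 hom2_fin12[OF f(2)])
  also have "pmul p sh13 (pmul r sh23 ?fc) =
      pmul p0 sh12 (pmul p sh13 (pmul r sh23 (\<lambda>(i, j, k). a (b (c v k) j) i)))"
    by (simp add: mult_ratio_sh12[OF f(1)] pmul_commute3[of _ sh12])
  also have "\<dots> = pmul p0 sh12 (pmul p' sh13 (pmul r' sh23 (\<lambda>(i, j, k). c (a (b v j) i) k)))"
    by (simp only: exchange_left3[OF lina 1 2])
  also have "\<dots> = pmul p' sh13 (pmul r' sh23 ?cf)"
    by (simp add: lin_mult_ratio_sh12[OF f(1) linc] pmul_commute3[of _ sh12])
  also have "diag12 \<dots> = pmul (p' * r') sh2 (diag12 ?cf)"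
    by (simp add: mult diag12_pmul pmul_fin12 lin_hom2_fin12[OF f(2) linc])
  finally show "pmul (p * r) sh2 (\<lambda>(k, l). diag f (c v l) k) = pmul (p' * r') sh2 (\<lambda>(k, l). c (diag f v k) l)"
    by (simp add: diag12_hom2[OF f(2)] lin_diag12_hom2[OF f(2) linc])
qed

text \<open>The same argument with c on the first variable: now z2/z1 and z3/z1 merge under z2 =
  z3.\<close>

lemma exchange_diag_right:
  assumes a: "a \<in> hom1 scale" and c: "c \<in> hom1 scale"
    and f: "f = mult_ratio scale p0 (comp_fields a b)" "f \<in> hom2 scale"
    and 1: "exchange p p' c a" and 2: "exchange r r' c b"
  shows "exchange (p * r) (p' * r') c (diag f)"
  unfolding exchange_def
proof
  fix v
  let ?fc = "\<lambda>(i, j, k). f (c v i) j k" and ?cf = "\<lambda>(i, j, k). c (f v j k) i"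
  note linc = hom1D(1)[OF c] and lina = hom1D(1)[OF a]
  have mult: "pmul (s * t) sh2 g = pmul s sh2 (pmul t sh2 g)" for s t and g :: "_ \<Rightarrow> 'v"
    by (simp add: fun_eq_iff pmul_mult)
  have "pmul (p * r) sh2 (diag23 ?cf) = diag23 (pmul p sh12 (pmul r sh13 ?cf))"
    by (simp add: mult diag23_pmul pmul_fin23 lin_hom2_fin23[OF f(2) linc])
  also have "pmul p sh12 (pmul r sh13 ?cf) =
      pmul p0 sh23 (pmul p sh12 (pmul r sh13 (\<lambda>(i, j, k). c (a (b v k) j) i)))"
    by (simp add: lin_mult_ratio_sh23[OF f(1) linc] pmul_commute3[of _ sh23])
  also have "\<dots> = pmul p0 sh23 (pmul p' sh12 (pmul r' sh13 (\<lambda>(i, j, k). a (b (c v i) k) j)))"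
    by (simp only: exchange_right3[OF lina 1 2])
  also have "\<dots> = pmul p' sh12 (pmul r' sh13 ?fc)"
    by (simp add: mult_ratio_sh23[OF f(1)] pmul_commute3[of _ sh23])
  also have "diag23 \<dots> = pmul (p' * r') sh2 (diag23 ?fc)"
    by (simp add: mult diag23_pmul pmul_fin23 hom2_fin23[OF f(2)])
  finally show "pmul (p * r) sh2 (\<lambda>(k, l). c (diag f v l) k) = pmul (p' * r') sh2 (\<lambda>(k, l). diag f (c v k) l)"
    by (simp add: diag23_hom2[OF f(2)] lin_diag23_hom2[OF f(2) linc])
qed

text \<open>Both sides sum F over the triples with i + j + k = n. The lower bound in all three
  indices leaves only finitely many of them.\<close>

lemma Sum_any_triple:
  fixes F :: "int \<Rightarrow> int \<Rightarrow> int \<Rightarrow> 'v"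
  assumes "\<And>i j k. i < N \<or> j < N \<or> k < N \<Longrightarrow> F i j k = 0"
  shows "Sum_any (\<lambda>m. Sum_any (\<lambda>j. F j (m - j) (n - m))) =
    Sum_any (\<lambda>m. Sum_any (\<lambda>j. F m j (n - m - j)))"
proof -
  have bd: "\<not> (i < N \<or> j < N \<or> k < N)" if "F i j k \<noteq> 0" for i j k
    using assms that by blast
  have "Sum_any (\<lambda>m. Sum_any (\<lambda>j. F j (m - j) (n - m))) = Sum_any (\<lambda>j. Sum_any (\<lambda>m. F j (m - j) (n - m)))"
  proof (rule Sum_any_swap)
    fix m j assume "F j (m - j) (n - m) \<noteq> 0"
    from bd[OF this] show "m \<in> {2 * N..n - N} \<and> j \<in> {N..n - 2 * N}" by auto
  qed simp_all
  also have "\<dots> = Sum_any (\<lambda>j. Sum_any (\<lambda>i. F j i (n - j - i)))"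
  proof -
    have "Sum_any (\<lambda>m. F j (m - j) (n - m)) = Sum_any (\<lambda>i. F j i (n - j - i))" for j
      using Sum_any_shift[of "\<lambda>m. F j (m - j) (n - m)" j] by (simp add: algebra_simps)
    thus ?thesis by simp
  qed
  finally show ?thesis .
qed

text \<open>An exponent is bounded once its field stands next to v. For c this holds at once, for b
  after the exchange with c, and for a after the exchanges with b and c. The degrees of the
  right-hand polynomials are lost where the shift raises the exponent.\<close>

lemma triple_bounded:
  assumes a: "a \<in> hom1 scale" and b: "b \<in> hom1 scale" and c: "c \<in> hom1 scale"
    and 12: "exchange p12 q12 a b" and 13: "exchange p13 q13 a c" and 23: "exchange p23 q23 b c"
  defines "F \<equiv> \<lambda>v. pmul p12 sh12 (pmul p13 sh13 (pmul p23 sh23 (\<lambda>(i, j, k). a (b (c v k) j) i)))"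
  shows "\<exists>N. \<forall>i j k. i < N \<or> j < N \<or> k < N \<longrightarrow> F v (i, j, k) = 0"
proof -
  obtain K1 where K1: "\<And>k. k < K1 \<Longrightarrow> a v k = 0" using hom1D(2)[OF a] by blast
  obtain K2 where K2: "\<And>k. k < K2 \<Longrightarrow> b v k = 0" using hom1D(2)[OF b] by blast
  obtain K3 where K3: "\<And>k. k < K3 \<Longrightarrow> c v k = 0" using hom1D(2)[OF c] by blast
  note lina = hom1D(1)[OF a] and linb = hom1D(1)[OF b] and linc = hom1D(1)[OF c]
  have zero [simp]: "a 0 k = 0" "b 0 k = 0" "c 0 k = 0" for k
    using lin_0[OF lina] lin_0[OF linb] lin_0[OF linc] by auto
  let ?h1 = "\<lambda>(i :: int, j :: int, k :: int). i"
  let ?h2 = "\<lambda>(i :: int, j :: int, k :: int). j"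
  let ?h3 = "\<lambda>(i :: int, j :: int, k :: int). k"
  have k: "F v x = 0" if "?h3 x < K3" for x
    unfolding F_def
    by (rule pmul_vanish[where h = ?h3 and d = 0 and N = K3], (auto simp: sh_defs)[],
        rule pmul_vanish[where h = ?h3 and d = 0 and N = K3], (auto simp: sh_defs)[],
        rule pmul_vanish[where h = ?h3 and d = 0 and N = K3])
       (use that K3 in \<open>auto simp: sh_defs\<close>)
  have eq23: "pmul p23 sh23 (\<lambda>(i, j, k). a (b (c v k) j) i) = pmul q23 sh23 (\<lambda>(i, j, k). a (c (b v j) k) i)"
  proof (rule ext, clarify)
    fix i j k
    show "pmul p23 sh23 (\<lambda>(i, j, k). a (b (c v k) j) i) (i, j, k) =
        pmul q23 sh23 (\<lambda>(i, j, k). a (c (b v j) k) i) (i, j, k)"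
      using exchange_right[OF lina 23, where v = v and x = "(j, k)" and i = i]
      by (simp add: pmul_sh23 pmul_lin[OF lina] split_def)
  qed
  have j: "F v x = 0" if "?h2 x < K2 - int (degree q23)" for x
    unfolding F_def eq23
    by (rule pmul_vanish[where h = ?h2 and d = 0 and N = "K2 - int (degree q23)"], (auto simp: sh_defs)[],
        rule pmul_vanish[where h = ?h2 and d = 0 and N = "K2 - int (degree q23)"], (auto simp: sh_defs)[],
        rule pmul_vanish[where h = ?h2 and d = 1 and N = K2])
       (use that K2 in \<open>auto simp: sh_defs\<close>)
  have "F v = pmul p23 sh23 (pmul p12 sh12 (pmul p13 sh13 (\<lambda>(i, j, k). a (b (c v k) j) i)))"
    unfolding F_def by (simp add: pmul_commute3[of _ sh23])
  also have "\<dots> = pmul p23 sh23 (pmul q12 sh12 (pmul q13 sh13 (\<lambda>(i, j, k). b (c (a v i) k) j)))"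
    by (simp only: exchange_right3[OF linb 12 13])
  finally have eq13: "F v = pmul p23 sh23 (pmul q12 sh12 (pmul q13 sh13 (\<lambda>(i, j, k). b (c (a v i) k) j)))" .
  have i: "F v x = 0" if "?h1 x < K1 - int (degree q13) - int (degree q12)" for x
    unfolding eq13
    by (rule pmul_vanish[where h = ?h1 and d = 0 and N = "K1 - int (degree q13) - int (degree q12)"], (auto simp: sh_defs)[],
        rule pmul_vanish[where h = ?h1 and d = 1 and N = "K1 - int (degree q13)"], (auto simp: sh_defs)[],
        rule pmul_vanish[where h = ?h1 and d = 1 and N = K1])
       (use that K1 in \<open>auto simp: sh_defs\<close>)
  show ?thesis
    by (rule exI[of _ "min (K1 - int (degree q13) - int (degree q12)) (min (K2 - int (degree q23)) K3)"])
       (use i j k in auto)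
qed

text \<open>Both sides are the restriction to z1 = z2 = z3 of one series \<open>F\<close>, the
  threefold product regularised in all pairs. On the left p12 is absorbed into f, and z1 = z2 merges
  the ratios of p13 and p23; on the right p23 is absorbed into g, and z2 = z3 merges those of p12
  and p13.\<close>

lemma diag_assoc:
  assumes a: "a \<in> hom1 scale" and b: "b \<in> hom1 scale" and c: "c \<in> hom1 scale"
    and 12: "exchange p12 q12 a b" and 13: "exchange p13 q13 a c" and 23: "exchange p23 q23 b c"
    and f: "f = mult_ratio scale p12 (comp_fields a b)" and g: "g = mult_ratio scale p23 (comp_fields b c)"
  shows "diag (mult_ratio scale (p13 * p23) (comp_fields (diag f) c)) =
    diag (mult_ratio scale (p12 * p13) (comp_fields a (diag g)))"
proof (rule ext, rule ext)
  fix v n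
  have f2: "f \<in> hom2 scale" and g2: "g \<in> hom2 scale"
    unfolding f g by (intro exchange_hom2[OF 12 a b] exchange_hom2[OF 23 b c])+
  note lina = hom1D(1)[OF a]
  let ?H = "\<lambda>(i, j, k). a (b (c v k) j) i"
  let ?fc = "\<lambda>(i, j, k). f (c v k) i j" and ?ag = "\<lambda>(i, j, k). a (g v j k) i"
  define F where "F = pmul p12 sh12 (pmul p13 sh13 (pmul p23 sh23 ?H))"
  have mult: "pmul (s * t) sh2 g = pmul s sh2 (pmul t sh2 g)" for s t and g :: "_ \<Rightarrow> 'v"
    by (simp add: fun_eq_iff pmul_mult)
  have "pmul (p13 * p23) sh2 (\<lambda>(m, k). diag f (c v k) m) = diag12 (pmul p13 sh13 (pmul p23 sh23 ?fc))"
    by (simp add: mult diag12_pmul pmul_fin12 hom2_fin12[OF f2] diag12_hom2[OF f2])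
  also have "\<dots> = diag12 F"
    by (simp add: F_def mult_ratio_sh12[OF f] pmul_commute3[of _ sh12])
  finally have 1: "pmul (p13 * p23) sh2 (\<lambda>(m, k). diag f (c v k) m) = diag12 F" .
  have "pmul (p12 * p13) sh2 (\<lambda>(i, m). a (diag g v m) i) = diag23 (pmul p12 sh12 (pmul p13 sh13 ?ag))"
    by (simp add: mult diag23_pmul pmul_fin23 lin_hom2_fin23[OF g2 lina] lin_diag23_hom2[OF g2 lina])
  also have "\<dots> = diag23 F"
    by (simp add: F_def lin_mult_ratio_sh23[OF g lina])
  finally have 2: "pmul (p12 * p13) sh2 (\<lambda>(i, m). a (diag g v m) i) = diag23 F" .
  obtain N where N: "\<And>i j k. i < N \<or> j < N \<or> k < N \<Longrightarrow> F (i, j, k) = 0"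
    using triple_bounded[OF a b c 12 13 23, of v] unfolding F_def by blast
  have "diag (mult_ratio scale (p13 * p23) (comp_fields (diag f) c)) v n =
      Sum_any (\<lambda>m. Sum_any (\<lambda>j. F (j, m - j, n - m)))"
    by (simp add: diag_def[of "mult_ratio _ _ _"] mult_ratio_pmul comp_fields_def 1) (simp add: diag12_def)
  also have "\<dots> = Sum_any (\<lambda>m. Sum_any (\<lambda>j. F (m, j, n - m - j)))"
    by (rule Sum_any_triple) (rule N)
  also have "\<dots> = diag (mult_ratio scale (p12 * p13) (comp_fields a (diag g))) v n"
    by (simp add: diag_def[of "mult_ratio _ _ _"] mult_ratio_pmul comp_fields_def 2) (simp add: diag23_def)
  finally show "diag (mult_ratio scale (p13 * p23) (comp_fields (diag f) c)) v n =
    diag (mult_ratio scale (p12 * p13) (comp_fields a (diag g))) v n" .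
qed

lemma diag_mult_ratio:
  assumes "f \<in> hom2 scale"
  shows "diag (mult_ratio scale p f) v m = scale (poly p 1) (diag f v m)"
  using diag_pmul_sh2[of "\<lambda>(k, l). f v k l" p m] hom2_finite[OF assms]
  by (simp add: diag_def mult_ratio_pmul)

end

section \<open>Products of homogeneous elements\<close>

context series_space
begin

lemma mult_ratio_mult: "mult_ratio scale p (mult_ratio scale p' f) = mult_ratio scale (p * p') f"
proof (intro ext)
  fix v k l
  have "(\<lambda>(k, l). pmul p' sh2 (\<lambda>(k, l). f v k l) (k, l)) = pmul p' sh2 (\<lambda>(k, l). f v k l)"
    by auto
  thus "mult_ratio scale p (mult_ratio scale p' f) v k l = mult_ratio scale (p * p') f v k l"
    by (simp add: mult_ratio_pmul pmul_mult)
qed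

lemma mult_ratio_add: "mult_ratio scale p (f + g) = mult_ratio scale p f + mult_ratio scale p g"
  by (intro ext) (simp add: mult_ratio_def scale_right_distrib sum.distrib)

lemma mult_ratio_scale:
  "mult_ratio scale p (\<lambda>v k l. scale c (f v k l)) = (\<lambda>v k l. scale c (mult_ratio scale p f v k l))"
  by (intro ext) (simp add: mult_ratio_def scale_sum_right mult.commute)

lemma hom2_0: "0 \<in> hom2 scale"
  by (simp add: hom2_def lin_iff)

lemma hom2_add:
  assumes "f \<in> hom2 scale" "g \<in> hom2 scale"
  shows "f + g \<in> hom2 scale"
  unfolding hom2_def mem_Collect_eq
proof (intro conjI allI)
  fix k l
  show "lin (\<lambda>v. (f + g) v k l)"
    using hom2D(1)[OF assms(1), of k l] hom2D(1)[OF assms(2), of k l]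
    by (simp add: lin_iff scale_right_distrib)
next
  fix v
  obtain N M where "\<forall>k l. k < N \<or> l < N \<longrightarrow> f v k l = 0" "\<forall>k l. k < M \<or> l < M \<longrightarrow> g v k l = 0"
    using hom2D(2)[OF assms(1)] hom2D(2)[OF assms(2)] by blast
  thus "\<exists>N. \<forall>k l. k < N \<or> l < N \<longrightarrow> (f + g) v k l = 0"
    by (intro exI[of _ "min N M"]) auto
qed

lemma hom2_scale:
  assumes "f \<in> hom2 scale"
  shows "(\<lambda>v k l. scale c (f v k l)) \<in> hom2 scale"
  unfolding hom2_def mem_Collect_eq
proof (intro conjI allI)
  fix k l
  show "lin (\<lambda>v. scale c (f v k l))"
    using hom2D(1)[OF assms, of k l] by (simp add: lin_iff scale_right_distrib mult.commute)
next
  fix v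
  show "\<exists>N. \<forall>k l. k < N \<or> l < N \<longrightarrow> scale c (f v k l) = 0"
    using hom2D(2)[OF assms, of v] by fastforce
qed

lemma hom2_mult_ratio:
  assumes "f \<in> hom2 scale"
  shows "mult_ratio scale p f \<in> hom2 scale"
  unfolding hom2_def mem_Collect_eq
proof (intro conjI allI)
  fix k l
  have "lin (\<lambda>v. pmul p sh2 ((\<lambda>v (k, l). f v k l) v) (k, l))"
    by (rule pmul_fun_linear) (use hom2D(1)[OF assms] in \<open>simp add: split_def\<close>)
  thus "lin (\<lambda>v. mult_ratio scale p f v k l)"
    by (simp add: mult_ratio_pmul)
next
  fix v
  obtain N where N: "\<forall>k l. k < N \<or> l < N \<longrightarrow> f v k l = 0"
    using hom2D(2)[OF assms] by blast
  show "\<exists>N. \<forall>k l. k < N \<or> l < N \<longrightarrow> mult_ratio scale p f v k l = 0"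
  proof (intro exI allI impI)
    fix k l assume kl: "k < N - int (degree p) \<or> l < N - int (degree p)"
    show "mult_ratio scale p f v k l = 0"
      unfolding mult_ratio_def
      by (intro sum.neutral ballI) (use kl N in auto)
  qed
qed

lemma diag_add:
  assumes "f \<in> hom2 scale" "g \<in> hom2 scale"
  shows "diag (f + g) = diag f + diag g"
  by (intro ext) (simp add: diag_def Sum_any.distrib hom2_finite[OF assms(1)] hom2_finite[OF assms(2)])

lemma diag_scale:
  assumes "f \<in> hom2 scale"
  shows "diag (\<lambda>v k l. scale c (f v k l)) = (\<lambda>v k. scale c (diag f v k))"
  using Sum_any_scale[OF hom2_finite[OF assms]] by (intro ext) (simp add: diag_def)

lemma hom1_0: "0 \<in> hom1 scale"
  by (simp add: hom1_def lin_iff)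

lemma hom1_add:
  assumes "a \<in> hom1 scale" "b \<in> hom1 scale"
  shows "a + b \<in> hom1 scale"
  unfolding hom1_def mem_Collect_eq
proof (intro conjI allI)
  fix k
  show "lin (\<lambda>v. (a + b) v k)"
    using hom1D(1)[OF assms(1), of k] hom1D(1)[OF assms(2), of k]
    by (simp add: lin_iff scale_right_distrib)
next
  fix v
  obtain N M where "\<forall>k<N. a v k = 0" "\<forall>k<M. b v k = 0"
    using hom1D(2)[OF assms(1)] hom1D(2)[OF assms(2)] by blast
  thus "\<exists>N. \<forall>k<N. (a + b) v k = 0"
    by (intro exI[of _ "min N M"]) auto
qed

lemma hom1_scale:
  assumes "a \<in> hom1 scale"
  shows "(\<lambda>v k. scale (\<chi> k) (a v k)) \<in> hom1 scale"
  unfolding hom1_def mem_Collect_eq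
proof (intro conjI allI)
  fix k
  show "lin (\<lambda>v. scale (\<chi> k) (a v k))"
    using hom1D(1)[OF assms, of k] by (simp add: lin_iff scale_right_distrib mult.commute)
next
  fix v
  show "\<exists>N. \<forall>k<N. scale (\<chi> k) (a v k) = 0"
    using hom1D(2)[OF assms, of v] by fastforce
qed

section \<open>Dilation of the variables\<close>

lemma dilate_hom1: "a \<in> hom1 scale \<Longrightarrow> dilate scale c a \<in> hom1 scale"
  unfolding dilate_def by (rule hom1_scale)

lemma dilate_dilate: "dilate scale c (dilate scale d a) = dilate scale (c * d) a"
  by (simp add: dilate_def power_int_mult_distrib)

lemma dilate_0 [simp]: "dilate scale c 0 = 0"
  by (intro ext) (simp add: dilate_def)

lemma dilate_add: "dilate scale c (a + b) = dilate scale c a + dilate scale c b"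
  by (intro ext) (simp add: dilate_def scale_right_distrib)

lemma dilate_scale: "dilate scale c (\<lambda>v k. scale d (a v k)) = (\<lambda>v k. scale d (dilate scale c a v k))"
  by (intro ext) (simp add: dilate_def mult.commute)

lemma comp_fields_dilate_right:
  assumes "a \<in> hom1 scale"
  shows "a (dilate scale c b v l) k = scale (c powi l) (a (b v l) k)"
  using hom1D(1)[OF assms, of k] by (simp add: dilate_def lin_iff)

text \<open>Replacing z2 by c z2 turns p(z2/z1) into p(c z2/z1). On coefficients the replacement is
  the weight c^l, which \<open>sh2\<close> divides by c; \<open>cancel\<close> undoes this
  division.\<close>

lemma exchange_dilate_right:
  assumes "exchange p p' a b" "a \<in> hom1 scale" "c \<noteq> 0"
  shows "exchange (pcompose p [:0, c:]) (pcompose p' [:0, c:]) a (dilate scale c b)"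
  unfolding exchange_def
proof (intro allI ext, clarify)
  fix v k l
  let ?\<chi> = "\<lambda>(k :: int, l :: int). c powi l"
  have \<chi>: "?\<chi> (sh2 x) = inverse c * ?\<chi> x" for x
    using assms(3) by (auto simp: sh2_def power_int_diff field_simps split: prod.splits)
  have cancel: "pcompose (pcompose r [:0, c:]) [:0, inverse c:] = r" for r :: "'f poly"
    using assms(3) by (simp add: pcompose_assoc[symmetric] pcompose_pCons pcompose_idR)
  have "pmul (pcompose p [:0, c:]) sh2 (\<lambda>(k, l). a (dilate scale c b v l) k) (k, l)
      = pmul (pcompose p [:0, c:]) sh2 (\<lambda>x. scale (?\<chi> x) ((\<lambda>(k, l). a (b v l) k) x)) (k, l)"
    by (simp add: comp_fields_dilate_right[OF assms(2)] split_def)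
  also have "\<dots> = scale (?\<chi> (k, l)) (pmul p sh2 (\<lambda>(k, l). a (b v l) k) (k, l))"
    by (subst pmul_weighted[where \<chi> = ?\<chi>, OF \<chi>]) (simp only: cancel)
  also have "\<dots> = scale (?\<chi> (k, l)) (pmul p' sh2 (\<lambda>(k, l). b (a v k) l) (k, l))"
    by (simp only: exchangeD[OF assms(1)])
  also have "\<dots> = pmul (pcompose p' [:0, c:]) sh2 (\<lambda>x. scale (?\<chi> x) ((\<lambda>(k, l). b (a v k) l) x)) (k, l)"
    by (subst pmul_weighted[where \<chi> = ?\<chi>, OF \<chi>]) (simp only: cancel)
  also have "\<dots> = pmul (pcompose p' [:0, c:]) sh2 (\<lambda>(k, l). dilate scale c b (a v k) l) (k, l)"
    by (simp add: dilate_def split_def)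
  finally show "pmul (pcompose p [:0, c:]) sh2 (\<lambda>(k, l). a (dilate scale c b v l) k) (k, l) =
    pmul (pcompose p' [:0, c:]) sh2 (\<lambda>(k, l). dilate scale c b (a v k) l) (k, l)" .
qed

lemma comp_fields_dilate:
  assumes "a \<in> hom1 scale" "c \<noteq> 0"
  shows "comp_fields (dilate scale c a) (dilate scale c b) v k l = scale (c powi (k + l)) (comp_fields a b v k l)"
  using assms(2) comp_fields_dilate_right[OF assms(1), of c b]
  by (simp add: comp_fields_def dilate_def[of _ c a] power_int_add)

lemma mult_ratio_dilate:
  assumes "a \<in> hom1 scale" "c \<noteq> 0"
  shows "mult_ratio scale p (comp_fields (dilate scale c a) (dilate scale c b)) v k l =
    scale (c powi (k + l)) (mult_ratio scale p (comp_fields a b) v k l)"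
  by (simp add: mult_ratio_def comp_fields_dilate[OF assms] scale_sum_right mult.commute)

lemma exchange_iff: "exchange p p' a b \<longleftrightarrow>
  (\<forall>v k l. mult_ratio scale p (comp_fields a b) v k l = pmul p' sh2 (\<lambda>(k, l). b (a v k) l) (k, l))"
  by (simp add: exchange_def mult_ratio_pmul comp_fields_def fun_eq_iff)

text \<open>A common dilation leaves z2/z1 unchanged: its weight c^(k + l) is invariant under
  \<open>sh2\<close>.\<close>

lemma exchange_dilate:
  assumes "exchange p p' a b" "a \<in> hom1 scale" "b \<in> hom1 scale" "c \<noteq> 0"
  shows "exchange p p' (dilate scale c a) (dilate scale c b)"
  unfolding exchange_iff
proof (intro allI)
  fix v k l
  let ?\<chi> = "\<lambda>(k :: int, l :: int). c powi (k + l)"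
  have \<chi>: "?\<chi> (sh2 x) = 1 * ?\<chi> x" for x
    by (auto simp: sh2_def split: prod.splits)
  have "pmul p' sh2 (\<lambda>(k, l). dilate scale c b (dilate scale c a v k) l) (k, l)
      = pmul p' sh2 (\<lambda>x. scale (?\<chi> x) ((\<lambda>(k, l). b (a v k) l) x)) (k, l)"
    using comp_fields_dilate_right[OF assms(3), of c a] assms(4)
    by (simp add: dilate_def[of _ c b] split_def power_int_add mult.commute)
  also have "\<dots> = scale (?\<chi> (k, l)) (pmul p' sh2 (\<lambda>(k, l). b (a v k) l) (k, l))"
    by (subst pmul_weighted[where \<chi> = ?\<chi>, OF \<chi>]) (simp add: pcompose_idR)
  finally show "mult_ratio scale p (comp_fields (dilate scale c a) (dilate scale c b)) v k l =
      pmul p' sh2 (\<lambda>(k, l). dilate scale c b (dilate scale c a v k) l) (k, l)"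
    using assms(1) by (simp add: mult_ratio_dilate[OF assms(2,4)] exchange_iff)
qed

lemma dilate_diag:
  assumes "a \<in> hom1 scale" "c \<noteq> 0" "mult_ratio scale p (comp_fields a b) \<in> hom2 scale"
  shows "dilate scale c (diag (mult_ratio scale p (comp_fields a b))) =
    diag (mult_ratio scale p (comp_fields (dilate scale c a) (dilate scale c b)))"
  using Sum_any_scale[OF hom2_finite[OF assms(3)]]
  by (intro ext) (subst dilate_def, simp add: diag_def mult_ratio_dilate[OF assms(1,2)])

lemma exchange_smult: "exchange p p' a b \<Longrightarrow> exchange (smult c p) (smult c p') a b"
  by (simp add: exchange_def fun_eq_iff pmul_smult)

end

section \<open>Products of weighted fields, for a parameter that is not a root of unity\<close>

locale q_series_space = series_space scale
  for scale :: "'f::field \<Rightarrow> 'v::ab_group_add \<Rightarrow> 'v" +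
  fixes qq :: 'f
  assumes qq_nonzero: "qq \<noteq> 0" and qq_power: "0 < m \<Longrightarrow> qq ^ m \<noteq> 1"
begin

text \<open>Unlike \<open>poly0\<close>, this set is stable under p(x) \<mapsto> p(q^n x), the
  effect of a weight; dividing by p(1) leads back to \<open>poly0\<close>.\<close>

definition nice :: "'f poly set" where
  "nice = {p. \<forall>m::nat. poly p (qq ^ m) \<noteq> 0}"

lemma poly0_nice: "p \<in> poly0 qq \<Longrightarrow> p \<in> nice"
  by (simp add: poly0_def nice_def)

lemma nice_mult: "p \<in> nice \<Longrightarrow> r \<in> nice \<Longrightarrow> p * r \<in> nice"
  by (simp add: nice_def)

lemma poly0_mult: "p \<in> poly0 qq \<Longrightarrow> r \<in> poly0 qq \<Longrightarrow> p * r \<in> poly0 qq"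
  by (simp add: poly0_def)

lemma poly0_1: "1 \<in> poly0 qq"
  by (simp add: poly0_def)

lemma nice_pcompose: "p \<in> nice \<Longrightarrow> pcompose p [:0, qq ^ n:] \<in> nice"
  by (simp add: nice_def poly_pcompose power_add[symmetric])

lemma nice_normalize: "p \<in> nice \<Longrightarrow> smult (inverse (poly p 1)) p \<in> poly0 qq"
  unfolding nice_def poly0_def
  by (auto simp: all_conj_distrib dest: spec[of _ "0 :: nat"])

text \<open>A condition on p alone: p' serves only to bound exponents and is never
  evaluated.\<close>

definition q_local :: "nat \<Rightarrow> 'v field1 \<Rightarrow> 'v field1 \<Rightarrow> bool" where
  "q_local \<alpha> a b \<longleftrightarrow> (\<exists>p\<in>nice. \<exists>p'. exchange p p' a (dilate scale (qq ^ \<alpha>) b))"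

lemma exchange_normalize:
  assumes "exchange p p' a b" "p \<in> nice"
  obtains r r' where "exchange r r' a b" "r \<in> poly0 qq"
  using exchange_smult[OF assms(1)] nice_normalize[OF assms(2)] by blast

lemma q_localE:
  assumes "q_local \<alpha> a b"
  obtains p p' where "p \<in> poly0 qq" "exchange p p' a (dilate scale (qq ^ \<alpha>) b)"
  using assms unfolding q_local_def by (meson exchange_normalize)

abbreviation "q_comm \<equiv> quasi_comm_hom scale qq"

lemma q_local_q_comm:
  assumes "q_local \<alpha> a b" "a \<in> hom1 scale" "b \<in> hom1 scale"
  shows "q_comm a \<alpha> b"
  using assms unfolding quasi_comm_hom_def
  by (meson q_localE exchange_hom2 dilate_hom1)

text \<open>The product with index \<open>-1\<close>, on operator parts.\<close>

definition fmul :: "nat \<Rightarrow> 'v field1 \<Rightarrow> 'v field1 \<Rightarrow> 'v field1" where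
  "fmul \<alpha> a b = prod_hom scale qq a \<alpha> 0 b"

lemma prod_hom_fmul:
  "prod_hom scale qq a \<alpha> r b = (\<lambda>v k. scale (1 / nqfact qq r) (fmul (\<alpha> + r) ((qderiv scale qq ^^ r) a) b v k))"
  by (simp add: fmul_def prod_hom_def Let_def nqfact_def[of _ 0])

text \<open>This disposes of the choice in \<open>prod_hom\<close>. Multiplying by a second
  admissible polynomial changes the diagonal only by its value at 1, which is 1; applied both ways
  to p and r, this compares each with the product p r.\<close>

lemma fmul_eq:
  assumes "p \<in> poly0 qq" "mult_ratio scale p (comp_fields a (dilate scale (qq ^ \<alpha>) b)) \<in> hom2 scale"
  shows "fmul \<alpha> a b = diag (mult_ratio scale p (comp_fields a (dilate scale (qq ^ \<alpha>) b)))"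
proof -
  let ?f = "comp_fields a (dilate scale (qq ^ \<alpha>) b)"
  define r where "r = (SOME p. p \<in> poly0 qq \<and> mult_ratio scale p ?f \<in> hom2 scale)"
  have r: "r \<in> poly0 qq \<and> mult_ratio scale r ?f \<in> hom2 scale"
    unfolding r_def by (rule someI[of _ p]) (use assms in blast)
  have "poly p 1 = 1" "poly r 1 = 1" using assms(1) r by (auto simp: poly0_def)
  hence "diag (mult_ratio scale r ?f) = diag (mult_ratio scale p (mult_ratio scale r ?f))"
    "diag (mult_ratio scale p ?f) = diag (mult_ratio scale r (mult_ratio scale p ?f))"
    using diag_mult_ratio[of "mult_ratio scale r ?f" p] diag_mult_ratio[of "mult_ratio scale p ?f" r]
      r assms(2) by (simp_all add: fun_eq_iff)
  moreover have "fmul \<alpha> a b = diag (mult_ratio scale r ?f)"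
    by (simp add: fmul_def prod_hom_def Let_def r_def nqfact_def)
  ultimately show ?thesis
    by (simp add: mult_ratio_mult mult.commute)
qed

lemma fmul_hom1: "q_comm a \<alpha> b \<Longrightarrow> fmul \<alpha> a b \<in> hom1 scale"
  unfolding quasi_comm_hom_def using fmul_eq diag_hom1 by metis

lemma qpow_nonzero: "qq ^ n \<noteq> 0"
  using qq_nonzero by simp

text \<open>In the product, c carries the twist q^(\<alpha> + \<beta>). Relative to the relation of
  a with c this is an extra dilation of c by q^\<beta>, so r(x) becomes r(q^\<beta> x); relative to
  that of b with c it is a common dilation by q^\<alpha>, which leaves s unchanged.\<close>

lemma q_local_fmul_left:
  assumes a: "a \<in> hom1 scale" and b: "b \<in> hom1 scale" and c: "c \<in> hom1 scale"
    and ab: "q_local \<alpha> a b" and ac: "q_local \<alpha> a c" and bc: "q_local \<beta> b c"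
  shows "q_local (\<alpha> + \<beta>) (fmul \<alpha> a b) c"
proof -
  let ?b = "dilate scale (qq ^ \<alpha>) b" and ?c = "dilate scale (qq ^ (\<alpha> + \<beta>)) c"
  obtain p p' where p: "p \<in> poly0 qq" "exchange p p' a ?b" using ab by (rule q_localE)
  obtain r r' where r: "r \<in> poly0 qq" "exchange r r' a (dilate scale (qq ^ \<alpha>) c)" using ac by (rule q_localE)
  obtain s s' where s: "s \<in> poly0 qq" "exchange s s' b (dilate scale (qq ^ \<beta>) c)" using bc by (rule q_localE)
  have b': "?b \<in> hom1 scale" and c': "?c \<in> hom1 scale" using b c by (simp_all add: dilate_hom1)
  have f: "mult_ratio scale p (comp_fields a ?b) \<in> hom2 scale" by (rule exchange_hom2[OF p(2) a b'])
  have 1: "exchange (pcompose r [:0, qq ^ \<beta>:]) (pcompose r' [:0, qq ^ \<beta>:]) a ?c"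
    using exchange_dilate_right[OF r(2) a qpow_nonzero, of \<beta>]
    by (simp add: dilate_dilate power_add mult.commute)
  have 2: "exchange s s' ?b ?c"
    using exchange_dilate[OF s(2) b dilate_hom1[OF c] qpow_nonzero, of \<alpha>]
    by (simp add: dilate_dilate power_add)
  have "pcompose r [:0, qq ^ \<beta>:] * s \<in> nice"
    using r(1) s(1) by (intro nice_mult nice_pcompose poly0_nice)
  with exchange_diag_left[OF a c' HOL.refl f 1 2] show ?thesis
    unfolding q_local_def fmul_eq[OF p(1) f] by blast
qed

text \<open>Dilation respects the regularised product, since both factors are dilated together and
  their ratio is unaffected.\<close>

lemma dilate_fmul:
  assumes a: "a \<in> hom1 scale" and b: "b \<in> hom1 scale"
    and p: "p \<in> poly0 qq" "exchange p p' a (dilate scale (qq ^ \<alpha>) b)"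
  shows "dilate scale (qq ^ n) (fmul \<alpha> a b) =
    diag (mult_ratio scale p (comp_fields (dilate scale (qq ^ n) a) (dilate scale (qq ^ (\<alpha> + n)) b)))"
proof -
  have "mult_ratio scale p (comp_fields a (dilate scale (qq ^ \<alpha>) b)) \<in> hom2 scale"
    by (rule exchange_hom2[OF p(2) a dilate_hom1[OF b]])
  from fmul_eq[OF p(1) this] dilate_diag[OF a qpow_nonzero this, of n] show ?thesis
    by (simp add: dilate_dilate power_add mult.commute)
qed

lemma q_local_fmul_right:
  assumes a: "a \<in> hom1 scale" and b: "b \<in> hom1 scale" and c: "c \<in> hom1 scale"
    and ab: "q_local \<alpha> a b" and ca: "q_local \<gamma> c a" and cb: "q_local \<gamma> c b"
  shows "q_local \<gamma> c (fmul \<alpha> a b)"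
proof -
  let ?a = "dilate scale (qq ^ \<gamma>) a" and ?b = "dilate scale (qq ^ (\<alpha> + \<gamma>)) b"
  obtain p p' where p: "p \<in> poly0 qq" "exchange p p' a (dilate scale (qq ^ \<alpha>) b)" using ab by (rule q_localE)
  obtain r r' where r: "r \<in> poly0 qq" "exchange r r' c ?a" using ca by (rule q_localE)
  obtain s s' where s: "s \<in> poly0 qq" "exchange s s' c (dilate scale (qq ^ \<gamma>) b)" using cb by (rule q_localE)
  have a': "?a \<in> hom1 scale" and b': "?b \<in> hom1 scale" using a b by (simp_all add: dilate_hom1)
  have "exchange p p' ?a ?b"
    using exchange_dilate[OF p(2) a dilate_hom1[OF b] qpow_nonzero, of \<gamma>]
    by (simp add: dilate_dilate power_add mult.commute)
  from exchange_hom2[OF this a' b']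
  have f: "mult_ratio scale p (comp_fields ?a ?b) \<in> hom2 scale" .
  have 2: "exchange (pcompose s [:0, qq ^ \<alpha>:]) (pcompose s' [:0, qq ^ \<alpha>:]) c ?b"
    using exchange_dilate_right[OF s(2) c qpow_nonzero, of \<alpha>]
    by (simp add: dilate_dilate power_add)
  have "r * pcompose s [:0, qq ^ \<alpha>:] \<in> nice"
    using r(1) s(1) by (intro nice_mult nice_pcompose poly0_nice)
  with exchange_diag_right[OF a' c HOL.refl f r(2) 2] show ?thesis
    unfolding q_local_def dilate_fmul[OF a b p] by blast
qed

lemma fmul_assoc:
  assumes a: "a \<in> hom1 scale" and b: "b \<in> hom1 scale" and c: "c \<in> hom1 scale"
    and ab: "q_local \<alpha> a b" and ac: "q_local \<alpha> a c" and bc: "q_local \<beta> b c"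
  shows "fmul (\<alpha> + \<beta>) (fmul \<alpha> a b) c = fmul \<alpha> a (fmul \<beta> b c)"
proof -
  let ?b = "dilate scale (qq ^ \<alpha>) b" and ?c = "dilate scale (qq ^ (\<alpha> + \<beta>)) c"
  obtain p p' where p: "p \<in> poly0 qq" "exchange p p' a ?b" using ab by (rule q_localE)
  obtain r0 r0' where r0: "r0 \<in> poly0 qq" "exchange r0 r0' a (dilate scale (qq ^ \<alpha>) c)" using ac by (rule q_localE)
  obtain s s' where s: "s \<in> poly0 qq" "exchange s s' b (dilate scale (qq ^ \<beta>) c)" using bc by (rule q_localE)
  have b': "?b \<in> hom1 scale" and c': "?c \<in> hom1 scale" using b c by (simp_all add: dilate_hom1)
  have "exchange (pcompose r0 [:0, qq ^ \<beta>:]) (pcompose r0' [:0, qq ^ \<beta>:]) a ?c"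
    using exchange_dilate_right[OF r0(2) a qpow_nonzero, of \<beta>]
    by (simp add: dilate_dilate power_add mult.commute)
  moreover have "pcompose r0 [:0, qq ^ \<beta>:] \<in> nice" using r0(1) by (intro nice_pcompose poly0_nice)
  \<comment> \<open>The substitution x \<mapsto> q^\<beta> x has spoiled the value at 1, which
    \<open>fmul_eq\<close> requires.\<close>
  ultimately obtain r r' where r: "exchange r r' a ?c" "r \<in> poly0 qq"
    by (rule exchange_normalize)
  have s': "exchange s s' ?b ?c"
    using exchange_dilate[OF s(2) b dilate_hom1[OF c] qpow_nonzero, of \<alpha>]
    by (simp add: dilate_dilate power_add)
  let ?f = "mult_ratio scale p (comp_fields a ?b)" and ?g = "mult_ratio scale s (comp_fields ?b ?c)"
  have f: "?f \<in> hom2 scale" by (rule exchange_hom2[OF p(2) a b'])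
  have g: "?g \<in> hom2 scale" by (rule exchange_hom2[OF s' b' c'])
  have fg: "fmul \<alpha> a b = diag ?f" by (rule fmul_eq[OF p(1) f])
  have gd: "dilate scale (qq ^ \<alpha>) (fmul \<beta> b c) = diag ?g"
    using dilate_fmul[OF b c s, of \<alpha>] by (simp add: add.commute)
  have "mult_ratio scale (r * s) (comp_fields (diag ?f) ?c) \<in> hom2 scale"
    by (rule exchange_hom2[OF exchange_diag_left[OF a c' HOL.refl f r(1) s'] diag_hom1[OF f] c'])
  hence "fmul (\<alpha> + \<beta>) (fmul \<alpha> a b) c = diag (mult_ratio scale (r * s) (comp_fields (diag ?f) ?c))"
    unfolding fg by (intro fmul_eq poly0_mult r s)
  also have "\<dots> = diag (mult_ratio scale (p * r) (comp_fields a (diag ?g)))"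
    by (rule diag_assoc[OF a b' c' p(2) r(1) s' HOL.refl HOL.refl])
  also have "\<dots> = fmul \<alpha> a (fmul \<beta> b c)"
    unfolding gd[symmetric]
  proof (rule fmul_eq[symmetric])
    show "p * r \<in> poly0 qq" by (intro poly0_mult p r)
    show "mult_ratio scale (p * r) (comp_fields a (dilate scale (qq ^ \<alpha>) (fmul \<beta> b c))) \<in> hom2 scale"
      unfolding gd
      by (rule exchange_hom2[OF exchange_diag_right[OF b' a HOL.refl g p(2) r(1)] a diag_hom1[OF g]])
  qed
  finally show ?thesis .
qed

section \<open>Bilinearity of the product\<close>

lemma comp_fields_add_left: "comp_fields (a + a') b = comp_fields a b + comp_fields a' b"
  by (intro ext) (simp add: comp_fields_def)

lemma comp_fields_scale_left: "comp_fields (\<lambda>v k. scale c (a v k)) b = (\<lambda>v k l. scale c (comp_fields a b v k l))"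
  by (intro ext) (simp add: comp_fields_def)

lemma comp_fields_add_right:
  assumes "a \<in> hom1 scale"
  shows "comp_fields a (b + b') = comp_fields a b + comp_fields a b'"
  using hom1D(1)[OF assms] by (intro ext) (simp add: comp_fields_def lin_iff)

lemma comp_fields_scale_right:
  assumes "a \<in> hom1 scale"
  shows "comp_fields a (\<lambda>v k. scale c (b v k)) = (\<lambda>v k l. scale c (comp_fields a b v k l))"
  using hom1D(1)[OF assms] by (intro ext) (simp add: comp_fields_def lin_iff)

lemma comp_fields_0 [simp]: "comp_fields 0 b = 0"
  by (intro ext) (simp add: comp_fields_def)

lemma comp_fields_0_right: "a \<in> hom1 scale \<Longrightarrow> comp_fields a 0 = 0"
  using lin_0[OF hom1D(1)] by (intro ext) (simp add: comp_fields_def)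

text \<open>Each summand comes with its own regularising polynomial; the product of the two serves
  both and still has value 1 at 1.\<close>

lemma
  assumes f: "mult_ratio scale p f \<in> hom2 scale" "p \<in> poly0 qq"
    and g: "mult_ratio scale r g \<in> hom2 scale" "r \<in> poly0 qq"
  shows common_hom2: "mult_ratio scale (p * r) f \<in> hom2 scale" "mult_ratio scale (p * r) g \<in> hom2 scale"
    and common_hom2_add: "mult_ratio scale (p * r) (f + g) \<in> hom2 scale"
    and common_diag_add: "diag (mult_ratio scale (p * r) (f + g)) =
      diag (mult_ratio scale (p * r) f) + diag (mult_ratio scale (p * r) g)"
proof -
  show 1: "mult_ratio scale (p * r) f \<in> hom2 scale"
    using hom2_mult_ratio[OF f(1), of r] by (simp add: mult_ratio_mult mult.commute)
  show 2: "mult_ratio scale (p * r) g \<in> hom2 scale"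
    using hom2_mult_ratio[OF g(1), of p] by (simp add: mult_ratio_mult)
  show "mult_ratio scale (p * r) (f + g) \<in> hom2 scale"
    by (simp only: mult_ratio_add hom2_add[OF 1 2])
  show "diag (mult_ratio scale (p * r) (f + g)) =
      diag (mult_ratio scale (p * r) f) + diag (mult_ratio scale (p * r) g)"
    by (simp only: mult_ratio_add diag_add[OF 1 2])
qed

lemma
  assumes "q_comm a \<alpha> b" "q_comm a' \<alpha> b"
  shows q_comm_add_left: "q_comm (a + a') \<alpha> b"
    and fmul_add_left: "fmul \<alpha> (a + a') b = fmul \<alpha> a b + fmul \<alpha> a' b"
proof -
  let ?f = "comp_fields a (dilate scale (qq ^ \<alpha>) b)" and ?g = "comp_fields a' (dilate scale (qq ^ \<alpha>) b)"
  obtain p r where f: "mult_ratio scale p ?f \<in> hom2 scale" "p \<in> poly0 qq"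
    and g: "mult_ratio scale r ?g \<in> hom2 scale" "r \<in> poly0 qq"
    using assms by (auto simp: quasi_comm_hom_def)
  have pr: "p * r \<in> poly0 qq" by (intro poly0_mult f g)
  note * = common_hom2[OF f g] common_hom2_add[OF f g] common_diag_add[OF f g]
  show "q_comm (a + a') \<alpha> b"
    unfolding quasi_comm_hom_def comp_fields_add_left using pr *(3) by blast
  show "fmul \<alpha> (a + a') b = fmul \<alpha> a b + fmul \<alpha> a' b"
    using *(3,4) fmul_eq[OF pr *(1)] fmul_eq[OF pr *(2)] fmul_eq[OF pr, of "a + a'" \<alpha> b]
    by (simp add: comp_fields_add_left)
qed

lemma
  assumes "a \<in> hom1 scale" "q_comm a \<alpha> b" "q_comm a \<alpha> b'"
  shows q_comm_add_right: "q_comm a \<alpha> (b + b')"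
    and fmul_add_right: "fmul \<alpha> a (b + b') = fmul \<alpha> a b + fmul \<alpha> a b'"
proof -
  let ?f = "comp_fields a (dilate scale (qq ^ \<alpha>) b)" and ?g = "comp_fields a (dilate scale (qq ^ \<alpha>) b')"
  obtain p r where f: "mult_ratio scale p ?f \<in> hom2 scale" "p \<in> poly0 qq"
    and g: "mult_ratio scale r ?g \<in> hom2 scale" "r \<in> poly0 qq"
    using assms by (auto simp: quasi_comm_hom_def)
  have pr: "p * r \<in> poly0 qq" by (intro poly0_mult f g)
  note * = common_hom2[OF f g] common_hom2_add[OF f g] common_diag_add[OF f g]
  show "q_comm a \<alpha> (b + b')"
    unfolding quasi_comm_hom_def dilate_add comp_fields_add_right[OF assms(1)] using pr *(3) by blast
  show "fmul \<alpha> a (b + b') = fmul \<alpha> a b + fmul \<alpha> a b'"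
    using *(3,4) fmul_eq[OF pr *(1)] fmul_eq[OF pr *(2)] fmul_eq[OF pr, of a \<alpha> "b + b'"]
    by (simp add: dilate_add comp_fields_add_right[OF assms(1)])
qed

lemma
  assumes "q_comm a \<alpha> b"
  shows q_comm_scale_left: "q_comm (\<lambda>v k. scale c (a v k)) \<alpha> b"
    and fmul_scale_left: "fmul \<alpha> (\<lambda>v k. scale c (a v k)) b = (\<lambda>v k. scale c (fmul \<alpha> a b v k))"
proof -
  obtain p where p: "p \<in> poly0 qq" "mult_ratio scale p (comp_fields a (dilate scale (qq ^ \<alpha>) b)) \<in> hom2 scale"
    using assms by (auto simp: quasi_comm_hom_def)
  have *: "mult_ratio scale p (comp_fields (\<lambda>v k. scale c (a v k)) (dilate scale (qq ^ \<alpha>) b)) \<in> hom2 scale"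
    unfolding comp_fields_scale_left mult_ratio_scale by (rule hom2_scale[OF p(2)])
  thus "q_comm (\<lambda>v k. scale c (a v k)) \<alpha> b"
    unfolding quasi_comm_hom_def using p by blast
  show "fmul \<alpha> (\<lambda>v k. scale c (a v k)) b = (\<lambda>v k. scale c (fmul \<alpha> a b v k))"
    unfolding fmul_eq[OF p(1) *] fmul_eq[OF p]
    unfolding comp_fields_scale_left mult_ratio_scale diag_scale[OF p(2)] ..
qed

lemma
  assumes a: "a \<in> hom1 scale" and "q_comm a \<alpha> b"
  shows q_comm_scale_right: "q_comm a \<alpha> (\<lambda>v k. scale c (b v k))"
    and fmul_scale_right: "fmul \<alpha> a (\<lambda>v k. scale c (b v k)) = (\<lambda>v k. scale c (fmul \<alpha> a b v k))"
proof -
  obtain p where p: "p \<in> poly0 qq" "mult_ratio scale p (comp_fields a (dilate scale (qq ^ \<alpha>) b)) \<in> hom2 scale"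
    using assms by (auto simp: quasi_comm_hom_def)
  have *: "mult_ratio scale p (comp_fields a (dilate scale (qq ^ \<alpha>) (\<lambda>v k. scale c (b v k)))) \<in> hom2 scale"
    unfolding dilate_scale comp_fields_scale_right[OF a] mult_ratio_scale by (rule hom2_scale[OF p(2)])
  thus "q_comm a \<alpha> (\<lambda>v k. scale c (b v k))"
    unfolding quasi_comm_hom_def using p by blast
  show "fmul \<alpha> a (\<lambda>v k. scale c (b v k)) = (\<lambda>v k. scale c (fmul \<alpha> a b v k))"
    unfolding fmul_eq[OF p(1) *] fmul_eq[OF p]
    unfolding dilate_scale comp_fields_scale_right[OF a] mult_ratio_scale diag_scale[OF p(2)] ..
qed

lemma mult_ratio_0 [simp]: "mult_ratio scale p 0 = 0"
  by (intro ext) (simp add: mult_ratio_def)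

lemma diag_0 [simp]: "diag 0 = 0"
  by (intro ext) (simp add: diag_def)

lemma
  shows q_comm_0_left: "q_comm 0 \<alpha> b"
    and fmul_0_left: "fmul \<alpha> 0 b = 0"
proof -
  have *: "mult_ratio scale 1 (comp_fields 0 (dilate scale (qq ^ \<alpha>) b)) \<in> hom2 scale"
    by (simp add: hom2_0)
  thus "q_comm 0 \<alpha> b" using poly0_1 by (auto simp: quasi_comm_hom_def)
  show "fmul \<alpha> 0 b = 0" by (simp add: fmul_eq[OF poly0_1 *])
qed

lemma
  assumes "a \<in> hom1 scale"
  shows q_comm_0_right: "q_comm a \<alpha> 0"
    and fmul_0_right: "fmul \<alpha> a 0 = 0"
proof -
  have *: "mult_ratio scale 1 (comp_fields a (dilate scale (qq ^ \<alpha>) 0)) \<in> hom2 scale"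
    by (simp add: hom2_0 comp_fields_0_right[OF assms])
  thus "q_comm a \<alpha> 0" using poly0_1 by (auto simp: quasi_comm_hom_def)
  show "fmul \<alpha> a 0 = 0" by (simp add: fmul_eq[OF poly0_1 *] comp_fields_0_right[OF assms])
qed

text \<open>Multiplication by c z^d. The case d = 0, c = 1 is the vacuum, and d = -1 gives the
  operator part of T.\<close>

definition mono_field :: "'f \<Rightarrow> int \<Rightarrow> 'v field1" where
  "mono_field c d = (\<lambda>v k. if k = d then scale c v else 0)"

lemma mono_field_hom1: "mono_field c d \<in> hom1 scale"
  unfolding hom1_def mem_Collect_eq
proof (intro conjI allI)
  show "lin (\<lambda>v. mono_field c d v k)" for k
    by (simp add: mono_field_def lin_iff scale_right_distrib mult.commute)
  show "\<exists>N. \<forall>k<N. mono_field c d v k = 0" for v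
    by (intro exI[of _ d]) (auto simp: mono_field_def)
qed

lemma dilate_mono_field: "dilate scale e (mono_field c d) = mono_field (e powi d * c) d"
  by (intro ext) (simp add: mono_field_def dilate_def)

lemma exchange_mono_left:
  assumes "a \<in> hom1 scale"
  shows "exchange 1 1 (mono_field c d) a"
proof -
  have "a (scale c v) l = scale c (a v l)" "a 0 l = 0" for v l
    using hom1D(1)[OF assms, of l] lin_0[OF hom1D(1)[OF assms], of l] by (auto simp: lin_iff)
  thus ?thesis by (auto simp: exchange_def fun_eq_iff mono_field_def)
qed

lemma exchange_mono_right:
  assumes "a \<in> hom1 scale"
  shows "exchange 1 1 a (mono_field c d)"
proof -
  have "a (scale c v) l = scale c (a v l)" "a 0 l = 0" for v l
    using hom1D(1)[OF assms, of l] lin_0[OF hom1D(1)[OF assms], of l] by (auto simp: lin_iff)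
  thus ?thesis by (auto simp: exchange_def fun_eq_iff mono_field_def)
qed

lemma q_local_mono_left: "a \<in> hom1 scale \<Longrightarrow> q_local \<alpha> (mono_field c d) a"
  unfolding q_local_def using exchange_mono_left[OF dilate_hom1] poly0_nice[OF poly0_1] by blast

lemma q_local_mono_right: "a \<in> hom1 scale \<Longrightarrow> q_local \<alpha> a (mono_field c d)"
  unfolding q_local_def dilate_mono_field using exchange_mono_right poly0_nice[OF poly0_1] by blast

lemma mult_ratio_1: "mult_ratio scale 1 f = f"
  by (intro ext) (simp add: mult_ratio_def)

lemma fmul_mono_left:
  assumes "a \<in> hom1 scale"
  shows "fmul \<alpha> (mono_field c d) a = (\<lambda>v k. scale (c * (qq ^ \<alpha>) powi (k - d)) (a v (k - d)))"
proof -
  have "fmul \<alpha> (mono_field c d) a = diag (comp_fields (mono_field c d) (dilate scale (qq ^ \<alpha>) a))"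
    using exchange_hom2[OF exchange_mono_left mono_field_hom1, OF dilate_hom1 dilate_hom1, OF assms assms]
    by (subst fmul_eq[OF poly0_1]) (simp_all add: mult_ratio_1)
  also have "\<dots> = (\<lambda>v k. scale (c * (qq ^ \<alpha>) powi (k - d)) (a v (k - d)))"
  proof (intro ext)
    fix v k
    have "diag (comp_fields (mono_field c d) (dilate scale (qq ^ \<alpha>) a)) v k =
        Sum_any (\<lambda>j. if j = d then scale c (dilate scale (qq ^ \<alpha>) a v (k - j)) else 0)"
      by (simp add: diag_def comp_fields_def mono_field_def)
    thus "diag (comp_fields (mono_field c d) (dilate scale (qq ^ \<alpha>) a)) v k =
        scale (c * (qq ^ \<alpha>) powi (k - d)) (a v (k - d))"
      by (simp add: dilate_def)
  qed
  finally show ?thesis .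
qed

lemma fmul_mono_right:
  assumes "a \<in> hom1 scale"
  shows "fmul \<alpha> a (mono_field c d) = (\<lambda>v k. scale ((qq ^ \<alpha>) powi d * c) (a v (k - d)))"
proof -
  let ?e = "(qq ^ \<alpha>) powi d * c"
  have lin: "a (scale ?e v) l = scale ?e (a v l)" "a 0 l = 0" for v l
    using hom1D(1)[OF assms, of l] lin_0[OF hom1D(1)[OF assms], of l] by (auto simp: lin_iff)
  have "fmul \<alpha> a (mono_field c d) = diag (comp_fields a (mono_field ?e d))"
    using exchange_hom2[OF exchange_mono_right assms mono_field_hom1, OF assms, of ?e d]
    by (subst fmul_eq[OF poly0_1]) (simp_all add: mult_ratio_1 dilate_mono_field)
  also have "\<dots> = (\<lambda>v k. scale ?e (a v (k - d)))"
  proof (intro ext)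
    fix v k
    have "comp_fields a (mono_field ?e d) v j (k - j) = (if j = k - d then scale ?e (a v j) else 0)" for j
      using lin by (auto simp: comp_fields_def mono_field_def)
    thus "diag (comp_fields a (mono_field ?e d)) v k = scale ?e (a v (k - d))"
      by (simp add: diag_def)
  qed
  finally show ?thesis .
qed

text \<open>On the left z^-1 has weight 1 and dilates a by q, which yields a(zq)/z. On the right it
  is itself dilated by q^\<alpha> and yields q^-\<alpha> a(z)/z; the factor q^\<alpha> compensates
  this for every \<alpha>.\<close>

lemma qderiv_fmul:
  assumes "a \<in> hom1 scale"
  shows "qderiv scale qq a = fmul 1 (mono_field (1 / (qq - 1)) (- 1)) a
    - (\<lambda>v k. scale (qq ^ \<alpha>) (fmul \<alpha> a (mono_field (1 / (qq - 1)) (- 1)) v k))"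
  using qq_nonzero
  by (intro ext) (simp add: fmul_mono_left[OF assms] fmul_mono_right[OF assms] qderiv_def dilate_def
      scale_right_diff_distrib power_int_minus)

end

section \<open>Polynomials in t with field coefficients\<close>

context q_series_space
begin

abbreviation "scaleT \<equiv> scalet scale"

lemma coeff_scalet: "coeff (scaleT c P) n = (\<lambda>v k. scale c (coeff P n v k))"
proof -
  have "(\<lambda>v k. scale c ((0 :: 'v field1) v k)) = 0" by (simp add: fun_eq_iff)
  thus ?thesis by (simp add: scalet_def coeff_map_poly)
qed

lemma vector_space_scalet: "vector_space scaleT"
  by unfold_locales
     (auto intro!: poly_eqI simp: coeff_scalet fun_eq_iff scale_right_distrib scale_left_distrib)

interpretation T: vector_space scaleT by (rule vector_space_scalet)

lemma scalet_monom: "scaleT c (monom a n) = monom (\<lambda>v k. scale c (a v k)) n"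
  by (rule poly_eqI) (auto simp: coeff_scalet fun_eq_iff)

lemma homtD: "P \<in> homt scale \<Longrightarrow> coeff P n \<in> hom1 scale"
  by (simp add: homt_def)

lemma monom_homt: "a \<in> hom1 scale \<Longrightarrow> monom a n \<in> homt scale"
  by (simp add: homt_def hom1_0)

lemma homt_add: "P \<in> homt scale \<Longrightarrow> Q \<in> homt scale \<Longrightarrow> P + Q \<in> homt scale"
  by (simp add: homt_def hom1_add)

lemma homt_scale: "P \<in> homt scale \<Longrightarrow> scaleT c P \<in> homt scale"
  by (simp add: homt_def coeff_scalet hom1_scale[where \<chi> = "\<lambda>_. c"])

lemma homt_0: "0 \<in> homt scale"
  by (simp add: homt_def hom1_0)

definition tmul :: "'v field1 poly \<Rightarrow> 'v field1 poly \<Rightarrow> 'v field1 poly" where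
  "tmul P Q = prodt scale qq P (- 1) Q"

text \<open>With a common degree bound, products of different polynomials can be compared term by
  term; the added summands contain a zero field.\<close>

lemma tmul_superset:
  assumes "degree P \<le> M" "degree Q \<le> N" "P \<in> homt scale"
  shows "tmul P Q = (\<Sum>i\<le>M. \<Sum>j\<le>N. monom (fmul i (coeff P i) (coeff Q j)) (i + j))"
proof -
  have "tmul P Q = (\<Sum>i\<le>degree P. \<Sum>j\<le>degree Q. monom (fmul i (coeff P i) (coeff Q j)) (i + j))"
    by (simp add: tmul_def prodt_def fmul_def)
  also have "\<dots> = (\<Sum>i\<le>degree P. \<Sum>j\<le>N. monom (fmul i (coeff P i) (coeff Q j)) (i + j))"
    by (intro sum.cong[OF HOL.refl] sum.mono_neutral_left)
       (use assms in \<open>auto simp: not_le coeff_eq_0 fmul_0_right[OF homtD]\<close>)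
  also have "\<dots> = (\<Sum>i\<le>M. \<Sum>j\<le>N. monom (fmul i (coeff P i) (coeff Q j)) (i + j))"
    by (intro sum.mono_neutral_left)
       (use assms in \<open>auto simp: not_le coeff_eq_0 fmul_0_left\<close>)
  finally show ?thesis .
qed

lemma tmul_monom:
  assumes "a \<in> hom1 scale"
  shows "tmul (monom a \<alpha>) (monom b \<beta>) = monom (fmul \<alpha> a b) (\<alpha> + \<beta>)"
proof -
  have fm: "fmul i (if \<alpha> = i then a else 0) (if \<beta> = j then b else 0) =
      (if i = \<alpha> \<and> j = \<beta> then fmul \<alpha> a b else 0)" for i j
    by (auto simp: fmul_0_left fmul_0_right[OF assms])
  have mon: "monom (if i = \<alpha> \<and> j = \<beta> then fmul \<alpha> a b else 0) (i + j) =
      (if j = \<beta> then if i = \<alpha> then monom (fmul \<alpha> a b) (\<alpha> + \<beta>) else 0 else 0)" for i j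
    by auto
  show ?thesis
    by (subst tmul_superset[OF degree_monom_le degree_monom_le monom_homt[OF assms]])
       (simp add: fm mon)
qed

section \<open>The q-derivation on polynomials in t\<close>

definition tderiv :: "'v field1 poly \<Rightarrow> 'v field1 poly" where
  "tderiv P = pCons 0 (map_poly (qderiv scale qq) P)"

lemma qderiv_0 [simp]: "qderiv scale qq 0 = 0"
  by (intro ext) (simp add: qderiv_def)

lemma qderiv_0' [simp]: "qderiv scale qq (\<lambda>v k. 0) = (\<lambda>v k. 0)"
  by (intro ext) (simp add: qderiv_def dilate_def)

lemma qderiv_add: "qderiv scale qq (a + b) = qderiv scale qq a + qderiv scale qq b"
  by (intro ext) (simp add: qderiv_def dilate_def algebra_simps scale_right_distrib scale_right_diff_distrib)

lemma qderiv_scale: "qderiv scale qq (\<lambda>v k. scale c (a v k)) = (\<lambda>v k. scale c (qderiv scale qq a v k))"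
  by (intro ext) (simp add: qderiv_def dilate_def scale_right_diff_distrib mult_ac)

lemma qderiv_hom1:
  assumes "a \<in> hom1 scale"
  shows "qderiv scale qq a \<in> hom1 scale"
proof -
  have "q_comm (mono_field (1 / (qq - 1)) (- 1)) 1 a" "q_comm a 0 (mono_field (1 / (qq - 1)) (- 1))"
    by (intro q_local_q_comm q_local_mono_left q_local_mono_right assms mono_field_hom1)+
  from this[THEN fmul_hom1] have "fmul 1 (mono_field (1 / (qq - 1)) (- 1)) a +
      (\<lambda>v k. scale (- (qq ^ 0)) (fmul 0 a (mono_field (1 / (qq - 1)) (- 1)) v k)) \<in> hom1 scale"
    by (intro hom1_add hom1_scale)
  moreover have "qderiv scale qq a = fmul 1 (mono_field (1 / (qq - 1)) (- 1)) a +
      (\<lambda>v k. scale (- (qq ^ 0)) (fmul 0 a (mono_field (1 / (qq - 1)) (- 1)) v k))"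
    unfolding qderiv_fmul[OF assms, of 0] by (intro ext) simp
  ultimately show ?thesis by simp
qed

lemma coeff_tderiv: "coeff (tderiv P) n = (case n of 0 \<Rightarrow> 0 | Suc m \<Rightarrow> qderiv scale qq (coeff P m))"
  by (cases n) (simp_all add: tderiv_def coeff_map_poly)

lemma tderiv_homt: "P \<in> homt scale \<Longrightarrow> tderiv P \<in> homt scale"
  by (auto simp: homt_def coeff_tderiv hom1_0 qderiv_hom1 split: nat.split)

lemma tderiv_pow_homt: "P \<in> homt scale \<Longrightarrow> (tderiv ^^ r) P \<in> homt scale"
  by (induction r) (simp_all add: tderiv_homt)

lemma tderiv_add: "tderiv (P + Q) = tderiv P + tderiv Q"
  by (rule poly_eqI) (simp add: coeff_tderiv qderiv_add split: nat.split)

lemma tderiv_scale: "tderiv (scaleT c P) = scaleT c (tderiv P)"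
  by (rule poly_eqI) (auto simp: coeff_tderiv coeff_scalet qderiv_scale fun_eq_iff split: nat.split)

lemma tderiv_monom: "tderiv (monom a \<alpha>) = monom (qderiv scale qq a) (Suc \<alpha>)"
  by (rule poly_eqI) (simp add: coeff_tderiv split: nat.split)

lemma tderiv_pow_monom: "(tderiv ^^ r) (monom a \<alpha>) = monom ((qderiv scale qq ^^ r) a) (\<alpha> + r)"
  by (induction r) (simp_all add: tderiv_monom)

lemma tderiv_pow_add: "(tderiv ^^ r) (P + Q) = (tderiv ^^ r) P + (tderiv ^^ r) Q"
  by (induction r) (simp_all add: tderiv_add)

lemma tderiv_pow_scale: "(tderiv ^^ r) (scaleT c P) = scaleT c ((tderiv ^^ r) P)"
  by (induction r) (simp_all add: tderiv_scale)

lemma coeff_tderiv_pow: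
  "coeff ((tderiv ^^ r) P) n = (if n < r then 0 else (qderiv scale qq ^^ r) (coeff P (n - r)))"
proof (induction r arbitrary: n)
  case (Suc r)
  show ?case by (cases n) (auto simp: coeff_tderiv Suc)
qed simp

definition tderiv_div :: "nat \<Rightarrow> 'v field1 poly \<Rightarrow> 'v field1 poly" where
  "tderiv_div r P = scaleT (1 / nqfact qq r) ((tderiv ^^ r) P)"

lemma
  assumes "P \<in> homt scale" "P' \<in> homt scale" "quasi_comm scale qq P Q" "quasi_comm scale qq P' Q"
  shows quasi_comm_add_left: "quasi_comm scale qq (P + P') Q"
    and tmul_add_left: "tmul (P + P') Q = tmul P Q + tmul P' Q"
proof -
  have q: "q_comm (coeff P i) i (coeff Q j)" "q_comm (coeff P' i) i (coeff Q j)" for i j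
    using assms(3,4) by (simp_all add: quasi_comm_def)
  show "quasi_comm scale qq (P + P') Q"
    by (simp add: quasi_comm_def q_comm_add_left q)
  let ?M = "max (degree P) (degree P')"
  have deg: "degree (P + P') \<le> ?M" "degree P \<le> ?M" "degree P' \<le> ?M"
    by (auto intro: degree_add_le)
  show "tmul (P + P') Q = tmul P Q + tmul P' Q"
    unfolding tmul_superset[OF deg(1) order_refl homt_add[OF assms(1,2)]]
      tmul_superset[OF deg(2) order_refl assms(1)] tmul_superset[OF deg(3) order_refl assms(2)]
    by (simp add: fmul_add_left[OF q] add_monom[symmetric] sum.distrib)
qed

lemma
  assumes P: "P \<in> homt scale" and "quasi_comm scale qq P Q" "quasi_comm scale qq P Q'"
  shows quasi_comm_add_right: "quasi_comm scale qq P (Q + Q')"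
    and tmul_add_right: "tmul P (Q + Q') = tmul P Q + tmul P Q'"
proof -
  have q: "q_comm (coeff P i) i (coeff Q j)" "q_comm (coeff P i) i (coeff Q' j)" for i j
    using assms(2,3) by (simp_all add: quasi_comm_def)
  show "quasi_comm scale qq P (Q + Q')"
    by (simp add: quasi_comm_def q_comm_add_right homtD[OF P] q)
  let ?M = "max (degree Q) (degree Q')"
  have deg: "degree (Q + Q') \<le> ?M" "degree Q \<le> ?M" "degree Q' \<le> ?M"
    by (auto intro: degree_add_le)
  show "tmul P (Q + Q') = tmul P Q + tmul P Q'"
    unfolding tmul_superset[OF order_refl deg(1) P] tmul_superset[OF order_refl deg(2) P]
      tmul_superset[OF order_refl deg(3) P]
    by (simp add: fmul_add_right[OF homtD[OF P] q] add_monom[symmetric] sum.distrib)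
qed

lemma degree_scalet_le: "degree (scaleT c P) \<le> degree P"
  by (rule degree_le) (auto simp: coeff_scalet coeff_eq_0 fun_eq_iff)

lemma
  assumes "P \<in> homt scale" "quasi_comm scale qq P Q"
  shows quasi_comm_scale_left: "quasi_comm scale qq (scaleT c P) Q"
    and tmul_scale_left: "tmul (scaleT c P) Q = scaleT c (tmul P Q)"
proof -
  have q: "q_comm (coeff P i) i (coeff Q j)" for i j
    using assms(2) by (simp add: quasi_comm_def)
  show "quasi_comm scale qq (scaleT c P) Q"
    by (simp add: quasi_comm_def coeff_scalet q_comm_scale_left q)
  show "tmul (scaleT c P) Q = scaleT c (tmul P Q)"
    unfolding tmul_superset[OF degree_scalet_le order_refl homt_scale[OF assms(1)]]
      tmul_superset[OF order_refl order_refl assms(1)]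
    by (simp add: coeff_scalet fmul_scale_left[OF q] T.scale_sum_right scalet_monom)
qed

lemma
  assumes P: "P \<in> homt scale" and "quasi_comm scale qq P Q"
  shows quasi_comm_scale_right: "quasi_comm scale qq P (scaleT c Q)"
    and tmul_scale_right: "tmul P (scaleT c Q) = scaleT c (tmul P Q)"
proof -
  have q: "q_comm (coeff P i) i (coeff Q j)" for i j
    using assms(2) by (simp add: quasi_comm_def)
  show "quasi_comm scale qq P (scaleT c Q)"
    by (simp add: quasi_comm_def coeff_scalet q_comm_scale_right homtD[OF P] q)
  show "tmul P (scaleT c Q) = scaleT c (tmul P Q)"
    unfolding tmul_superset[OF order_refl degree_scalet_le[of c Q] P]
      tmul_superset[OF order_refl order_refl[of "degree Q"] P]
    by (simp add: coeff_scalet fmul_scale_right[OF homtD[OF P] q] T.scale_sum_right scalet_monom)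
qed

lemma quasi_comm_0_left: "quasi_comm scale qq 0 Q"
  by (simp add: quasi_comm_def q_comm_0_left)

lemma quasi_comm_0_right: "P \<in> homt scale \<Longrightarrow> quasi_comm scale qq P 0"
  by (simp add: quasi_comm_def q_comm_0_right homtD)

lemma tmul_0_left: "tmul 0 Q = 0"
  using tmul_superset[OF order_refl order_refl homt_0] by (simp add: fmul_0_left)

lemma tmul_0_right: "P \<in> homt scale \<Longrightarrow> tmul P 0 = 0"
  using tmul_superset[OF order_refl order_refl] by (simp add: fmul_0_right homtD)

lemma qderiv_pow_0: "(qderiv scale qq ^^ r) 0 = 0"
  by (induction r) simp_all

lemma degree_tderiv_pow_le: "degree ((tderiv ^^ r) P) \<le> degree P + r"
  by (rule degree_le) (auto simp: coeff_tderiv_pow coeff_eq_0 qderiv_pow_0)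

text \<open>\<open>tderiv ^^ r\<close> moves the coefficient of index i to index i + r. The twist
  q^(i + r) in the product of index -r - 1 is therefore the ordinary twist of the product of index
  -1.\<close>

lemma prodt_tmul:
  assumes P: "P \<in> homt scale"
    and q: "quasi_comm scale qq ((tderiv ^^ r) P) Q"
  shows "prodt scale qq P (- int r - 1) Q = tmul (tderiv_div r P) Q"
proof -
  let ?g = "\<lambda>i. \<Sum>j\<le>degree Q. monom (fmul i (coeff ((tderiv ^^ r) P) i) (coeff Q j)) (i + j)"
  have "prodt scale qq P (- int r - 1) Q = (\<Sum>i\<le>degree P. \<Sum>j\<le>degree Q.
      monom (prod_hom scale qq (coeff P i) i r (coeff Q j)) (i + j + r))"
    by (simp add: prodt_def)
  also have "\<dots> = (\<Sum>i\<le>degree P. scaleT (1 / nqfact qq r) (?g (i + r)))"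
    by (simp add: prod_hom_fmul coeff_tderiv_pow T.scale_sum_right scalet_monom add_ac)
  also have "\<dots> = scaleT (1 / nqfact qq r) (\<Sum>i\<in>{0..degree P}. ?g (i + r))"
    by (simp add: T.scale_sum_right atLeast0AtMost)
  also have "(\<Sum>i\<in>{0..degree P}. ?g (i + r)) = sum ?g {0 + r..degree P + r}"
    by (rule sum.shift_bounds_cl_nat_ivl[symmetric])
  also have "\<dots> = sum ?g {..degree P + r}"
    by (rule sum.mono_neutral_left) (auto simp: coeff_tderiv_pow fmul_0_left)
  also have "\<dots> = tmul ((tderiv ^^ r) P) Q"
    by (rule tmul_superset[OF degree_tderiv_pow_le order_refl tderiv_pow_homt[OF P], symmetric])
  finally show ?thesis
    by (simp add: tderiv_div_def tmul_scale_left[OF tderiv_pow_homt[OF P] q])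
qed

end

section \<open>The associative algebra behind the vertex algebra\<close>

lemma nqint_nat: "nqint qq (int n) = (qq ^ n - 1) / (qq - 1)"
  by (simp add: nqint_def)

lemma nqfact_0 [simp]: "nqfact qq 0 = 1"
  by (simp add: nqfact_def)

lemma nqfact_Suc: "nqfact qq (Suc r) = nqint qq (int (Suc r)) * nqfact qq r"
  by (simp add: nqfact_def prod.atLeast1_atMost_eq mult.commute)

lemma nqbinom_mult_nqfact:
  "(\<Prod>j<l. nqint qq (int (R + l) - int j)) * nqfact qq R = nqfact qq (R + l)"
proof (induction l)
  case (Suc l)
  have "(\<Prod>j<Suc l. nqint qq (int (R + Suc l) - int j)) =
      nqint qq (int (Suc (R + l))) * (\<Prod>j<l. nqint qq (int (R + l) - int j))"
    by (subst prod.lessThan_Suc_shift) simp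
  thus ?case
    using Suc by (simp add: nqfact_Suc mult.assoc)
qed simp

context q_series_space
begin

interpretation T: vector_space scaleT by (rule vector_space_scalet)

lemma nqint_nonzero: "0 < n \<Longrightarrow> nqint qq (int n) \<noteq> 0"
  using qq_power[of n] qq_power[of 1] by (simp add: nqint_nat)

lemma nqfact_nonzero: "nqfact qq n \<noteq> 0"
  by (induction n) (simp_all only: nqfact_0 nqfact_Suc mult_eq_0_iff nqint_nonzero, simp_all)

lemma nqbinom_nqfact: "nqbinom qq (int (R + l)) l = nqfact qq (R + l) / (nqfact qq l * nqfact qq R)"
  using nqbinom_mult_nqfact[of qq R l, symmetric] nqfact_nonzero by (simp add: nqbinom_def field_simps)

lemma nqint_add: "nqint qq (int l) + qq ^ l * nqint qq (int m) = nqint qq (int (l + m))"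
  unfolding nqint_nat by (simp add: power_add algebra_simps add_divide_distrib diff_divide_distrib)

lemma tderiv_div_0 [simp]: "tderiv_div 0 P = P"
  by (simp add: tderiv_div_def)

lemma tderiv_div_add: "tderiv_div r (P + Q) = tderiv_div r P + tderiv_div r Q"
  by (simp add: tderiv_div_def tderiv_pow_add T.scale_right_distrib)

lemma tderiv_div_scale: "tderiv_div r (scaleT c P) = scaleT c (tderiv_div r P)"
  by (simp add: tderiv_div_def tderiv_pow_scale mult.commute)

lemma tderiv_tderiv_div: "tderiv (tderiv_div r P) = scaleT (nqint qq (int (Suc r))) (tderiv_div (Suc r) P)"
  using nqfact_nonzero[of r] nqint_nonzero[of "Suc r"]
  by (simp add: tderiv_div_def tderiv_scale nqfact_Suc del: of_nat_Suc)

lemma tderiv_div_Suc: "tderiv_div (Suc r) P = scaleT (1 / nqint qq (int (Suc r))) (tderiv (tderiv_div r P))"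
  using nqint_nonzero[of "Suc r"] by (simp add: tderiv_tderiv_div del: of_nat_Suc)

lemma tderiv_div_tderiv_div:
  "tderiv_div l (tderiv_div R P) = scaleT (nqbinom qq (int (R + l)) l) (tderiv_div (R + l) P)"
  using nqfact_nonzero
  by (simp add: tderiv_div_def tderiv_pow_scale nqbinom_nqfact funpow_add[symmetric, THEN fun_cong, simplified]
      add.commute del: of_nat_add)

lemma tderiv_div_monom: "\<exists>b. tderiv_div r (monom a \<alpha>) = monom b (\<alpha> + r)"
  by (simp add: tderiv_div_def tderiv_pow_monom scalet_monom)

lemma onet_monom: "onet = monom (mono_field 1 0) 0"
  by (simp add: onet_def mono_field_def fun_eq_iff if_distrib cong: if_cong)

lemma tderiv_onet: "tderiv onet = 0"
proof -
  have "qderiv scale qq (mono_field 1 0) = 0"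
    by (intro ext) (auto simp: qderiv_def dilate_mono_field)
  thus ?thesis unfolding onet_monom tderiv_monom by simp
qed

lemma tderiv_div_onet: "0 < r \<Longrightarrow> tderiv_div r onet = 0"
proof (induction r)
  case (Suc r)
  have "tderiv 0 = 0" by (simp add: tderiv_def)
  with Suc show ?case
    unfolding tderiv_div_Suc[of r] by (cases "r = 0") (simp_all add: tderiv_onet)
qed simp

lemma span_closed:
  assumes "P \<in> T.span S" "h 0" "\<And>x. x \<in> S \<Longrightarrow> h x"
    "\<And>x y. h x \<Longrightarrow> h y \<Longrightarrow> h (x + y)" "\<And>c x. h x \<Longrightarrow> h (scaleT c x)"
  shows "h P"
proof -
  have "T.span S \<subseteq> {x. h x}"
    by (rule T.span_minimal) (use assms in \<open>auto simp: T.subspace_def\<close>)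
  thus ?thesis using assms(1) by blast
qed

end

text \<open>The quantum affine algebra enters the construction only through these two properties of
  its currents.\<close>

locale q_currents = q_series_space scale qq
  for scale :: "'f::field \<Rightarrow> 'v::ab_group_add \<Rightarrow> 'v" and qq :: 'f +
  fixes I :: "'i set" and cur :: "'i \<Rightarrow> 'v field1" and wt :: "'i \<Rightarrow> nat"
  assumes cur_hom1: "i \<in> I \<Longrightarrow> cur i \<in> hom1 scale"
    and cur_local: "i \<in> I \<Longrightarrow> j \<in> I \<Longrightarrow> q_local (wt i) (cur i) (cur j)"
begin

interpretation T: vector_space scaleT by (rule vector_space_scalet)

text \<open>Commutation with \<open>t_field\<close> \<open>\<otimes> t\<close>, twisted by the degree, is \<^const>\<open>tderiv\<close>.\<close>

definition t_field :: "'v field1" where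
  "t_field = mono_field (1 / (qq - 1)) (- 1)"

text \<open>T is adjoined to the currents so that the twisted commutator with it can be formed
  inside the algebra they generate.\<close>

definition letters :: "('v field1 \<times> nat) set" where
  "letters = insert (t_field, Suc 0) ((\<lambda>i. (cur i, wt i)) ` I)"

lemma letters_hom1: "(a, \<alpha>) \<in> letters \<Longrightarrow> a \<in> hom1 scale"
  by (auto simp: letters_def t_field_def mono_field_hom1 cur_hom1)

lemma letters_local: "(a, \<alpha>) \<in> letters \<Longrightarrow> (b, \<beta>) \<in> letters \<Longrightarrow> q_local \<alpha> a b"
  by (auto simp: letters_def t_field_def cur_local
      intro!: q_local_mono_left q_local_mono_right mono_field_hom1 cur_hom1)

text \<open>Pairs are used instead of elements \<open>monom a \<alpha>\<close>, because a zero
  operator would lose its degree there, and the degree determines the twist.\<close>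

inductive_set mons :: "('v field1 \<times> nat) set" where
  one: "(mono_field 1 0, 0) \<in> mons"
| step: "(a, \<alpha>) \<in> letters \<Longrightarrow> (b, \<beta>) \<in> mons \<Longrightarrow> (fmul \<alpha> a b, \<alpha> + \<beta>) \<in> mons"

text \<open>Membership in \<open>hom1\<close> and locality go through one induction: the product of
  a letter with b is a field because the two are local, and the next step needs both facts.\<close>

lemma mons_letters:
  assumes "(b, \<beta>) \<in> mons"
  shows "b \<in> hom1 scale \<and> (\<forall>a \<alpha>. (a, \<alpha>) \<in> letters \<longrightarrow> q_local \<alpha> a b)"
  using assms
proof (induction rule: mons.induct)
  case one
  show ?case by (auto intro: mono_field_hom1 q_local_mono_right letters_hom1)
next
  case (step a \<alpha> b \<beta>)
  have a: "a \<in> hom1 scale" using step by (auto intro: letters_hom1)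
  have ab: "q_local \<alpha> a b" and b: "b \<in> hom1 scale" using step by auto
  have "fmul \<alpha> a b \<in> hom1 scale"
    by (rule fmul_hom1[OF q_local_q_comm[OF ab a b]])
  moreover have "q_local \<gamma> c (fmul \<alpha> a b)" if "(c, \<gamma>) \<in> letters" for c \<gamma>
    by (rule q_local_fmul_right[OF a b letters_hom1[OF that] ab letters_local[OF that step(1)]])
       (use step that in blast)
  ultimately show ?case by blast
qed

lemma mons_hom1: "(b, \<beta>) \<in> mons \<Longrightarrow> b \<in> hom1 scale"
  using mons_letters by blast

text \<open>Locality is built up one side at a time: \<open>mons_letters\<close> lets the right
  factor grow, here the left factor grows.\<close>

lemma mons_local:
  assumes "(a, \<alpha>) \<in> mons" "(b, \<beta>) \<in> mons"
  shows "q_local \<alpha> a b"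
  using assms
proof (induction rule: mons.induct)
  case one
  thus ?case by (auto intro: q_local_mono_left mons_hom1)
next
  case (step a \<alpha> c \<gamma>)
  show ?case
    by (rule q_local_fmul_left[OF letters_hom1[OF step(1)] mons_hom1[OF step(2)] mons_hom1[OF step(4)]])
       (use step mons_letters in auto)
qed

lemma fmul_one_left: "a \<in> hom1 scale \<Longrightarrow> fmul 0 (mono_field 1 0) a = a"
  by (simp add: fmul_mono_left)

lemma fmul_one_right: "a \<in> hom1 scale \<Longrightarrow> fmul \<alpha> a (mono_field 1 0) = a"
  by (simp add: fmul_mono_right)

lemma mons_fmul:
  assumes "(a, \<alpha>) \<in> mons" "(b, \<beta>) \<in> mons"
  shows "(fmul \<alpha> a b, \<alpha> + \<beta>) \<in> mons"
  using assms
proof (induction rule: mons.induct)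
  case one
  thus ?case by (simp add: fmul_one_left mons_hom1)
next
  case (step a \<alpha> c \<gamma>)
  have "fmul (\<alpha> + \<gamma>) (fmul \<alpha> a c) b = fmul \<alpha> a (fmul \<gamma> c b)"
    by (rule fmul_assoc[OF letters_hom1[OF step(1)] mons_hom1[OF step(2)] mons_hom1[OF step(4)]])
       (use step mons_letters mons_local in auto)
  thus ?case
    using mons.step[OF step(1) step(3)[OF step(4)]] by (simp add: add.assoc)
qed

lemma letters_mons: "(a, \<alpha>) \<in> letters \<Longrightarrow> (a, \<alpha>) \<in> mons"
  using mons.step[OF _ mons.one, of a \<alpha>] by (simp add: fmul_one_right letters_hom1)

text \<open>Any two elements have a regularised product that lies in this span again, and on it
  \<open>tmul\<close> is an associative bilinear product with unit \<open>onet\<close>.\<close>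

definition ambient :: "'v field1 poly set" where
  "ambient = T.span {monom a \<alpha> | a \<alpha>. (a, \<alpha>) \<in> mons}"

lemma ambient_monom: "(a, \<alpha>) \<in> mons \<Longrightarrow> monom a \<alpha> \<in> ambient"
  unfolding ambient_def by (rule T.span_base) blast

lemma ambient_closed:
  "0 \<in> ambient" "P \<in> ambient \<Longrightarrow> Q \<in> ambient \<Longrightarrow> P + Q \<in> ambient"
  "P \<in> ambient \<Longrightarrow> scaleT c P \<in> ambient"
  unfolding ambient_def by (rule T.span_zero, erule (1) T.span_add, erule T.span_scale)

lemma ambient_diff: "P \<in> ambient \<Longrightarrow> Q \<in> ambient \<Longrightarrow> P - Q \<in> ambient"
  unfolding ambient_def by (rule T.span_diff)

lemma ambient_induct [consumes 1, case_names zero monom add scale]: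
  assumes "P \<in> ambient" "h 0" "\<And>a \<alpha>. (a, \<alpha>) \<in> mons \<Longrightarrow> h (monom a \<alpha>)"
    "\<And>P Q. P \<in> ambient \<Longrightarrow> Q \<in> ambient \<Longrightarrow> h P \<Longrightarrow> h Q \<Longrightarrow> h (P + Q)"
    "\<And>c P. P \<in> ambient \<Longrightarrow> h P \<Longrightarrow> h (scaleT c P)"
  shows "h P"
proof -
  have "P \<in> ambient \<and> h P"
    by (rule span_closed[OF assms(1)[unfolded ambient_def]])
       (use assms(2-) ambient_closed ambient_monom in auto)
  thus ?thesis by blast
qed

lemma ambient_homt: "P \<in> ambient \<Longrightarrow> P \<in> homt scale"
  by (induction rule: ambient_induct) (auto intro: homt_0 homt_add homt_scale monom_homt mons_hom1)

lemma ambient_quasi_comm: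
  assumes "P \<in> ambient" "Q \<in> ambient"
  shows "quasi_comm scale qq P Q"
  using assms(1)
proof (induction rule: ambient_induct)
  case zero
  show ?case by (rule quasi_comm_0_left)
next
  case (monom a \<alpha>)
  note a = mons_hom1[OF monom]
  show ?case
    using assms(2)
  proof (induction rule: ambient_induct)
    case zero
    show ?case by (rule quasi_comm_0_right[OF monom_homt[OF a]])
  next
    case (monom b \<beta>)
    from q_local_q_comm[OF mons_local[OF \<open>(a, \<alpha>) \<in> mons\<close> monom] a mons_hom1[OF monom]]
    show ?case by (auto simp: quasi_comm_def q_comm_0_left q_comm_0_right[OF a])
  next
    case (add P Q)
    show ?case by (rule quasi_comm_add_right[OF monom_homt[OF a] add(3,4)])
  next
    case (scale c P)
    show ?case by (rule quasi_comm_scale_right[OF monom_homt[OF a] scale(2)])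
  qed
next
  case (add P P')
  show ?case by (rule quasi_comm_add_left[OF ambient_homt[OF add(1)] ambient_homt[OF add(2)] add(3,4)])
next
  case (scale c P)
  show ?case by (rule quasi_comm_scale_left[OF ambient_homt[OF scale(1)] scale(2)])
qed

lemma tmul_add:
  assumes "P \<in> ambient" "P' \<in> ambient" "Q \<in> ambient"
  shows "tmul (P + P') Q = tmul P Q + tmul P' Q" "tmul Q (P + P') = tmul Q P + tmul Q P'"
  using assms by (simp_all add: tmul_add_left tmul_add_right ambient_homt ambient_quasi_comm)

lemma tmul_scale:
  assumes "P \<in> ambient" "Q \<in> ambient"
  shows "tmul (scaleT c P) Q = scaleT c (tmul P Q)" "tmul Q (scaleT c P) = scaleT c (tmul Q P)"
  using assms by (simp_all add: tmul_scale_left tmul_scale_right ambient_homt ambient_quasi_comm)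

lemmas tmul_linear = tmul_add tmul_scale

lemma tmul_zero: "P \<in> ambient \<Longrightarrow> tmul P 0 = 0" "tmul 0 P = 0"
  by (simp_all add: tmul_0_left tmul_0_right ambient_homt)

lemma ambient_eqI:
  assumes "P \<in> ambient" "\<And>a \<alpha>. (a, \<alpha>) \<in> mons \<Longrightarrow> f (monom a \<alpha>) = g (monom a \<alpha>)"
    and "\<And>P Q. P \<in> ambient \<Longrightarrow> Q \<in> ambient \<Longrightarrow> f (P + Q) = f P + f Q"
    and "\<And>c P. P \<in> ambient \<Longrightarrow> f (scaleT c P) = scaleT c (f P)"
    and "\<And>P Q. P \<in> ambient \<Longrightarrow> Q \<in> ambient \<Longrightarrow> g (P + Q) = g P + g Q"
    and "\<And>c P. P \<in> ambient \<Longrightarrow> g (scaleT c P) = scaleT c (g P)"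
  shows "f P = g P"
  using assms(1)
proof (induction rule: ambient_induct)
  case zero
  show ?case
    using assms(4)[OF ambient_closed(1), of 0] assms(6)[OF ambient_closed(1), of 0] by simp
qed (use assms(2-) in auto)

lemma tmul_mons: "(a, \<alpha>) \<in> mons \<Longrightarrow> tmul (monom a \<alpha>) (monom b \<beta>) = monom (fmul \<alpha> a b) (\<alpha> + \<beta>)"
  by (simp add: tmul_monom mons_hom1)

lemma tmul_ambient:
  assumes P: "P \<in> ambient" and Q: "Q \<in> ambient"
  shows "tmul P Q \<in> ambient"
  using P
proof (induction rule: ambient_induct)
  case (monom a \<alpha>)
  note a = ambient_monom[OF monom]
  show ?case
    using Q
  proof (induction rule: ambient_induct)
    case (monom b \<beta>)
    show ?case
      using \<open>(a, \<alpha>) \<in> mons\<close> monom by (simp add: tmul_mons ambient_monom mons_fmul)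
  qed (simp_all add: tmul_linear tmul_zero ambient_closed a)
qed (simp_all add: tmul_linear tmul_zero ambient_closed Q)

lemma tmul_assoc:
  assumes P: "P \<in> ambient" and Q: "Q \<in> ambient" and R: "R \<in> ambient"
  shows "tmul (tmul P Q) R = tmul P (tmul Q R)"
  using P
proof (rule ambient_eqI)
  fix a \<alpha> assume a: "(a, \<alpha>) \<in> mons"
  show "tmul (tmul (monom a \<alpha>) Q) R = tmul (monom a \<alpha>) (tmul Q R)"
    using Q
  proof (rule ambient_eqI)
    fix b \<beta> assume b: "(b, \<beta>) \<in> mons"
    show "tmul (tmul (monom a \<alpha>) (monom b \<beta>)) R = tmul (monom a \<alpha>) (tmul (monom b \<beta>) R)"
      using R
    proof (rule ambient_eqI)
      fix c \<gamma> assume c: "(c, \<gamma>) \<in> mons"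
      have "fmul (\<alpha> + \<beta>) (fmul \<alpha> a b) c = fmul \<alpha> a (fmul \<beta> b c)"
        by (rule fmul_assoc) (use a b c in \<open>auto intro: mons_hom1 mons_local\<close>)
      thus "tmul (tmul (monom a \<alpha>) (monom b \<beta>)) (monom c \<gamma>) =
          tmul (monom a \<alpha>) (tmul (monom b \<beta>) (monom c \<gamma>))"
        using a b c by (simp add: tmul_mons mons_fmul add.assoc)
    qed (simp_all add: tmul_linear tmul_ambient ambient_monom a b)
  qed (simp_all add: tmul_linear tmul_ambient ambient_monom a R)
qed (simp_all add: tmul_linear tmul_ambient Q R)

lemma onet_ambient: "onet \<in> ambient"
  unfolding onet_monom by (rule ambient_monom[OF mons.one])

lemma tmul_onet_left: "P \<in> ambient \<Longrightarrow> tmul onet P = P"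
  by (erule ambient_eqI)
     (simp_all add: tmul_linear onet_ambient, simp add: onet_monom tmul_mons mons.one fmul_one_left mons_hom1)

lemma tmul_onet_right: "P \<in> ambient \<Longrightarrow> tmul P onet = P"
  by (erule ambient_eqI)
     (simp_all add: tmul_linear onet_ambient, simp add: onet_monom tmul_mons fmul_one_right mons_hom1)

section \<open>The derivation as a twisted commutator, and its Leibniz rule\<close>

abbreviation "tvar \<equiv> monom t_field (Suc 0)"

lemma tvar_ambient: "tvar \<in> ambient"
  by (rule ambient_monom[OF letters_mons]) (simp add: letters_def)

lemma tderiv_commutator:
  assumes "a \<in> hom1 scale"
  shows "tderiv (monom a \<alpha>) = tmul tvar (monom a \<alpha>) - scaleT (qq ^ \<alpha>) (tmul (monom a \<alpha>) tvar)"
proof -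
  have "t_field \<in> hom1 scale" by (simp add: t_field_def mono_field_hom1)
  thus ?thesis
    by (simp add: tmul_monom assms tderiv_monom scalet_monom qderiv_fmul[OF assms, of \<alpha>] t_field_def
        diff_monom)
qed

lemma tderiv_ambient: "P \<in> ambient \<Longrightarrow> tderiv P \<in> ambient"
proof (induction rule: ambient_induct)
  case (monom a \<alpha>)
  show ?case
    unfolding tderiv_commutator[OF mons_hom1[OF monom]]
    by (intro ambient_diff ambient_closed tmul_ambient tvar_ambient ambient_monom monom)
qed (simp_all add: tderiv_add tderiv_scale ambient_closed, simp add: tderiv_def ambient_closed)

lemma tderiv_pow_ambient: "P \<in> ambient \<Longrightarrow> (tderiv ^^ r) P \<in> ambient"
  by (induction r) (simp_all add: tderiv_ambient)

lemma tderiv_div_ambient: "P \<in> ambient \<Longrightarrow> tderiv_div r P \<in> ambient"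
  by (simp add: tderiv_div_def tderiv_pow_ambient ambient_closed)

lemma tmul_diff:
  assumes "P \<in> ambient" "P' \<in> ambient" "Q \<in> ambient"
  shows "tmul (P - P') Q = tmul P Q - tmul P' Q" "tmul Q (P - P') = tmul Q P - tmul Q P'"
  using tmul_linear(1,2)[OF ambient_diff[OF assms(1,2)] assms(2,3)] by simp_all

text \<open>For Q of degree \<beta>, associativity lets T P Q - q^(\<alpha> + \<beta>) P Q T
  telescope into (T P - q^\<alpha> P T) Q + q^\<alpha> P (T Q - q^\<beta> Q T).\<close>

lemma tderiv_tmul:
  assumes P: "monom a \<alpha> \<in> ambient" and Q: "Q \<in> ambient"
  shows "tderiv (tmul (monom a \<alpha>) Q) = tmul (tderiv (monom a \<alpha>)) Q + scaleT (qq ^ \<alpha>) (tmul (monom a \<alpha>) (tderiv Q))"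
  using Q
proof (rule ambient_eqI)
  fix b \<beta> assume b: "(b, \<beta>) \<in> mons"
  have a: "a \<in> hom1 scale" using homtD[OF ambient_homt[OF P], of \<alpha>] by simp
  let ?P = "monom a \<alpha>" and ?Q = "monom b \<beta>"
  note amb = P ambient_monom[OF b] tvar_ambient
  note mem = amb tmul_ambient[OF amb(1,2)] tmul_ambient[OF amb(1,3)] tmul_ambient[OF amb(2,3)]
    tmul_ambient[OF amb(3,1)] tmul_ambient[OF amb(3,2)]
  have "fmul \<alpha> a b \<in> hom1 scale"
    using homtD[OF ambient_homt[OF mem(4)], of "\<alpha> + \<beta>"] by (simp add: tmul_monom a)
  hence "tderiv (tmul ?P ?Q) = tmul tvar (tmul ?P ?Q) - scaleT (qq ^ (\<alpha> + \<beta>)) (tmul (tmul ?P ?Q) tvar)"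
    by (simp add: tmul_monom a tderiv_commutator)
  also have "\<dots> = tmul (tderiv ?P) ?Q + scaleT (qq ^ \<alpha>) (tmul ?P (tderiv ?Q))"
    by (simp add: tderiv_commutator a mons_hom1[OF b] tmul_diff tmul_linear mem ambient_closed tmul_assoc
        T.scale_right_diff_distrib power_add)
  finally show "tderiv (tmul ?P ?Q) = tmul (tderiv ?P) ?Q + scaleT (qq ^ \<alpha>) (tmul ?P (tderiv ?Q))" .
qed (simp_all add: tmul_linear P tderiv_ambient tmul_ambient tderiv_add tderiv_scale
      T.scale_right_distrib add_ac mult.commute)

lemma tmul_sum_right: "(\<And>i. i \<in> S \<Longrightarrow> f i \<in> ambient) \<Longrightarrow> Q \<in> ambient \<Longrightarrow> tmul (sum f S) Q = (\<Sum>i\<in>S. tmul (f i) Q)"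
proof (induction S rule: infinite_finite_induct)
  case (insert x S)
  have "sum f S \<in> ambient"
    unfolding ambient_def by (rule T.span_sum) (use insert in \<open>auto simp: ambient_def\<close>)
  with insert show ?case by (simp add: tmul_linear)
qed (simp_all add: tmul_zero)

lemma tderiv_sum: "tderiv (sum f S) = (\<Sum>i\<in>S. tderiv (f i))"
proof -
  have "tderiv 0 = 0" by (simp add: tderiv_def)
  thus ?thesis by (induction S rule: infinite_finite_induct) (simp_all add: tderiv_add)
qed

lemma tderiv_div_tmul:
  assumes P: "monom a \<alpha> \<in> ambient" and Q: "Q \<in> ambient"
  shows "tderiv_div s (tmul (monom a \<alpha>) Q) =
    (\<Sum>l\<le>s. scaleT (qq ^ (\<alpha> * (s - l))) (tmul (tderiv_div l (monom a \<alpha>)) (tderiv_div (s - l) Q)))"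
proof (induction s)
  case (Suc s)
  let ?P = "monom a \<alpha>"
  let ?t = "\<lambda>l m. tmul (tderiv_div l ?P) (tderiv_div m Q)"
  let ?n = "\<lambda>m. nqint qq (int m)"
  note mem = tderiv_div_ambient[OF P] tderiv_div_ambient[OF Q]
  \<comment> \<open>The left factor has degree \<alpha> + l, hence the power of q when D passes
    it.\<close>
  have step: "tderiv (?t l m) = scaleT (?n (Suc l)) (?t (Suc l) m)
      + scaleT (qq ^ (\<alpha> + l) * ?n (Suc m)) (?t l (Suc m))" for l m
  proof -
    obtain b where b: "tderiv_div l ?P = monom b (\<alpha> + l)" using tderiv_div_monom by blast
    have "monom b (\<alpha> + l) \<in> ambient" using mem(1)[of l] by (simp add: b)
    from tderiv_tmul[OF this mem(2)]
    have "tderiv (?t l m) = tmul (tderiv (tderiv_div l ?P)) (tderiv_div m Q)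
        + scaleT (qq ^ (\<alpha> + l)) (tmul (tderiv_div l ?P) (tderiv (tderiv_div m Q)))"
      by (simp only: b)
    thus ?thesis
      by (simp add: tderiv_tderiv_div tmul_linear mem del: of_nat_Suc)
  qed
  have "scaleT (?n (Suc s)) (tderiv_div (Suc s) (tmul ?P Q)) = tderiv (tderiv_div s (tmul ?P Q))"
    by (simp only: tderiv_tderiv_div)
  also have "\<dots> = (\<Sum>l\<le>s. scaleT (qq ^ (\<alpha> * (s - l)) * ?n (Suc l)) (?t (Suc l) (s - l)))
      + (\<Sum>l\<le>s. scaleT (qq ^ (\<alpha> * (s - l)) * (qq ^ (\<alpha> + l) * ?n (Suc (s - l)))) (?t l (Suc (s - l))))"
    by (simp add: Suc tderiv_sum tderiv_scale step T.scale_right_distrib sum.distrib del: of_nat_Suc)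
  \<comment> \<open>The two sums are brought to the common range l \<le> s + 1. The terms added, at
    l = 0 here and at l = s + 1 in the next step, contain the factor [0] = 0.\<close>
  also have "(\<Sum>l\<le>s. scaleT (qq ^ (\<alpha> * (s - l)) * ?n (Suc l)) (?t (Suc l) (s - l)))
      = (\<Sum>l\<le>Suc s. scaleT (qq ^ (\<alpha> * (Suc s - l)) * ?n l) (?t l (Suc s - l)))"
    by (subst sum.atMost_Suc_shift) (simp add: nqint_def)
  also have "(\<Sum>l\<le>s. scaleT (qq ^ (\<alpha> * (s - l)) * (qq ^ (\<alpha> + l) * ?n (Suc (s - l)))) (?t l (Suc (s - l))))
      = (\<Sum>l\<le>Suc s. scaleT (qq ^ (\<alpha> * (Suc s - l)) * (qq ^ l * ?n (Suc s - l))) (?t l (Suc s - l)))"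
    by (subst sum.atMost_Suc)
       (auto intro!: sum.cong simp: nqint_def[of _ 0] Suc_diff_le power_add power_mult mult_ac simp del: of_nat_Suc)
  also have "(\<Sum>l\<le>Suc s. scaleT (qq ^ (\<alpha> * (Suc s - l)) * ?n l) (?t l (Suc s - l)))
      + (\<Sum>l\<le>Suc s. scaleT (qq ^ (\<alpha> * (Suc s - l)) * (qq ^ l * ?n (Suc s - l))) (?t l (Suc s - l)))
      = (\<Sum>l\<le>Suc s. scaleT (?n (Suc s)) (scaleT (qq ^ (\<alpha> * (Suc s - l))) (?t l (Suc s - l))))"
  proof (subst sum.distrib[symmetric], rule sum.cong[OF HOL.refl])
    fix l assume "l \<in> {..Suc s}"
    \<comment> \<open>The summand l collects the contribution [l] from differentiating the left
      factor and q^l [s + 1 - l] from differentiating the right one; they add up to [s + 1].\<close>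
    hence eq: "?n (Suc s) = ?n l + qq ^ l * ?n (Suc s - l)"
      using nqint_add[of l "Suc s - l"] by simp
    thus "scaleT (qq ^ (\<alpha> * (Suc s - l)) * ?n l) (?t l (Suc s - l))
        + scaleT (qq ^ (\<alpha> * (Suc s - l)) * (qq ^ l * ?n (Suc s - l))) (?t l (Suc s - l))
        = scaleT (?n (Suc s)) (scaleT (qq ^ (\<alpha> * (Suc s - l))) (?t l (Suc s - l)))"
      unfolding eq by (simp add: T.scale_left_distrib algebra_simps del: of_nat_Suc)
  qed
  finally show ?case
    using nqint_nonzero[of "Suc s"] by (simp only: T.scale_sum_right[symmetric] T.scale_cancel_left) simp
qed simp

lemma prodt_ambient:
  assumes "P \<in> ambient" "Q \<in> ambient"
  shows "prodt scale qq P (- int r - 1) Q = tmul (tderiv_div r P) Q"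
  using assms by (simp add: prodt_tmul ambient_homt ambient_quasi_comm tderiv_pow_ambient)

end

section \<open>The vertex algebra generated by local fields\<close>

context q_currents
begin

interpretation T: vector_space scaleT by (rule vector_space_scalet)

abbreviation gen :: "'i \<Rightarrow> 'v field1 poly" where
  "gen i \<equiv> monom (cur i) (wt i)"

lemma gen_ambient: "i \<in> I \<Longrightarrow> gen i \<in> ambient"
  by (rule ambient_monom[OF letters_mons]) (simp add: letters_def)

text \<open>The spanning monomials of the theorem: \<open>tderiv_div r (gen i)\<close> acts as the
  mode of index -r - 1 of the generator, so r \<ge> 0 runs through the negative indices. T is not
  among the factors.\<close>

inductive_set words :: "'v field1 poly set" where
  nil: "onet \<in> words"
| cons: "i \<in> I \<Longrightarrow> P \<in> words \<Longrightarrow> tmul (tderiv_div r (gen i)) P \<in> words"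

lemma words_ambient: "P \<in> words \<Longrightarrow> P \<in> ambient"
  by (induction rule: words.induct) (auto intro: onet_ambient tmul_ambient tderiv_div_ambient gen_ambient)

lemma tmul_monoms:
  assumes "monom a \<alpha> \<in> ambient"
  shows "tmul (monom a \<alpha>) (monom b \<beta>) = monom (fmul \<alpha> a b) (\<alpha> + \<beta>)"
  using homtD[OF ambient_homt[OF assms], of \<alpha>] by (simp add: tmul_monom)

lemma words_monom: "P \<in> words \<Longrightarrow> \<exists>a \<alpha>. P = monom a \<alpha>"
proof (induction rule: words.induct)
  case (cons i P r)
  obtain b where b: "tderiv_div r (gen i) = monom b (wt i + r)" using tderiv_div_monom by blast
  with tderiv_div_ambient[OF gen_ambient[OF cons(1)], of r] cons show ?case
    by (auto simp: tmul_monoms) blast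
qed (auto simp: onet_monom)

definition vertex_space :: "'v field1 poly set" where
  "vertex_space = T.span words"

lemma vertex_closed:
  "0 \<in> vertex_space" "P \<in> vertex_space \<Longrightarrow> Q \<in> vertex_space \<Longrightarrow> P + Q \<in> vertex_space"
  "P \<in> vertex_space \<Longrightarrow> scaleT c P \<in> vertex_space"
  unfolding vertex_space_def by (rule T.span_zero, erule (1) T.span_add, erule T.span_scale)

lemma words_vertex: "P \<in> words \<Longrightarrow> P \<in> vertex_space"
  unfolding vertex_space_def by (rule T.span_base)

lemma vertex_ambient: "P \<in> vertex_space \<Longrightarrow> P \<in> ambient"
  unfolding vertex_space_def
  by (erule span_closed) (auto intro: ambient_closed words_ambient)

lemma vertex_induct [consumes 1, case_names zero word add scale]:
  assumes "P \<in> vertex_space" "h 0" "\<And>P. P \<in> words \<Longrightarrow> h P"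
    "\<And>P Q. P \<in> vertex_space \<Longrightarrow> Q \<in> vertex_space \<Longrightarrow> h P \<Longrightarrow> h Q \<Longrightarrow> h (P + Q)"
    "\<And>c P. P \<in> vertex_space \<Longrightarrow> h P \<Longrightarrow> h (scaleT c P)"
  shows "h P"
proof -
  have "P \<in> vertex_space \<and> h P"
    by (rule span_closed[OF assms(1)[unfolded vertex_space_def]])
       (use assms(2-) vertex_closed words_vertex in auto)
  thus ?thesis by blast
qed

lemma words_tmul:
  assumes "P \<in> words" "Q \<in> words"
  shows "tmul P Q \<in> words"
  using assms(1)
proof (induction rule: words.induct)
  case nil
  show ?case using assms(2) by (simp add: tmul_onet_left words_ambient)
next
  case (cons i P r)
  thus ?case
    using words.cons[of i "tmul P Q" r] assms(2)
    by (simp add: tmul_assoc words_ambient tderiv_div_ambient gen_ambient)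
qed

lemma vertex_tmul:
  assumes "P \<in> vertex_space" and Q: "Q \<in> vertex_space"
  shows "tmul P Q \<in> vertex_space"
  using assms(1)
proof (induction rule: vertex_induct)
  case (word P)
  show ?case
    using Q
  proof (induction rule: vertex_induct)
    case (word Q)
    thus ?case using \<open>P \<in> words\<close> by (intro words_vertex words_tmul)
  qed (simp_all add: tmul_linear tmul_zero words_ambient[OF word] vertex_ambient vertex_closed)
qed (simp_all add: tmul_linear tmul_zero vertex_ambient[OF Q] vertex_ambient vertex_closed)

lemma gen_vertex: "i \<in> I \<Longrightarrow> tderiv_div r (gen i) \<in> vertex_space"
  using words_vertex[OF words.cons[OF _ words.nil, of i r]]
  by (simp add: tmul_onet_right tderiv_div_ambient gen_ambient)

text \<open>By the Leibniz rule D differentiates one factor at a time, and on a factor it only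
  raises the divided power, up to a scalar. No factor T is left over.\<close>

lemma vertex_tderiv: "P \<in> vertex_space \<Longrightarrow> tderiv P \<in> vertex_space"
proof (induction rule: vertex_induct)
  case (word P)
  thus ?case
  proof (induction rule: words.induct)
    case nil
    show ?case by (simp add: tderiv_onet vertex_closed)
  next
    case (cons i P r)
    obtain b where b: "tderiv_div r (gen i) = monom b (wt i + r)" using tderiv_div_monom by blast
    have "monom b (wt i + r) \<in> ambient"
      using tderiv_div_ambient[OF gen_ambient[OF cons(1)], of r] by (simp add: b)
    from tderiv_tmul[OF this words_ambient[OF cons(2)], folded b] cons show ?case
      by (simp add: tderiv_tderiv_div vertex_closed vertex_tmul gen_vertex words_vertex del: of_nat_Suc)
  qed
qed (simp_all add: tderiv_add tderiv_scale vertex_closed, simp add: tderiv_def vertex_closed)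

lemma vertex_tderiv_div: "P \<in> vertex_space \<Longrightarrow> tderiv_div r P \<in> vertex_space"
proof -
  assume "P \<in> vertex_space"
  hence "(tderiv ^^ r) P \<in> vertex_space" by (induction r) (simp_all add: vertex_tderiv)
  thus ?thesis by (simp add: tderiv_div_def vertex_closed)
qed

section \<open>The products of all indices on the vertex space\<close>

abbreviation "md \<equiv> prodt scale qq"

lemma md_nonneg: "0 \<le> k \<Longrightarrow> md P k Q = 0"
  by (simp add: prodt_def)

lemma md_neg:
  assumes "k < 0" "P \<in> vertex_space" "Q \<in> vertex_space"
  shows "md P k Q = tmul (tderiv_div (nat (- k - 1)) P) Q"
  using prodt_ambient[OF vertex_ambient vertex_ambient, OF assms(2,3), of "nat (- k - 1)"] assms(1) by simp

lemma md_vertex: "P \<in> vertex_space \<Longrightarrow> Q \<in> vertex_space \<Longrightarrow> md P k Q \<in> vertex_space"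
  by (cases "k < 0") (simp_all add: md_neg md_nonneg vertex_tmul vertex_tderiv_div vertex_closed)

lemma md_linear:
  assumes "P \<in> vertex_space" "P' \<in> vertex_space" "Q \<in> vertex_space"
  shows "md (P + P') k Q = md P k Q + md P' k Q" "md (scaleT c P) k Q = scaleT c (md P k Q)"
    "md Q k (P + P') = md Q k P + md Q k P'" "md Q k (scaleT c P) = scaleT c (md Q k P)"
  using assms
  by (cases "k < 0"; simp add: md_neg md_nonneg vertex_closed tderiv_div_add tderiv_div_scale
      tmul_linear tderiv_div_ambient vertex_ambient)+

lemma md_zero:
  assumes "P \<in> vertex_space"
  shows "md 0 k P = 0" "md P k 0 = 0"
  using md_linear(2)[OF vertex_closed(1) vertex_closed(1) assms, of 0]
    md_linear(4)[OF vertex_closed(1) vertex_closed(1) assms, where c = 0] by simp_all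

lemma onet_vertex: "onet \<in> vertex_space"
  by (rule words_vertex[OF words.nil])

lemma md_onet_left: "P \<in> vertex_space \<Longrightarrow> md onet k P = (if k = - 1 then P else 0)"
  by (cases "k < 0")
     (auto simp: md_neg md_nonneg onet_vertex tderiv_div_onet tmul_zero tmul_onet_left vertex_ambient)

lemma md_onet_right: "P \<in> vertex_space \<Longrightarrow> md P (- 1) onet = P"
  by (simp add: md_neg onet_vertex tmul_onet_right vertex_ambient)

lemma monom_zero_fun [simp]: "monom (\<lambda>v k. 0) n = (0 :: 'v field1 poly)"
  by (rule poly_eqI) (simp add: fun_eq_iff)

text \<open>The spanning elements are homogeneous, so their span contains the homogeneous components
  of each of its members.\<close>

lemma component_vertex: "P \<in> vertex_space \<Longrightarrow> monom (coeff P n) n \<in> vertex_space"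
proof (induction rule: vertex_induct)
  case (word P)
  obtain a \<alpha> where P: "P = monom a \<alpha>" using words_monom[OF word] by blast
  thus ?case using words_vertex[OF word] by (cases "n = \<alpha>") (simp_all add: vertex_closed)
next
  case (add P Q)
  thus ?case by (simp only: coeff_add add_monom[symmetric] vertex_closed)
next
  case (scale c P)
  thus ?case by (simp add: coeff_scalet scalet_monom[symmetric] vertex_closed)
qed (simp add: vertex_closed)

section \<open>Grading by powers of t\<close>

abbreviation "Gr \<equiv> homogt vertex_space"

lemma Gr_vertex: "h \<in> Gr u \<Longrightarrow> h \<in> vertex_space"
  by (auto simp: homogt_def vertex_closed)

lemma Gr_coeff: "h \<in> Gr u \<Longrightarrow> int n \<noteq> u \<Longrightarrow> coeff h n = 0"
  by (auto simp: homogt_def)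

lemma Gr_cases:
  assumes "h \<in> Gr u"
  obtains "h = 0" | a \<alpha> where "h = monom a \<alpha>" "u = int \<alpha>" "monom a \<alpha> \<in> vertex_space"
  using assms by (auto simp: homogt_def)

lemma GrI: "P \<in> vertex_space \<Longrightarrow> P = monom a \<alpha> \<Longrightarrow> int \<alpha> = u \<Longrightarrow> P \<in> Gr u"
  by (auto simp: homogt_def)

lemma Gr_0: "0 \<in> Gr u"
  by (simp add: homogt_def)

lemma subspace_Gr: "T.subspace (Gr u)"
proof (rule T.subspaceI)
  show "P + Q \<in> Gr u" if P: "P \<in> Gr u" and Q: "Q \<in> Gr u" for P Q
    using P
  proof (cases rule: Gr_cases)
    case (2 a \<alpha>)
    from Q show ?thesis
    proof (cases rule: Gr_cases)
      case (2 b \<beta>)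
      with \<open>P = monom a \<alpha>\<close> \<open>u = int \<alpha>\<close> have "P + Q = monom (a + b) \<alpha>" by (simp add: add_monom)
      thus ?thesis using vertex_closed(2)[OF Gr_vertex Gr_vertex, OF P Q] \<open>u = int \<alpha>\<close> by (intro GrI) auto
    qed (use P in simp)
  qed (use Q in simp)
  show "scaleT c P \<in> Gr u" if P: "P \<in> Gr u" for c P
    using P
  proof (cases rule: Gr_cases)
    case (2 a \<alpha>)
    thus ?thesis
      using vertex_closed(3)[OF Gr_vertex[OF P], of c] by (intro GrI) (auto simp: scalet_monom)
  qed (simp add: Gr_0)
qed (rule Gr_0)

lemma coeff_sum_Gr:
  assumes "\<And>u. f u \<in> Gr u" "finite {u. f u \<noteq> 0}"
  shows "coeff (\<Sum>u | f u \<noteq> 0. f u) n = coeff (f (int n)) n"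
proof -
  have "coeff (\<Sum>u | f u \<noteq> 0. f u) n = (\<Sum>u | f u \<noteq> 0. coeff (f u) n)"
    by (rule coeff_sum)
  also have "\<dots> = (\<Sum>u | f u \<noteq> 0. if int n = u then coeff (f (int n)) n else 0)"
    by (intro sum.cong[OF HOL.refl]) (use Gr_coeff[OF assms(1)] in auto)
  also have "\<dots> = coeff (f (int n)) n"
    using assms(2) by (simp add: sum.delta')
  finally show ?thesis .
qed

lemma decomposition:
  assumes P: "P \<in> vertex_space"
  shows "\<exists>!f. (\<forall>u. f u \<in> Gr u) \<and> finite {u. f u \<noteq> 0} \<and> P = (\<Sum>u | f u \<noteq> 0. f u)"
proof (rule ex_ex1I)
  define f where "f u = (if u \<ge> 0 then monom (coeff P (nat u)) (nat u) else 0)" for u :: int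
  have supp: "{u. f u \<noteq> 0} \<subseteq> int ` {..degree P}"
  proof
    fix u assume "u \<in> {u. f u \<noteq> 0}"
    hence "u \<ge> 0" "coeff P (nat u) \<noteq> 0" by (auto simp: f_def split: if_splits)
    thus "u \<in> int ` {..degree P}" using le_degree by (intro image_eqI[of _ _ "nat u"]) auto
  qed
  have "(\<Sum>u | f u \<noteq> 0. f u) = sum f (int ` {..degree P})"
    by (rule sum.mono_neutral_left[OF _ supp]) auto
  also have "\<dots> = (\<Sum>i\<le>degree P. monom (coeff P i) i)"
    by (simp add: sum.reindex f_def)
  also have "\<dots> = P" by (rule poly_as_sum_of_monoms)
  finally have "P = (\<Sum>u | f u \<noteq> 0. f u)" ..
  moreover have "f u \<in> Gr u" for u
    using component_vertex[OF P] by (auto simp: f_def Gr_0 intro: GrI)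
  moreover have "finite {u. f u \<noteq> 0}" by (rule finite_subset[OF supp]) simp
  ultimately show "\<exists>f. (\<forall>u. f u \<in> Gr u) \<and> finite {u. f u \<noteq> 0} \<and> P = (\<Sum>u | f u \<noteq> 0. f u)"
    by blast
next
  fix f g
  assume f: "(\<forall>u. f u \<in> Gr u) \<and> finite {u. f u \<noteq> 0} \<and> P = (\<Sum>u | f u \<noteq> 0. f u)"
    and g: "(\<forall>u. g u \<in> Gr u) \<and> finite {u. g u \<noteq> 0} \<and> P = (\<Sum>u | g u \<noteq> 0. g u)"
  have "coeff (f u) n = coeff (g u) n" for u n
  proof (cases "int n = u")
    case True
    thus ?thesis
      using coeff_sum_Gr[of f n] coeff_sum_Gr[of g n] f g by metis
  next
    case False
    thus ?thesis using Gr_coeff f g by metis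
  qed
  hence "f u = g u" for u by (rule poly_eqI)
  thus "f = g" by (rule ext)
qed

lemma md_Gr:
  assumes P: "P \<in> Gr u" and Q: "Q \<in> Gr s"
  shows "md P r Q \<in> Gr (s + u - r - 1)"
proof (cases "r < 0")
  case True
  show ?thesis
    using P
  proof (cases rule: Gr_cases)
    case 1
    thus ?thesis by (simp add: md_zero Gr_vertex[OF Q] Gr_0)
  next
    case a: (2 a \<alpha>)
    from Q show ?thesis
    proof (cases rule: Gr_cases)
      case 1
      thus ?thesis by (simp add: md_zero Gr_vertex[OF P] Gr_0)
    next
      case (2 b \<beta>)
      let ?r = "nat (- r - 1)"
      obtain c where c: "tderiv_div ?r (monom a \<alpha>) = monom c (\<alpha> + ?r)" using tderiv_div_monom by blast
      have "monom c (\<alpha> + ?r) \<in> ambient"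
        using tderiv_div_ambient[OF vertex_ambient[OF a(3)], of ?r] by (simp add: c)
      hence "md P r Q = monom (fmul (\<alpha> + ?r) c b) (\<alpha> + ?r + \<beta>)"
        using True a 2 by (simp add: md_neg c tmul_monoms)
      thus ?thesis
        by (rule GrI[OF md_vertex[OF Gr_vertex[OF P] Gr_vertex[OF Q]]]) (use a 2 True in simp)
    qed
  qed
qed (simp add: md_nonneg Gr_0)

text \<open>The left side is 0 since \<open>md a r b\<close> is. On the right, for l \<le> r the
  outer product has a nonnegative index, and for l > r the numerator of the binomial contains [0],
  at j = l - r - 1.\<close>

lemma md_assoc_nonneg:
  assumes "0 \<le> r" "a \<in> vertex_space" "b \<in> vertex_space" "c \<in> vertex_space"
  shows "md (md a r b) s c = Sum_any (\<lambda>l::nat.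
    scaleT (nqbinom qq (int l - r - 1) l * qq powi ((s + int l + 1) * (r - u + 1)))
      (md a (r - int l) (md b (s + int l) c)))"
proof -
  have *: "scaleT (nqbinom qq (int l - r - 1) l * qq powi ((s + int l + 1) * (r - u + 1)))
      (md a (r - int l) (md b (s + int l) c)) = 0" for l
  proof (cases "int l \<le> r")
    case True
    thus ?thesis by (simp add: md_nonneg)
  next
    case False
    have "nqbinom qq (int l - r - 1) l = 0"
      unfolding nqbinom_def
      by (rule divide_eq_0_iff[THEN iffD2, OF disjI1], rule prod_zero)
         (use False assms(1) in \<open>auto simp: nqint_def intro!: bexI[of _ "nat (int l - r - 1)"]\<close>)
    thus ?thesis by simp
  qed
  show ?thesis
    unfolding * using assms by (simp add: md_nonneg md_zero)
qed

lemma md_assoc: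
  assumes a: "a \<in> Gr u" and b: "b \<in> vertex_space" and c: "c \<in> vertex_space"
  shows "md (md a r b) s c = Sum_any (\<lambda>l::nat.
    scaleT (nqbinom qq (int l - r - 1) l * qq powi ((s + int l + 1) * (r - u + 1)))
      (md a (r - int l) (md b (s + int l) c)))"
proof -
  note aV = Gr_vertex[OF a]
  consider "0 \<le> r" | "r < 0" "0 \<le> s" | "r < 0" "s < 0" by linarith
  thus ?thesis
  proof cases
    case 1
    thus ?thesis by (rule md_assoc_nonneg) (rule aV b c)+
  next
    case 2
    thus ?thesis by (simp add: md_nonneg md_zero aV)
  next
    case 3
    \<comment> \<open>Both indices are negative now, and the products turn into the divided powers
      of D of orders R and S.\<close>
    define R S where "R = nat (- r - 1)" and "S = nat (- s - 1)"
    have r: "r = - int R - 1" and s: "s = - int S - 1" using 3 by (auto simp: R_def S_def)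
    have md_int: "md P (- int k - 1) Q = tmul (tderiv_div k P) Q"
      if "P \<in> vertex_space" "Q \<in> vertex_space" for P Q k
      using that by (simp add: md_neg)
    from a show ?thesis
    proof (cases rule: Gr_cases)
      case 1
      thus ?thesis by (simp add: md_zero b c md_vertex)
    next
      case (2 a0 \<alpha>)
      let ?term = "\<lambda>l. scaleT (nqbinom qq (int l - r - 1) l * qq powi ((s + int l + 1) * (r - u + 1)))
        (md a (r - int l) (md b (s + int l) c))"
      obtain a1 where a1: "tderiv_div R a = monom a1 (\<alpha> + R)"
        unfolding 2(1) using tderiv_div_monom by blast
      note amb = vertex_ambient[OF aV] vertex_ambient[OF b] vertex_ambient[OF c]
      have a1_amb: "monom a1 (\<alpha> + R) \<in> ambient" using tderiv_div_ambient[OF amb(1), of R] by (simp add: a1)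
      have trm: "?term l = scaleT (qq ^ ((\<alpha> + R) * (S - l)))
          (tmul (tmul (tderiv_div l (tderiv_div R a)) (tderiv_div (S - l) b)) c)" if l: "l \<le> S" for l
      proof -
        \<comment> \<open>Since s + l + 1 = l - S and r - u + 1 = -(\<alpha> + R), this is the
          exponent in the Leibniz rule for \<open>tderiv_div R a\<close>, of degree \<alpha> +
          R.\<close>
        have e1: "(s + int l + 1) * (r - u + 1) = int ((\<alpha> + R) * (S - l))"
        proof -
          obtain m where "S = l + m" using le_Suc_ex[OF l] by blast
          thus ?thesis by (simp add: r s 2(2) algebra_simps)
        qed
        have e2: "int l - r - 1 = int (R + l)" by (simp add: r)
        have e3: "md a (r - int l) (md b (s + int l) c) =
            tmul (tderiv_div (R + l) a) (tmul (tderiv_div (S - l) b) c)"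
        proof -
          have "r - int l = - int (R + l) - 1" "s + int l = - int (S - l) - 1"
            using l by (auto simp: r s of_nat_diff)
          thus ?thesis
            by (simp only: md_int aV b c vertex_tmul vertex_tderiv_div)
        qed
        have "tmul (tmul (tderiv_div l (tderiv_div R a)) (tderiv_div (S - l) b)) c =
            scaleT (nqbinom qq (int (R + l)) l) (tmul (tderiv_div (R + l) a) (tmul (tderiv_div (S - l) b) c))"
          by (simp only: tderiv_div_tderiv_div tmul_scale tmul_assoc tmul_ambient tderiv_div_ambient amb
              ambient_closed)
        thus ?thesis
          by (simp only: e1 e2 e3 power_int_of_nat T.scale_scale
              mult.commute[of "nqbinom qq (int (R + l)) l"])
      qed
      have "md (md a r b) s c = tmul (tderiv_div S (tmul (tderiv_div R a) b)) c"
        by (simp add: r s md_int aV b c vertex_tmul vertex_tderiv_div)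
      also have "\<dots> = tmul (\<Sum>l\<le>S. scaleT (qq ^ ((\<alpha> + R) * (S - l)))
          (tmul (tderiv_div l (tderiv_div R a)) (tderiv_div (S - l) b))) c"
        by (simp only: a1 tderiv_div_tmul[OF a1_amb amb(2)])
      also have "\<dots> = (\<Sum>l\<le>S. ?term l)"
        by (subst tmul_sum_right)
           (auto simp: trm tmul_linear tmul_ambient tderiv_div_ambient amb ambient_closed)
      also have "\<dots> = Sum_any ?term"
      proof (rule Sum_any.expand_superset[symmetric])
        show "{l. ?term l \<noteq> 0} \<subseteq> {..S}"
        proof
          fix l assume l: "l \<in> {l. ?term l \<noteq> 0}"
          have "md b (s + int l) c = 0" if "S < l"
            using that by (intro md_nonneg) (simp add: s)
          with l show "l \<in> {..S}" by (auto simp: md_zero aV not_less[symmetric])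
        qed
      qed simp
      finally show ?thesis .
    qed
  qed
qed

section \<open>The vertex algebra axioms and minimality\<close>

lemma qva_vertex_space: "qva_in_homt scale qq vertex_space"
  unfolding qva_in_homt_def graded_nonlocal_qva_def
proof (intro conjI allI ballI)
  show "vertex_space \<subseteq> homt scale" by (auto intro: ambient_homt vertex_ambient)
  show "quasi_comm scale qq P Q" if "P \<in> vertex_space" "Q \<in> vertex_space" for P Q
    using that by (intro ambient_quasi_comm vertex_ambient)
  show "T.subspace vertex_space" by (simp add: vertex_space_def)
  show "T.subspace (Gr u)" for u by (rule subspace_Gr)
  show "Gr u \<subseteq> vertex_space" for u by (auto intro: Gr_vertex)
  show "\<exists>N. \<forall>r\<ge>N. md a r b = 0" for a b
    by (intro exI[of _ 0]) (simp add: md_nonneg)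
qed (assumption | simp add: md_vertex md_linear md_onet_left md_onet_right onet_vertex md_nonneg md_Gr decomposition |
     rule md_assoc)+

lemma vertex_space_minimal:
  assumes "qva_in_homt scale qq W" "gen ` I \<subseteq> W"
  shows "vertex_space \<subseteq> W"
proof -
  have sub: "T.subspace W" and md: "\<And>a r b. a \<in> W \<Longrightarrow> b \<in> W \<Longrightarrow> md a r b \<in> W" and one: "onet \<in> W"
    using assms(1) by (simp_all add: qva_in_homt_def graded_nonlocal_qva_def)
  have "P \<in> W" if "P \<in> words" for P
    using that
  proof (induction rule: words.induct)
    case (cons i P r)
    have "md (gen i) (- int r - 1) P \<in> W" by (intro md) (use cons assms(2) in auto)
    thus ?case using cons by (simp add: prodt_ambient gen_ambient words_ambient)
  qed (rule one)
  thus ?thesis unfolding vertex_space_def by (intro T.span_minimal sub) blast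
qed

lemma smallest_vertex_space: "smallest_qva_containing scale qq (gen ` I) vertex_space"
  unfolding smallest_qva_containing_def
  using qva_vertex_space vertex_space_minimal gen_vertex[of _ 0] by auto

lemma words_foldr: "words = {foldr (\<lambda>(i, r) P. md (gen i) r P) irs onet | irs. \<forall>(i, r)\<in>set irs. i \<in> I \<and> r < 0}"
proof (intro Set.set_eqI iffI)
  fix P assume "P \<in> words"
  thus "P \<in> {foldr (\<lambda>(i, r) P. md (gen i) r P) irs onet | irs. \<forall>(i, r)\<in>set irs. i \<in> I \<and> r < 0}"
  proof (induction rule: words.induct)
    case nil
    show ?case by (intro CollectI exI[of _ "[]"]) simp
  next
    case (cons i P r)
    then obtain irs where irs: "P = foldr (\<lambda>(i, r) P. md (gen i) r P) irs onet"
      "\<forall>(i, r)\<in>set irs. i \<in> I \<and> r < 0" by blast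
    have "tmul (tderiv_div r (gen i)) P = md (gen i) (- int r - 1) P"
      using cons by (simp add: prodt_ambient gen_ambient words_ambient)
    thus ?case
      using irs cons(1) by (intro CollectI exI[of _ "(i, - int r - 1) # irs"]) auto
  qed
next
  fix P assume "P \<in> {foldr (\<lambda>(i, r) P. md (gen i) r P) irs onet | irs. \<forall>(i, r)\<in>set irs. i \<in> I \<and> r < 0}"
  then obtain irs where P: "P = foldr (\<lambda>(i, r) P. md (gen i) r P) irs onet"
    and irs: "\<forall>(i, r)\<in>set irs. i \<in> I \<and> r < 0" by blast
  show "P \<in> words"
    unfolding P using irs
  proof (induction irs)
    case (Cons ir irs)
    obtain i r where ir: "ir = (i, r)" by (cases ir)
    let ?P = "foldr (\<lambda>(i, r) P. md (gen i) r P) irs onet"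
    have "i \<in> I" "r < 0" "?P \<in> words" using Cons by (auto simp: ir)
    moreover from this have "md (gen i) r ?P = tmul (tderiv_div (nat (- r - 1)) (gen i)) ?P"
      using prodt_ambient[OF gen_ambient words_ambient, of i ?P "nat (- r - 1)"] by simp
    ultimately show ?case by (simp add: ir words.cons)
  qed (simp add: words.nil)
qed

theorem smallest_qva:
  "(\<exists>!V. smallest_qva_containing scale qq (gen ` I) V) \<and>
    (\<forall>V. smallest_qva_containing scale qq (gen ` I) V \<longrightarrow>
      V = module.span scaleT {foldr (\<lambda>(i, r) P. md (gen i) r P) irs onet | irs. \<forall>(i, r)\<in>set irs. i \<in> I \<and> r < 0})"
proof -
  have "V = vertex_space" if "smallest_qva_containing scale qq (gen ` I) V" for V
    using that smallest_vertex_space by (auto simp: smallest_qva_containing_def)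
  with smallest_vertex_space show ?thesis
    unfolding vertex_space_def words_foldr by blast
qed

end

section \<open>The currents of the quantum affine algebra\<close>

lemma hq_power: "hq ^ m = Fract ([:0, 1:] ^ m) 1"
  by (induction m) (simp_all add: hq_def One_fract_def)

lemma hq_power_neq_1: "0 < m \<Longrightarrow> hq ^ m \<noteq> 1"
proof
  assume m: "0 < m" and "hq ^ m = 1"
  hence "[:0, 1 :: complex:] ^ m = 1"
    by (simp add: hq_power One_fract_def eq_fract)
  hence "degree ([:0, 1 :: complex:] ^ m) = 0" by simp
  with m show False by (simp add: degree_power_eq)
qed

lemma qv_nonzero: "qv \<noteq> 0"
proof -
  have "hq \<noteq> 0" by (simp add: hq_def Zero_fract_def eq_fract)
  thus ?thesis by (simp add: qv_def)
qed

lemma qv_powi_eq_1_iff: "qv powi k = 1 \<longleftrightarrow> k = 0"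
proof -
  have pos: "qv ^ m \<noteq> 1" if "0 < m" for m
    using hq_power_neq_1[of "2 * m"] that by (simp add: qv_def power_mult)
  show ?thesis
  proof (cases k rule: int_cases3)
    case (pos n)
    thus ?thesis using \<open>\<And>m. 0 < m \<Longrightarrow> qv ^ m \<noteq> 1\<close>[of n] by simp
  next
    case (neg n)
    thus ?thesis using \<open>\<And>m. 0 < m \<Longrightarrow> qv ^ m \<noteq> 1\<close>[of n] by (simp add: power_int_minus)
  qed simp
qed

lemma sgn_int_cases: "sgn_int s = 1 \<or> sgn_int s = - 1"
  by (cases s) simp_all

lemma qv_powi_mult: "qv powi k * qv powi l = qv powi (k + l)"
  using qv_nonzero by (simp add: power_int_add)

text \<open>Every edge listed in decreasing order ends in node 0, so away from node 0 no edge is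
  listed in both orientations.\<close>

lemma affine_edges_less:
  assumes "ade_valid T" "(i, j) \<in> affine_edges T" "1 \<le> j" "1 \<le> i"
  shows "i < j"
  using assms by (cases T) auto

text \<open>Restricting to nodes other than 0 avoids the entry -2 of \<open>A_type 1\<close>. There
  1 - c x would vanish at x = q, because c = q^-1.\<close>

lemma affine_cartan_cases:
  assumes "ade_valid T" "1 \<le> i" "1 \<le> j"
  shows "affine_cartan T i j \<in> {2, 0, - 1}"
proof (cases "i = j")
  case False
  have "\<not> ((i, j) \<in> affine_edges T \<and> (j, i) \<in> affine_edges T)"
  proof (rule notI, elim conjE)
    assume 1: "(i, j) \<in> affine_edges T" and 2: "(j, i) \<in> affine_edges T"
    show False
      using affine_edges_less[OF assms(1) 1 assms(3,2)] affine_edges_less[OF assms(1) 2 assms(2,3)]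
      by simp
  qed
  thus ?thesis
    using False by (simp add: affine_cartan_def Int_insert_right)
qed (simp add: affine_cartan_def)

lemma affine_ADE_entries:
  assumes "affine_ADE n a" "i \<in> {1..n}" "j \<in> {1..n}"
  shows "a i j \<in> {2, 0, - 1}" and "a i j \<noteq> 2 \<Longrightarrow> i \<noteq> j"
proof -
  obtain T \<sigma> where T: "ade_valid T" "\<sigma> permutes {1..n}"
    and a: "\<forall>i\<le>n. \<forall>j\<le>n. a i j = affine_cartan T (\<sigma> i) (\<sigma> j)"
    using assms(1)[unfolded affine_ADE_def] by (elim exE conjE)
  have "\<sigma> i \<in> {1..n}" "\<sigma> j \<in> {1..n}"
    using permutes_in_image[OF T(2)] assms(2,3) by auto
  hence "affine_cartan T (\<sigma> i) (\<sigma> j) \<in> {2, 0, - 1}"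
    by (intro affine_cartan_cases[OF T(1)]) auto
  thus "a i j \<in> {2, 0, - 1}" using a assms(2,3) by simp
  show "i \<noteq> j" if "a i j \<noteq> 2"
    using that a assms(2,3) by (auto simp: affine_cartan_def)
qed

text \<open>For entry 0 one has m = 1, a single permutation and two terms, so the Serre relation is
  the vanishing of a commutator.\<close>

lemma serre_commuting:
  assumes "a i j = 0"
  shows "serre a s i j l k = sc 1 * (genx s j k * genx s i (l 0)) + sc (- 1) * (genx s i (l 0) * genx s j k)"
proof -
  have "{\<pi>. \<pi> permutes {..<1 :: nat}} = {id}"
    by (auto simp: lessThan_Suc permutes_sing)
  \<comment> \<open>The binomial of 1 over 1 is [1]/[1], which equals 1 only if [1] is
    nonzero.\<close>
  moreover have "qint 1 \<noteq> 0"
  proof -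
    have "qv powi 2 \<noteq> 1" by (simp only: qv_powi_eq_1_iff)
    thus ?thesis using qv_nonzero by (simp add: qint_def power_int_minus power2_eq_square field_simps)
  qed
  hence "qbinom (Suc 0) 0 = 1" "qbinom (Suc 0) (Suc 0) = 1" by (simp_all add: qbinom_def)
  ultimately show ?thesis
    by (simp add: serre_def assms)
qed

section \<open>Exchange relations for the currents\<close>

locale Uq_representation = series_space scale
  for scale :: "Cq \<Rightarrow> 'v::ab_group_add \<Rightarrow> 'v" +
  fixes act :: "free_alg \<Rightarrow> 'v \<Rightarrow> 'v" and n :: nat and a :: "nat \<Rightarrow> nat \<Rightarrow> int" and s :: sign
  assumes ADE: "affine_ADE n a" and rep: "Uq_module n a scale act" and restr: "restricted_module n act"
begin

lemma act_linear: "lin (act X)"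
  and act_sc: "act (sc c) v = scale c v"
  and act_add: "act (X + Y) v = act X v + act Y v"
  and act_mult: "act (X * Y) v = act X (act Y v)"
  and act_eq: "Uq_eq n a X Y \<Longrightarrow> act X v = act Y v"
  using rep by (simp_all add: Uq_module_def)

lemma act_diff: "act (X - Y) v = act X v - act Y v"
  using act_add[of "X - Y" Y v] by simp

lemma act_0: "act 0 v = 0"
  using act_diff[of 0 0 v] by simp

lemma current_hom1: "i \<in> {1..n} \<Longrightarrow> current act s i \<in> hom1 scale"
  unfolding hom1_def mem_Collect_eq
proof (intro conjI allI)
  show "lin (\<lambda>v. current act s i v k)" for k
    using act_linear[of "genx s i (- k - 1)"] by (simp add: current_def)
  fix v assume "i \<in> {1..n}"
  then obtain N where N: "\<forall>r\<ge>N. act (genx s i r) v = 0"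
    using restr unfolding restricted_module_def by blast
  show "\<exists>N. \<forall>k<N. current act s i v k = 0"
    by (rule exI[of _ "- N"]) (use N in \<open>simp add: current_def\<close>)
qed

text \<open>The coefficient of z^k is the mode -k - 1, so \<open>sh2\<close> takes the modes (-k -
  1, -l - 1) to (-k - 2, -l). The quadratic relation, taken at -k - 2 and -l - 1, involves just
  these two pairs; its terms are sorted by the order of the factors.\<close>

lemma current_exchange:
  assumes ij: "i \<in> {1..n}" "j \<in> {1..n}"
  defines "c \<equiv> qv powi (sgn_int s * a i j)"
  shows "exchange [:1, - c:] [:c, - 1:] (current act s i) (current act s j)"
  unfolding exchange_def
proof (intro allI ext, clarify)
  fix v k l
  let ?x = "\<lambda>i k. act (genx s i k)"
  have "?x i (- k - 2 + 1) (?x j (- l - 1) v) - scale c (?x j (- l - 1) (?x i (- k - 2 + 1) v))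
      = scale c (?x i (- k - 2) (?x j (- l - 1 + 1) v)) - ?x j (- l - 1 + 1) (?x i (- k - 2) v)"
    using act_eq[OF Uq_eq.base[OF Uq_rel.x_x[OF ij, of a s "- k - 2" "- l - 1"]], of v]
    by (simp only: act_diff act_mult act_sc c_def)
  moreover have "- k - 2 + 1 = - k - 1" "- l - 1 + 1 = - l" by simp_all
  ultimately have "?x i (- k - 1) (?x j (- l - 1) v) - scale c (?x j (- l - 1) (?x i (- k - 1) v))
      = scale c (?x i (- k - 2) (?x j (- l) v)) - ?x j (- l) (?x i (- k - 2) v)"
    by (simp only:)
  thus "pmul [:1, - c:] sh2 (\<lambda>(k, l). current act s i (current act s j v l) k) (k, l)
      = pmul [:c, - 1:] sh2 (\<lambda>(k, l). current act s j (current act s i v k) l) (k, l)"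
    by (simp add: current_def sh2_def algebra_simps)
qed

text \<open>Here c = 1, and 1 - x vanishes at q^0 = 1; a relation without that factor is needed, and
  the Serre relation provides it.\<close>

lemma current_commute:
  assumes ij: "i \<in> {1..n}" "j \<in> {1..n}" "a i j = 0"
  shows "exchange 1 1 (current act s i) (current act s j)"
  unfolding exchange_def
proof (intro allI ext, clarify)
  fix v k l
  have "i \<noteq> j" using affine_ADE_entries(2)[OF ADE ij(1,2)] ij(3) by simp
  from act_eq[OF Uq_eq.base[OF Uq_rel.serre[OF ij(1,2) this, of a s "\<lambda>_. - k - 1" "- l - 1"]], of v]
  have "act (genx s j (- l - 1)) (act (genx s i (- k - 1)) v)
      = act (genx s i (- k - 1)) (act (genx s j (- l - 1)) v)"
    by (simp add: serre_commuting[where a = a, OF ij(3)] act_add act_mult act_sc act_0)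
  thus "pmul 1 sh2 (\<lambda>(k, l). current act s i (current act s j v l) k) (k, l)
      = pmul 1 sh2 (\<lambda>(k, l). current act s j (current act s i v k) l) (k, l)"
    by (simp add: current_def)
qed

end

theorem corollary2p18:
  fixes scale :: "Cq \<Rightarrow> 'v::ab_group_add \<Rightarrow> 'v"
    and act :: "free_alg \<Rightarrow> 'v \<Rightarrow> 'v"
    and n :: nat
    and a :: "nat \<Rightarrow> nat \<Rightarrow> int"
    and s :: sign
    and \<alpha> :: "nat \<Rightarrow> nat"
    and qq :: Cq
    and x :: "nat \<Rightarrow> 'v field1 poly"
  assumes "affine_ADE n a"
    and "Uq_module n a scale act"
    and "restricted_module n act"
    and qq_def: "qq = qv powi (2 * sgn_int s)"
    and x_def: "\<And>i. x i = monom (current act s i) (\<alpha> i)"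
  shows "(\<exists>!V. smallest_qva_containing scale qq (x ` {1..n}) V) \<and>
    (\<forall>V. smallest_qva_containing scale qq (x ` {1..n}) V \<longrightarrow>
      V = module.span (scalet scale)
        {foldr (\<lambda>(i, r) P. prodt scale qq (x i) r P) irs onet |irs :: (nat \<times> int) list.
          \<forall>(i, r)\<in>set irs. i \<in> {1..n} \<and> r < 0})"
proof -
  interpret vector_space scale
    using assms(2) by (simp add: Uq_module_def)
  interpret Uq_representation scale act n a s
    by unfold_locales (rule assms(1), rule assms(2), rule assms(3))
  have qq_powi: "qq ^ m = qv powi (2 * sgn_int s * int m)" for m
    by (simp add: qq_def power_int_mult)
  interpret q_series_space scale qq
  proof unfold_locales
    show "qq \<noteq> 0" using qv_nonzero by (simp add: qq_def)
    show "qq ^ m \<noteq> 1" if "0 < m" for m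
      using that sgn_int_cases[of s] by (auto simp only: qq_powi qv_powi_eq_1_iff)
  qed
  have loc: "q_local (\<alpha> i) (current act s i) (current act s j)"
    if ij: "i \<in> {1..n}" "j \<in> {1..n}" for i j
  proof -
    have "\<exists>p\<in>nice. \<exists>p'. exchange p p' (current act s i) (current act s j)"
    proof (cases "a i j = 0")
      case True
      show ?thesis
        using current_commute[OF ij True] poly0_nice[OF poly0_1] by blast
    next
      case False
      \<comment> \<open>The exponent of q^m c, up to sign: for entry 2 it is positive, for entry -1
        it is odd.\<close>
      have "a i j + 2 * int m \<noteq> 0" for m
        using affine_ADE_entries(1)[OF ADE ij] False by (auto; presburger)
      moreover have "qq ^ m * qv powi (sgn_int s * a i j) = qv powi (sgn_int s * (a i j + 2 * int m))" for m
        by (simp add: qq_powi qv_powi_mult algebra_simps)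
      ultimately have "qq ^ m * qv powi (sgn_int s * a i j) \<noteq> 1" for m
        using sgn_int_cases[of s] by (auto simp: qv_powi_eq_1_iff)
      hence "[:1, - (qv powi (sgn_int s * a i j)):] \<in> nice"
        by (auto simp: nice_def)
      thus ?thesis
        using current_exchange[OF ij] by blast
    qed
    then obtain p p' where "p \<in> nice" "exchange p p' (current act s i) (current act s j)" by blast
    \<comment> \<open>The relation found so far is untwisted; the twist by q^(\<alpha> i) replaces
      p(x) by p(q^(\<alpha> i) x), which is still in \<open>nice\<close>.\<close>
    thus ?thesis
      unfolding q_local_def
      using exchange_dilate_right[OF _ current_hom1[OF ij(1)] qpow_nonzero] nice_pcompose by blast
  qed
  interpret q_currents scale qq "{1..n}" "current act s" \<alpha>
    by unfold_locales (rule current_hom1, assumption, rule loc)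
  have x: "x = gen" by (rule ext) (rule x_def)
  show ?thesis
    unfolding x by (rule smallest_qva)
qed

end
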